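(* Let $p\in(0,1)$ be fixed and let $A_n(p)$ be the adjacency matrix of the random graph $G(n,p)$. Let $v_1,\dots,v_n$ be the unit eigenvectors of $A_n(p)$, and let $v_i(j)$ denote the $j$th coordinate of $v_i$. Then, for any $\alpha>0$, there exist constants $C,c_1>0$ (depending on $p,\alpha$) such that, for any $\delta>n^{-\alpha}$, $$\sup_{1\le i\le n-1}\ \sup_{1\le j\le n}\mathbb{P}\left(|v_i(j)|\le\frac{\delta}{\sqrt n\,(\log n)^{c_1}}\right)\le Cn^{o(1)}\delta+o(1).$$ Here the rate of convergence to zero implicit in the $o(1)$ terms (as $n\to\infty$) depends on $p,\alpha$.
   Context: $G(n,p)$ is the Erdős–Rényi random graph: a simple graph on $n$ vertices in which each edge $\{i,j\}$, $i\ne j$, is present with probability $p$ independently of other edges; $A_n(p)$ is its zero-one adjacency matrix. For a real symmetric matrix $M$, $\lambda_1(M)\le\cdots\le\lambda_n(M)$ are the ordered eigenvalues and $v_1(M),\dots,v_n(M)$ is any orthonormal basis with $Mv_i(M)=\lambda_i(M)v_i(M)$ (so $v_n$ corresponds to the largest eigenvalue); if the spectrum is simple, eigenvectors are normalized so that their first non-zero coordinate is positive. $o(1)$ denotes a term tending to zero as $n\to\infty$. *)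

theory Defs
  imports
    "HOL-Probability.Product_PMF"
    "Jordan_Normal_Form.Char_Poly"
begin

text \<open>
  Graphs on \<open>n\<close> vertices have vertex set \<open>{..<n}\<close> and are represented by their edge sets, whose
  elements are two-element sets of vertices. Vertices, matrix rows and columns, eigenvalues and
  eigenvectors are all numbered from \<open>0\<close>, following the convention of \<open>Jordan_Normal_Form\<close>.
\<close>

definition all_edges :: "nat \<Rightarrow> nat set set" where
  "all_edges n = {e. e \<subseteq> {..<n} \<and> card e = 2}"

definition random_graph :: "nat \<Rightarrow> real \<Rightarrow> nat set set pmf" where
  "random_graph n p =
     map_pmf (\<lambda>f. {e \<in> all_edges n. f e}) (Pi_pmf (all_edges n) False (\<lambda>_. bernoulli_pmf p))"

text \<open>The diagonal vanishes, since the singleton \<open>{i, i}\<close> is never an edge.\<close>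

definition adjacency_mat :: "nat \<Rightarrow> nat set set \<Rightarrow> real mat" where
  "adjacency_mat n E = Matrix.mat n n (\<lambda>(i, j). if {i, j} \<in> E then 1 else 0)"

text \<open>The real eigenvalues in increasing order, repeated according to their multiplicity as roots of
  the characteristic polynomial; for a real symmetric matrix this is the whole spectrum.\<close>

definition ordered_eigenvalues :: "real mat \<Rightarrow> real list" where
  "ordered_eigenvalues M = sorted_list_of_multiset (proots (char_poly M))"

definition simple_spectrum :: "real mat \<Rightarrow> bool" where
  "simple_spectrum M \<longleftrightarrow> distinct (ordered_eigenvalues M)"

definition first_nonzero_pos :: "real vec \<Rightarrow> bool" where
  "first_nonzero_pos v \<longleftrightarrow>
     (\<exists>k < dim_vec v. vec_index v k > 0 \<and> (\<forall>m < k. vec_index v m = 0))"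

text \<open>\<open>v\<close> enumerates an orthonormal basis with \<open>v i\<close> an eigenvector for the \<open>i\<close>-th smallest eigenvalue.
  Only the values \<open>v i\<close> with \<open>i < dim_row M\<close> matter. The sign of the eigenvectors is fixed only
  if the spectrum is simple.\<close>

definition ordered_eigenbasis :: "real mat \<Rightarrow> (nat \<Rightarrow> real vec) \<Rightarrow> bool" where
  "ordered_eigenbasis M v \<longleftrightarrow>
     (\<forall>i < dim_row M. v i \<in> carrier_vec (dim_row M)) \<and>
     (\<forall>i < dim_row M. \<forall>j < dim_row M. scalar_prod (v i) (v j) = (if i = j then 1 else 0)) \<and>
     (\<forall>i < dim_row M. M *\<^sub>v v i = (ordered_eigenvalues M ! i) \<cdot>\<^sub>v v i) \<and>
     (simple_spectrum M \<longrightarrow> (\<forall>i < dim_row M. first_nonzero_pos (v i)))"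

text \<open>A choice of eigenvectors \<open>V M i\<close> for every real symmetric matrix \<open>M\<close> of any size
  (the condition that \<open>M\<close> equals its transpose forces \<open>M\<close> to be square).\<close>

definition eigenvector_choice :: "(real mat \<Rightarrow> nat \<Rightarrow> real vec) \<Rightarrow> bool" where
  "eigenvector_choice V \<longleftrightarrow> (\<forall>M. transpose_mat M = M \<longrightarrow> ordered_eigenbasis M (V M))"

end

theory Submission
  imports Defs "HOL-Probability.Hoeffding" "HOL-Combinatorics.Transposition" "HOL-Real_Asymp.Real_Asymp"
begin

text \<open>
  It suffices to show, for fixed \<open>\<epsilon>, \<eta> > 0\<close>, that \<open>|v\<^sub>i(j)| \<le> n^(-1/2-\<epsilon>)\<close> has probability at most \<open>\<eta>\<close> for large \<open>n\<close>,
  uniformly in \<open>i\<close> and \<open>j\<close>; a diagonal choice of \<open>\<epsilon>, \<eta> \<rightarrow> 0\<close> then produces the two \<open>o(1)\<close> terms. As the law of the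
  graph is exchangeable, this follows if with high probability every eigenvector has at most \<open>\<eta> n\<close> such
  coordinates and the \<open>i\<close>-th eigenvalue is simple.

  Let \<open>J\<close> be the set of small coordinates of an eigenvector \<open>x\<close>, \<open>I\<close> its complement and \<open>u = x|\<^sub>I\<close>. Then
  \<open>(A\<^sub>I\<^sub>I - \<lambda>) u\<close> is nearly constant, so \<open>u\<close> lies near the span of the singular vectors of \<open>A\<^sub>I\<^sub>I - \<lambda>\<close>, bordered by a
  constant column, with singular value at most \<open>n^(1/2-\<epsilon>/2)\<close>. This space has small dimension: a large one would,
  by restricted invertibility, force many rows of \<open>A\<close> in succession to be almost orthogonal to large spaces
  determined by the other entries, which Chebyshev's inequality excludes. A net on the space together with the
  small ball bound for the independent rows in \<open>J\<close> shows that \<open>A\<^sub>J\<^sub>I u\<close> is not nearly constant.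

  If the \<open>i\<close>-th eigenvalue is multiple, then by interlacing it is one of two eigenvalues of the graph without
  its last vertex, and an eigenvector with nonzero last coordinate forces the last column to be orthogonal to
  the corresponding eigenvector of the smaller graph, an event to which the small ball bound applies.
\<close>

section \<open>Random subsets and small ball probabilities\<close>

text \<open>Probabilities are compared on the scale exp(c n log n). A union over the 2^n sets
  \<open>J\<close> is negligible there, while a net of polynomial mesh on a space of dimension d
  costs exp(O(d log n)). The small ball bound gains a fixed negative power of n for each of about
  \<eta> n rows in \<open>J\<close>, so the net is affordable only if d is a small multiple of n;
  this dictates how small the window dimension must be. To exclude larger windows, a failure
  probability O(1/n) per row is enough, because it is collected over a constant multiple of n rows.
  A second obstacle is the mean p of the entries, which makes the largest eigenvalue of order n and
  spoils norm bounds. It is met in three ways: by centring (\<open>norm_ok\<close>), by working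
  orthogonally to the all-ones vector (\<open>proj_small_ball\<close>, \<open>ev_bounded\<close>),
  and by carrying an unknown constant \<beta> or \<gamma> that is itself put on a net. The
  eigenvalue depends on the graph as well, so it too is replaced by a point of a net before any
  probability is estimated.\<close>

locale bernoulli_sets =
  fixes p :: real
  assumes p_pos: "0 < p" and p_less_1: "p < 1"
begin

text \<open>With a finite sum as expectation, conditioning on some of the edges is iterated
  summation (\<open>EV_Un\<close>, \<open>EV_split\<close>). The link to \<open>random_graph\<close>
  is \<open>prob_random_graph\<close>.\<close>

definition EV :: "'a set \<Rightarrow> ('a set \<Rightarrow> real) \<Rightarrow> real" where
  "EV S H = (\<Sum>B\<in>Pow S. p ^ card B * (1 - p) ^ card (S - B) * H B)"

definition Pr :: "'a set \<Rightarrow> ('a set \<Rightarrow> bool) \<Rightarrow> real" where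
  "Pr S P = EV S (\<lambda>B. of_bool (P B))"

lemma EV_empty [simp]: "EV {} H = H {}"
  by (simp add: EV_def)

lemma EV_insert:
  assumes "finite S" "e \<notin> S"
  shows "EV (insert e S) H = p * EV S (\<lambda>B. H (insert e B)) + (1 - p) * EV S H"
proof -
  have disj: "Pow S \<inter> insert e ` Pow S = {}" using assms by auto
  have inj: "inj_on (insert e) (Pow S)" using assms
    by (auto simp: inj_on_def)
  have fin: "finite B" "e \<notin> B" if "B \<in> Pow S" for B
    using that assms finite_subset by auto
  have "EV (insert e S) H =
     (\<Sum>B\<in>Pow S. p ^ card B * (1 - p) ^ card (insert e S - B) * H B)
   + (\<Sum>B\<in>insert e ` Pow S. p ^ card B * (1 - p) ^ card (insert e S - B) * H B)"
    unfolding EV_def Pow_insert using assms disj by (subst sum.union_disjoint) auto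
  also have "(\<Sum>B\<in>Pow S. p ^ card B * (1 - p) ^ card (insert e S - B) * H B) = (1 - p) * EV S H"
    unfolding EV_def sum_distrib_left
  proof (rule sum.cong, simp, goal_cases)
    case (1 B)
    have "insert e S - B = insert e (S - B)" using fin[OF 1] by auto
    then show ?case using assms by (simp add: algebra_simps)
  qed
  also have "(\<Sum>B\<in>insert e ` Pow S. p ^ card B * (1 - p) ^ card (insert e S - B) * H B)
      = p * EV S (\<lambda>B. H (insert e B))"
    unfolding EV_def sum_distrib_left sum.reindex[OF inj]
  proof (rule sum.cong, simp, goal_cases)
    case (1 B)
    have "insert e S - insert e B = S - B" using fin[OF 1] assms by auto
    then show ?case using fin[OF 1] by simp
  qed
  finally show ?thesis by simp
qed

lemma EV_cong: "(\<And>B. B \<subseteq> S \<Longrightarrow> H B = H' B) \<Longrightarrow> EV S H = EV S H'"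
  unfolding EV_def by (rule sum.cong) auto

lemma EV_mono: "(\<And>B. B \<subseteq> S \<Longrightarrow> H B \<le> H' B) \<Longrightarrow> EV S H \<le> EV S H'"
  unfolding EV_def using p_pos p_less_1 by (intro sum_mono mult_left_mono) auto

lemma EV_add: "EV S (\<lambda>B. H B + H' B) = EV S H + EV S H'"
  by (simp add: EV_def algebra_simps sum.distrib)

lemma EV_diff: "EV S (\<lambda>B. H B - H' B) = EV S H - EV S H'"
  by (simp add: EV_def algebra_simps sum_subtractf)

lemma EV_cmult: "EV S (\<lambda>B. c * H B) = c * EV S H"
  by (simp add: EV_def algebra_simps sum_distrib_left)

lemma EV_sum: "EV S (\<lambda>B. \<Sum>x\<in>X. H x B) = (\<Sum>x\<in>X. EV S (H x))"
  unfolding EV_def sum_distrib_left by (rule sum.swap)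

lemma EV_const [simp]: "finite S \<Longrightarrow> EV S (\<lambda>_. c) = c"
  by (induction S rule: finite_induct) (auto simp: EV_insert algebra_simps)

lemma EV_nonneg: "(\<And>B. B \<subseteq> S \<Longrightarrow> 0 \<le> H B) \<Longrightarrow> 0 \<le> EV S H"
  using EV_mono[of S "\<lambda>_. 0" H] by (simp add: EV_def)

lemma EV_Un:
  assumes "finite S" "finite T" "S \<inter> T = {}"
  shows "EV (S \<union> T) H = EV S (\<lambda>B. EV T (\<lambda>C. H (B \<union> C)))"
  using assms(2,3)
proof (induction T arbitrary: H rule: finite_induct)
  case (insert e T)
  have "EV (S \<union> insert e T) H = p * EV (S \<union> T) (\<lambda>B. H (insert e B)) + (1 - p) * EV (S \<union> T) H"
    using insert assms(1) by (simp add: EV_insert)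
  also have "\<dots> = p * EV S (\<lambda>B. EV T (\<lambda>C. H (insert e (B \<union> C)))) + (1 - p) * EV S (\<lambda>B. EV T (\<lambda>C. H (B \<union> C)))"
    using insert by simp
  also have "\<dots> = EV S (\<lambda>B. EV (insert e T) (\<lambda>C. H (B \<union> C)))"
    using insert by (simp add: EV_insert EV_add EV_cmult)
  finally show ?case .
qed simp

lemma EV_split:
  assumes "finite S" "T \<subseteq> S"
  shows "EV S H = EV (S - T) (\<lambda>B. EV T (\<lambda>C. H (B \<union> C)))"
proof -
  have "S = (S - T) \<union> T" using assms by auto
  then show ?thesis using EV_Un[of "S - T" T H] assms finite_subset by auto
qed

lemma Pr_mono: "(\<And>B. B \<subseteq> S \<Longrightarrow> P B \<Longrightarrow> Q B) \<Longrightarrow> Pr S P \<le> Pr S Q"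
  unfolding Pr_def by (rule EV_mono) (auto simp: of_bool_def)

lemma Pr_cong: "(\<And>B. B \<subseteq> S \<Longrightarrow> P B = Q B) \<Longrightarrow> Pr S P = Pr S Q"
  unfolding Pr_def by (rule EV_cong) auto

lemma Pr_le_1: "finite S \<Longrightarrow> Pr S P \<le> 1"
  using EV_mono[of S "\<lambda>B. of_bool (P B)" "\<lambda>_. 1"] by (simp add: Pr_def)

lemma Pr_disj_le: "Pr S (\<lambda>B. P B \<or> Q B) \<le> Pr S P + Pr S Q"
  unfolding Pr_def EV_add[symmetric] by (rule EV_mono) auto

lemma Pr_Bex_le:
  assumes "finite X"
  shows "Pr S (\<lambda>B. \<exists>x\<in>X. P x B) \<le> (\<Sum>x\<in>X. Pr S (P x))"
proof -
  have "Pr S (\<lambda>B. \<exists>x\<in>X. P x B) \<le> EV S (\<lambda>B. \<Sum>x\<in>X. of_bool (P x B))"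
    unfolding Pr_def
  proof (rule EV_mono)
    fix B
    show "of_bool (\<exists>x\<in>X. P x B) \<le> (\<Sum>x\<in>X. of_bool (P x B) :: real)"
    proof (cases "\<exists>x\<in>X. P x B")
      case True
      then obtain x where x: "x \<in> X" "P x B" by auto
      have "(\<Sum>x\<in>X. of_bool (P x B) :: real) \<ge> of_bool (P x B)"
        using assms x(1) by (intro member_le_sum) auto
      then show ?thesis using x by auto
    qed (auto intro: sum_nonneg)
  qed
  then show ?thesis by (simp add: EV_sum Pr_def)
qed

lemma Pr_Bex_le_card:
  assumes "finite X" "\<And>x. x \<in> X \<Longrightarrow> Pr S (P x) \<le> \<rho>"
  shows "Pr S (\<lambda>B. \<exists>x\<in>X. P x B) \<le> real (card X) * \<rho>"
  using Pr_Bex_le[OF assms(1), of S P] sum_bounded_above[of X "\<lambda>x. Pr S (P x)" \<rho>] assms by auto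

lemma Pr_markov:
  assumes "\<And>B. B \<subseteq> S \<Longrightarrow> 0 \<le> H B" "\<And>B. B \<subseteq> S \<Longrightarrow> P B \<Longrightarrow> c \<le> H B"
  shows "c * Pr S P \<le> EV S H"
  unfolding Pr_def EV_cmult[symmetric] using assms by (intro EV_mono) (auto simp: of_bool_def)

text \<open>The part off \<open>T\<close> is revealed first. The event \<open>F\<close> may depend on \<open>T\<close> as long as it persists when the part
  in \<open>T\<close> is erased.\<close>

lemma Pr_conj_le:
  assumes "finite S" "T \<subseteq> S"
    and "\<And>B C. B \<subseteq> S - T \<Longrightarrow> C \<subseteq> T \<Longrightarrow> F (B \<union> C) \<Longrightarrow> F B"
    and "\<And>B. B \<subseteq> S - T \<Longrightarrow> F B \<Longrightarrow> Pr T (\<lambda>C. G (B \<union> C)) \<le> \<rho>"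
  shows "Pr S (\<lambda>B. F B \<and> G B) \<le> \<rho> * Pr (S - T) F"
proof -
  have "Pr S (\<lambda>B. F B \<and> G B) = EV (S - T) (\<lambda>B. EV T (\<lambda>C. of_bool (F (B \<union> C) \<and> G (B \<union> C))))"
    unfolding Pr_def by (rule EV_split[OF assms(1,2)])
  also have "\<dots> \<le> EV (S - T) (\<lambda>B. \<rho> * of_bool (F B))"
  proof (rule EV_mono)
    fix B assume B: "B \<subseteq> S - T"
    show "EV T (\<lambda>C. of_bool (F (B \<union> C) \<and> G (B \<union> C))) \<le> \<rho> * of_bool (F B)"
    proof (cases "F B")
      case True
      have "EV T (\<lambda>C. of_bool (F (B \<union> C) \<and> G (B \<union> C))) \<le> Pr T (\<lambda>C. G (B \<union> C))"
        unfolding Pr_def by (rule EV_mono) auto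
      then show ?thesis using assms(4)[OF B] True by auto
    next
      case False
      have "EV T (\<lambda>C. of_bool (F (B \<union> C) \<and> G (B \<union> C))) = EV T (\<lambda>C. 0)"
        using assms(3)[OF B] False by (intro EV_cong) auto
      then show ?thesis using False by (simp add: EV_def)
    qed
  qed
  finally show ?thesis by (simp add: EV_cmult Pr_def)
qed

lemma Pr_cond_le:
  assumes "finite S" "T \<subseteq> S" "\<And>B. B \<subseteq> S - T \<Longrightarrow> Pr T (\<lambda>C. G (B \<union> C)) \<le> \<rho>"
  shows "Pr S G \<le> \<rho>"
  using Pr_conj_le[of S T "\<lambda>_. True" G \<rho>] assms by (simp add: Pr_def)

lemma EV_reindex:
  assumes "bij_betw \<phi> S T"
  shows "EV T H = EV S (\<lambda>B. H (\<phi> ` B))"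
proof -
  have inj: "inj_on \<phi> S" and T: "T = \<phi> ` S" using assms by (auto simp: bij_betw_def)
  have b: "bij_betw ((`) \<phi>) (Pow S) (Pow T)"
    using assms bij_betw_Pow by blast
  show ?thesis unfolding EV_def
  proof (subst sum.reindex_bij_betw[OF b, symmetric], rule sum.cong, simp, goal_cases)
    case (1 B)
    then have B: "B \<subseteq> S" by auto
    have "card (\<phi> ` B) = card B" using inj B by (meson card_image inj_on_subset)
    moreover have "T - \<phi> ` B = \<phi> ` (S - B)" unfolding T using inj B by (simp add: inj_on_image_set_diff)
    moreover have "card (\<phi> ` (S - B)) = card (S - B)" by (meson Diff_subset card_image inj inj_on_subset)
    ultimately show ?case by simp
  qed
qed

end

section \<open>The random graph as a Bernoulli set of edges\<close>

lemma finite_all_edges: "finite (all_edges n)"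
  by (rule finite_subset[of _ "Pow {..<n}"]) (auto simp: all_edges_def)

context bernoulli_sets begin

lemma expectation_Pi_bernoulli:
  assumes "finite S"
  shows "measure_pmf.expectation (Pi_pmf S False (\<lambda>_. bernoulli_pmf p)) (\<lambda>f. H {e\<in>S. f e}) = EV S H"
  using assms
proof (induction S arbitrary: H rule: finite_induct)
  case (insert e S)
  let ?M = "Pi_pmf S False (\<lambda>_. bernoulli_pmf p)"
  have fin: "finite (set_pmf ?M)"
    by (rule finite_subset[OF set_Pi_pmf_subset'[OF insert(1)]]) (auto intro!: finite_PiE_dflt insert(1))
  have ins: "Pi_pmf (insert e S) False (\<lambda>_. bernoulli_pmf p)
      = bernoulli_pmf p \<bind> (\<lambda>b. map_pmf (\<lambda>f. f(e := b)) ?M)"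
    unfolding Pi_pmf_insert'[OF insert(1,2)] map_pmf_def ..
  have "measure_pmf.expectation (Pi_pmf (insert e S) False (\<lambda>_. bernoulli_pmf p)) (\<lambda>f. H {x\<in>insert e S. f x}) =
     (\<Sum>b\<in>UNIV. pmf (bernoulli_pmf p) b *\<^sub>R
        measure_pmf.expectation (map_pmf (\<lambda>f. f(e := b)) ?M) (\<lambda>f. H {x\<in>insert e S. f x}))"
    unfolding ins by (rule pmf_expectation_bind) (use fin in auto)
  also have "\<dots> = p * measure_pmf.expectation ?M (\<lambda>f. H {x\<in>insert e S. (f(e := True)) x}) 
      + (1 - p) * measure_pmf.expectation ?M (\<lambda>f. H {x\<in>insert e S. (f(e := False)) x})"
    using p_pos p_less_1 by (simp add: UNIV_bool)
  also have "(\<lambda>f. H {x\<in>insert e S. (f(e := True)) x}) = (\<lambda>f. H (insert e {x\<in>S. f x}))"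
    using insert(2) by (intro ext arg_cong[of _ _ H]) auto
  also have "(\<lambda>f. H {x\<in>insert e S. (f(e := False)) x}) = (\<lambda>f. H {x\<in>S. f x})"
    using insert(2) by (intro ext arg_cong[of _ _ H]) auto
  finally show ?case using insert.IH[of H] insert.IH[of "\<lambda>B. H (insert e B)"] insert(1,2)
    by (simp add: EV_insert del: insert_iff)
qed simp

lemma prob_random_graph:
  "measure_pmf.prob (random_graph n p) X = Pr (all_edges n) (\<lambda>B. B \<in> X)"
proof -
  have "measure_pmf.prob (random_graph n p) X = measure_pmf.expectation (random_graph n p) (indicator X)"
    by simp
  also have "\<dots> = EV (all_edges n) (indicator X)"
    unfolding random_graph_def integral_map_pmf
    by (rule expectation_Pi_bernoulli[OF finite_all_edges])
  also have "\<dots> = Pr (all_edges n) (\<lambda>B. B \<in> X)"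
    unfolding Pr_def by (rule EV_cong) (simp add: indicator_def)
  finally show ?thesis .
qed

end

text \<open>For \<open>r\<close> outside \<open>I\<close> these edges carry the entries of row
  \<open>r\<close> in the columns \<open>I\<close>. Stars of distinct vertices outside
  \<open>I\<close> are disjoint; all independence of rows comes from this.\<close>

definition star :: "nat \<Rightarrow> nat set \<Rightarrow> nat set set" where
  "star r I = (\<lambda>i. {r, i}) ` I"

definition adj :: "nat set set \<Rightarrow> nat \<Rightarrow> nat \<Rightarrow> real" where
  "adj B i j = of_bool ({i, j} \<in> B)"

definition row_sum :: "nat set set \<Rightarrow> nat set \<Rightarrow> (nat \<Rightarrow> real) \<Rightarrow> nat \<Rightarrow> real" where
  "row_sum B I u r = (\<Sum>i\<in>I. adj B r i * u i)"

lemma adj_commute: "adj B i j = adj B j i"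
  by (simp add: adj_def insert_commute)

lemma finite_star [simp]: "finite I \<Longrightarrow> finite (star r I)"
  by (simp add: star_def)

text \<open>A subset of size at most \<open>k\<close> is read off from a list of length exactly
  \<open>k\<close> over \<open>R\<close> and one padding symbol \<open>None\<close>.\<close>

lemma card_small_subsets:
  assumes "finite R"
  shows "card {D. D \<subseteq> R \<and> card D \<le> k} \<le> (card R + 1) ^ k"
proof -
  let ?A = "insert None (Some ` R)"
  let ?L = "{xs. set xs \<subseteq> ?A \<and> length xs = k}"
  have "{D. D \<subseteq> R \<and> card D \<le> k} \<subseteq> (\<lambda>xs. {x. Some x \<in> set xs}) ` ?L"
  proof
    fix D assume "D \<in> {D. D \<subseteq> R \<and> card D \<le> k}"
    then have D: "D \<subseteq> R" "card D \<le> k" by auto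
    obtain ys where ys': "set ys = D" "distinct ys"
      using finite_distinct_list[OF finite_subset[OF D(1) assms]] by blast
    have ys: "set ys = D" "length ys = card D"
      using distinct_card[OF ys'(2)] ys'(1) by auto
    let ?xs = "map Some ys @ replicate (k - card D) None"
    have L: "?xs \<in> ?L" using ys D by auto
    have "D = {x. Some x \<in> set ?xs}" unfolding ys(1)[symmetric] by (auto simp: image_iff)
    then show "D \<in> (\<lambda>xs. {x. Some x \<in> set xs}) ` ?L" using L by (rule image_eqI)
  qed
  moreover have finL: "finite ?L" using assms by (intro finite_lists_length_eq) auto
  ultimately have "card {D. D \<subseteq> R \<and> card D \<le> k} \<le> card ((\<lambda>xs. {x. Some x \<in> set xs}) ` ?L)"
    by (intro card_mono) auto
  also have "\<dots> \<le> card ?L" using finL by (rule card_image_le)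
  also have "card ?L = card ?A ^ k" using assms by (intro card_lists_length_eq) auto
  also have "card ?A = card R + 1"
    using assms by (subst card_insert_disjoint) (auto simp: card_image)
  finally show ?thesis .
qed

section \<open>Small ball bounds for weighted Bernoulli sums and for rows\<close>

context bernoulli_sets begin

lemma EV_point:
  assumes "finite S" "e \<in> S"
  shows "EV S H = p * EV S (\<lambda>B. H (insert e B)) + (1 - p) * EV S (\<lambda>B. H (B - {e}))"
proof -
  obtain S' where S: "S = insert e S'" "e \<notin> S'" using assms(2) by (meson mk_disjoint_insert)
  have fin: "finite S'" using assms S by simp
  have *: "EV S' (\<lambda>B. H (B - {e})) = EV S' H"
  proof (rule EV_cong)
    fix B assume "B \<subseteq> S'"
    then have "B - {e} = B" using S(2) by auto
    then show "H (B - {e}) = H B" by simp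
  qed
  show ?thesis unfolding S(1) EV_insert[OF fin S(2)] using *
    by (simp add: algebra_simps)
qed

text \<open>Discrete integration by parts in one coordinate: testing against the centred indicator
  becomes the effect of switching \<open>e\<close>.\<close>

lemma EV_score:
  assumes "finite S" "e \<in> S"
  shows "EV S (\<lambda>B. (of_bool (e \<in> B) - p) * H B)
       = p * (1 - p) * EV S (\<lambda>B. H (insert e B) - H (B - {e}))"
  using EV_cmult[of S "- p" "\<lambda>B. H (B - {e})"]
  by (subst EV_point[OF assms]) (simp add: EV_diff EV_cmult, simp add: algebra_simps)

lemma EV_shift: "finite S \<Longrightarrow> EV S (\<lambda>B. c + H B) = c + EV S H"
  by (simp add: EV_add)

lemma EV_centered_sum:
  assumes "finite S"
  shows "EV S (\<lambda>B. \<Sum>e\<in>S. w e * (of_bool (e \<in> B) - p)) = 0"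
  using assms
proof (induction S rule: finite_induct)
  case (insert e S)
  let ?Y = "\<lambda>B. \<Sum>x\<in>S. w x * (of_bool (x \<in> B) - p)"
  have *: "?Y (insert e B) = ?Y B" for B
    using insert(2) by (intro sum.cong) auto
  have **: "EV S (\<lambda>B. w e * (of_bool (e \<in> B) - p) + ?Y B) = EV S (\<lambda>B. - w e * p + ?Y B)"
    using insert(2) by (intro EV_cong) auto
  have h1: "EV S (\<lambda>B. w e * (of_bool (e \<in> insert e B) - p) + ?Y B) = w e * (1 - p)"
    using EV_shift[OF insert(1), of "w e * (1 - p)" ?Y] insert.IH by simp
  have h2: "EV S (\<lambda>B. - w e * p + ?Y B) = - w e * p"
    using EV_shift[OF insert(1), of "- w e * p" ?Y] insert.IH by simp
  show ?case unfolding EV_insert[OF insert(1,2)] sum.insert[OF insert(1,2)] * ** h1 h2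
    by (simp add: algebra_simps)
qed simp

lemma EV_centered_sum_sq:
  assumes "finite S"
  shows "EV S (\<lambda>B. (\<Sum>e\<in>S. w e * (of_bool (e \<in> B) - p))\<^sup>2) = p * (1 - p) * (\<Sum>e\<in>S. (w e)\<^sup>2)"
  using assms
proof (induction S rule: finite_induct)
  case (insert e S)
  let ?Y = "\<lambda>B. \<Sum>x\<in>S. w x * (of_bool (x \<in> B) - p)"
  have *: "?Y (insert e B) = ?Y B" for B
    using insert(2) by (intro sum.cong) auto
  have **: "EV S (\<lambda>B. (w e * (of_bool (e \<in> B) - p) + ?Y B)\<^sup>2) = EV S (\<lambda>B. (- w e * p + ?Y B)\<^sup>2)"
    using insert(2) by (intro EV_cong) auto
  have sq: "EV S (\<lambda>B. (c + ?Y B)\<^sup>2) = c\<^sup>2 + EV S (\<lambda>B. (?Y B)\<^sup>2)" for c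
  proof -
    have "EV S (\<lambda>B. (c + ?Y B)\<^sup>2) = EV S (\<lambda>B. c\<^sup>2 + (2 * c) * ?Y B + (?Y B)\<^sup>2)"
      by (rule EV_cong) (simp add: power2_eq_square algebra_simps)
    then show ?thesis using insert(1) by (simp only: EV_add EV_cmult EV_centered_sum[OF insert(1)] EV_const)
  qed
  have "EV (insert e S) (\<lambda>B. (\<Sum>x\<in>insert e S. w x * (of_bool (x \<in> B) - p))\<^sup>2)
     = p * EV S (\<lambda>B. (w e * (1 - p) + ?Y B)\<^sup>2) + (1 - p) * EV S (\<lambda>B. (- w e * p + ?Y B)\<^sup>2)"
    unfolding EV_insert[OF insert(1,2)] sum.insert[OF insert(1,2)] * ** by simp
  also have "\<dots> = p * (1 - p) * (\<Sum>x\<in>insert e S. (w x)\<^sup>2)"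
    unfolding sq insert.IH using insert(1,2) by (simp add: power2_eq_square algebra_simps)
  finally show ?case .
qed simp

lemma EV_abs_le_sqrt:
  assumes "finite S"
  shows "EV S (\<lambda>B. \<bar>H B\<bar>) \<le> sqrt (EV S (\<lambda>B. (H B)\<^sup>2))"
proof -
  define m where "m = EV S (\<lambda>B. \<bar>H B\<bar>)"
  have "0 \<le> EV S (\<lambda>B. (\<bar>H B\<bar> - m)\<^sup>2)" by (rule EV_nonneg) auto
  also have "\<dots> = EV S (\<lambda>B. ((H B)\<^sup>2 - (2 * m) * \<bar>H B\<bar>) + m\<^sup>2)"
    by (rule EV_cong) (simp add: power2_eq_square algebra_simps)
  also have "\<dots> = EV S (\<lambda>B. (H B)\<^sup>2) - m\<^sup>2"
    unfolding EV_add EV_diff EV_cmult using assms m_def by (simp add: power2_eq_square)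
  finally show ?thesis unfolding m_def[symmetric] by (intro real_le_rsqrt) simp
qed

text \<open>Testing the centred sum \<open>\<Sum>w\<^sub>e(x\<^sub>e - p)\<close> against a truncation of \<open>X - a\<close>: the truncation gains
  \<open>w\<^sub>e\<close> from switching \<open>x\<^sub>e\<close> whenever \<open>X\<close> is near \<open>a\<close>.\<close>

lemma small_ball:
  assumes fin: "finite S" and T: "T \<subseteq> S" and t: "0 < t" and wt: "\<And>e. e \<in> T \<Longrightarrow> \<bar>w e\<bar> \<le> t"
    and pos: "0 < (\<Sum>e\<in>T. (w e)\<^sup>2)"
  shows "Pr S (\<lambda>B. \<bar>(\<Sum>e\<in>S. w e * of_bool (e \<in> B)) - a\<bar> \<le> t) \<le> 2 * t / sqrt (p * (1 - p) * (\<Sum>e\<in>T. (w e)\<^sup>2))"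
proof -
  define X where "X = (\<lambda>B. \<Sum>e\<in>S. w e * of_bool (e \<in> B))"
  \<comment> \<open>The cutoff is \<open>2 * t\<close> because switching one edge of
    \<open>T\<close> moves \<open>X\<close> by at most \<open>t\<close>: if \<open>X\<close> is
    within \<open>t\<close> of \<open>a\<close>, both of its values stay where \<open>f\<close> is
    linear.\<close>
  define f where "f = (\<lambda>x::real. max (- 2 * t) (min (2 * t) (x - a)))"
  define s2 where "s2 = (\<Sum>e\<in>T. (w e)\<^sup>2)"
  define P where "P = Pr S (\<lambda>B. \<bar>X B - a\<bar> \<le> t)"
  have pq: "0 < p * (1 - p)" using p_pos p_less_1 by simp
  have finT: "finite T" using fin T finite_subset by auto
  have Xdiff: "X (insert e B) = X (B - {e}) + w e" if "e \<in> S" for e B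
  proof -
    have "X C = w e * of_bool (e \<in> C) + (\<Sum>x\<in>S - {e}. w x * of_bool (x \<in> C))" for C
      unfolding X_def using fin that by (subst sum.remove[of _ e]) auto
    moreover have "(\<Sum>x\<in>S - {e}. w x * of_bool (x \<in> insert e B)) = (\<Sum>x\<in>S - {e}. w x * of_bool (x \<in> B - {e}))"
      by (intro sum.cong) auto
    ultimately show ?thesis by simp
  qed
  have gain: "(w e)\<^sup>2 * of_bool (\<bar>X B - a\<bar> \<le> t) \<le> w e * (f (X (insert e B)) - f (X (B - {e})))"
    if e: "e \<in> T" for e B
  proof -
    have eS: "e \<in> S" using e T by auto
    have d: "X (insert e B) = X (B - {e}) + w e" by (rule Xdiff[OF eS])
    have XB: "X B = X (insert e B) \<or> X B = X (B - {e})"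
      by (cases "e \<in> B") (auto simp: insert_absorb)
    have mono: "0 \<le> w e * (f (X (insert e B)) - f (X (B - {e})))"
      unfolding d by (cases "w e \<ge> 0") (auto simp: f_def intro: mult_nonneg_nonneg mult_nonpos_nonpos)
    show ?thesis
    proof (cases "\<bar>X B - a\<bar> \<le> t")
      case True
      have we: "\<bar>w e\<bar> \<le> t" using wt e by auto
      have "f (X (insert e B)) = X (insert e B) - a" "f (X (B - {e})) = X (B - {e}) - a"
        using True XB d we unfolding f_def by auto
      then show ?thesis using True d by (simp add: power2_eq_square)
    qed (use mono in simp)
  qed
  have low: "p * (1 - p) * s2 * P \<le> EV S (\<lambda>B. (\<Sum>e\<in>T. w e * (of_bool (e \<in> B) - p)) * f (X B))"
  proof -
    have "EV S (\<lambda>B. (\<Sum>e\<in>T. w e * (of_bool (e \<in> B) - p)) * f (X B))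
       = EV S (\<lambda>B. \<Sum>e\<in>T. w e * ((of_bool (e \<in> B) - p) * f (X B)))"
      by (simp add: sum_distrib_right mult.assoc)
    also have "\<dots> = (\<Sum>e\<in>T. w e * (p * (1 - p) * EV S (\<lambda>B. f (X (insert e B)) - f (X (B - {e})))))"
      unfolding EV_sum EV_cmult using T by (intro sum.cong refl arg_cong2[of _ _ _ _ "(*)"] EV_score[OF fin]) auto
    also have "\<dots> = p * (1 - p) * (\<Sum>e\<in>T. EV S (\<lambda>B. w e * (f (X (insert e B)) - f (X (B - {e})))))"
      by (simp add: EV_cmult sum_distrib_left mult_ac)
    also have "\<dots> \<ge> p * (1 - p) * (\<Sum>e\<in>T. EV S (\<lambda>B. (w e)\<^sup>2 * of_bool (\<bar>X B - a\<bar> \<le> t)))"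
      using pq by (intro mult_left_mono sum_mono EV_mono gain) auto
    also have "p * (1 - p) * (\<Sum>e\<in>T. EV S (\<lambda>B. (w e)\<^sup>2 * of_bool (\<bar>X B - a\<bar> \<le> t))) = p * (1 - p) * s2 * P"
      by (simp add: EV_cmult P_def Pr_def s2_def sum_distrib_right)
    finally show ?thesis .
  qed
  \<comment> \<open>The upper bound uses only that \<open>f\<close> is bounded by
    \<open>2 * t\<close>, and the second moment of the centred sum. It is of order the square root
    of \<open>s2\<close>, against a lower bound linear in \<open>s2\<close>.\<close>
  have "EV S (\<lambda>B. (\<Sum>e\<in>T. w e * (of_bool (e \<in> B) - p)) * f (X B))
      \<le> EV S (\<lambda>B. 2 * t * \<bar>\<Sum>e\<in>T. w e * (of_bool (e \<in> B) - p)\<bar>)"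
  proof (rule EV_mono)
    fix B
    have "\<bar>f (X B)\<bar> \<le> 2 * t" using t by (auto simp: f_def)
    then show "(\<Sum>e\<in>T. w e * (of_bool (e \<in> B) - p)) * f (X B)
        \<le> 2 * t * \<bar>\<Sum>e\<in>T. w e * (of_bool (e \<in> B) - p)\<bar>"
      using mult_left_mono[of "\<bar>f (X B)\<bar>" "2 * t" "\<bar>\<Sum>e\<in>T. w e * (of_bool (e \<in> B) - p)\<bar>"]
        abs_ge_self[of "(\<Sum>e\<in>T. w e * (of_bool (e \<in> B) - p)) * f (X B)"]
      by (simp add: abs_mult mult.commute)
  qed
  also have "\<dots> \<le> 2 * t * sqrt (EV S (\<lambda>B. (\<Sum>e\<in>T. w e * (of_bool (e \<in> B) - p))\<^sup>2))"
    unfolding EV_cmult using t EV_abs_le_sqrt[OF fin] by (intro mult_left_mono) auto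
  also have "EV S (\<lambda>B. (\<Sum>e\<in>T. w e * (of_bool (e \<in> B) - p))\<^sup>2)
      = EV S (\<lambda>B. (\<Sum>e\<in>S. (if e \<in> T then w e else 0) * (of_bool (e \<in> B) - p))\<^sup>2)"
    using fin T by (intro EV_cong arg_cong[of _ _ "\<lambda>x. x\<^sup>2"] sum.mono_neutral_cong_left) auto
  also have "\<dots> = p * (1 - p) * (\<Sum>e\<in>S. (if e \<in> T then w e else 0)\<^sup>2)"
    by (rule EV_centered_sum_sq[OF fin])
  also have "(\<Sum>e\<in>S. (if e \<in> T then w e else 0)\<^sup>2) = s2"
    unfolding s2_def using fin T by (intro sum.mono_neutral_cong_right) auto
  finally have "p * (1 - p) * s2 * P \<le> 2 * t * sqrt (p * (1 - p) * s2)" using low by linarith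
  moreover have ps: "0 < p * (1 - p) * s2" using pq pos by (simp add: s2_def)
  moreover define r where "r = sqrt (p * (1 - p) * s2)"
  moreover have r: "0 < r" "r * r = p * (1 - p) * s2" using ps unfolding r_def by auto
  ultimately have le: "p * (1 - p) * s2 * P \<le> r * (2 * t)" by (simp add: mult.commute)
  have "r * (r * P) = p * (1 - p) * s2 * P" using r(2) by (metis mult.assoc)
  then have "r * (r * P) \<le> r * (2 * t)" using le by (rule ord_eq_le_trans)
  then have "r * P \<le> 2 * t" using r(1) by simp
  then have "P \<le> 2 * t / r" using r(1) by (simp add: pos_le_divide_eq mult.commute)
  then show ?thesis by (simp add: P_def X_def s2_def r_def)
qed

lemma EV_star:
  assumes "r \<notin> I"
  shows "EV (star r I) (\<lambda>C. H (\<lambda>i. {r, i} \<in> C)) = EV I (\<lambda>B. H (\<lambda>i. i \<in> B))"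
proof -
  have inj: "inj (\<lambda>i. {r, i})" by (auto simp: inj_on_def doubleton_eq_iff)
  have "EV (star r I) (\<lambda>C. H (\<lambda>i. {r, i} \<in> C)) = EV I (\<lambda>B. H (\<lambda>i. {r, i} \<in> (\<lambda>i. {r, i}) ` B))"
    by (rule EV_reindex) (auto simp: bij_betw_def star_def intro: inj_on_subset[OF inj])
  moreover have "{r, i} \<in> (\<lambda>i. {r, i}) ` B \<longleftrightarrow> i \<in> B" for i B
    using inj_image_mem_iff[OF inj] .
  ultimately show ?thesis by simp
qed

lemma Pr_row:
  assumes "r \<notin> I"
  shows "Pr (star r I) (\<lambda>C. P (row_sum C I u r)) = Pr I (\<lambda>B. P (\<Sum>i\<in>I. u i * of_bool (i \<in> B)))"
  unfolding Pr_def row_sum_def adj_def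
  using EV_star[OF assms, of "\<lambda>g. of_bool (P (\<Sum>i\<in>I. u i * of_bool (g i)))"] by (simp add: mult.commute)

lemma small_ball_row:
  assumes "r \<notin> I" "finite I" "T \<subseteq> I" "0 < t" "\<And>e. e \<in> T \<Longrightarrow> \<bar>u e\<bar> \<le> t" "0 < (\<Sum>e\<in>T. (u e)\<^sup>2)"
  shows "Pr (star r I) (\<lambda>C. \<bar>row_sum C I u r - a\<bar> \<le> t) \<le> 2 * t / sqrt (p * (1 - p) * (\<Sum>e\<in>T. (u e)\<^sup>2))"
  unfolding Pr_row[OF assms(1), of "\<lambda>x. \<bar>x - a\<bar> \<le> t"] using assms by (intro small_ball)

text \<open>Tuned for \<open>row_anticoncentration\<close>: with squared mass 1/16 and weights at
  most \<open>2 * c0\<close>, the bound of \<open>small_ball\<close> is exactly 1/2, while a single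
  Bernoulli variable takes a given value with probability at most
  \<open>max p (1 - p)\<close>.\<close>

definition c0 :: real where "c0 = sqrt (p * (1 - p)) / 32"
definition q0 :: real where "q0 = max (max p (1 - p)) (1 / 2)"

lemma c0_pos: "0 < c0" using p_pos p_less_1 by (simp add: c0_def)
lemma q0_bounds: "0 < q0" "q0 < 1" using p_pos p_less_1 by (auto simp: q0_def)

text \<open>Either one weight exceeds \<open>2 * c0\<close>, and then, all other entries being
  fixed, at most one value of that entry brings the sum within \<open>c0\<close> of
  \<open>a\<close>; or all weights are small and \<open>small_ball\<close> applies.\<close>

lemma row_anticoncentration:
  assumes r: "r \<notin> I" and fin: "finite I" and u: "1 / 16 \<le> (\<Sum>i\<in>I. (u i)\<^sup>2)"
  shows "Pr (star r I) (\<lambda>C. \<bar>row_sum C I u r - a\<bar> \<le> c0) \<le> q0"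
proof (cases "\<exists>j\<in>I. 2 * c0 < \<bar>u j\<bar>")
  case True
  then obtain j where j: "j \<in> I" "2 * c0 < \<bar>u j\<bar>" by auto
  have *: "Pr {j} (\<lambda>C. \<bar>(\<Sum>i\<in>I. u i * of_bool (i \<in> B \<union> C)) - a\<bar> \<le> c0) \<le> q0" if B: "B \<subseteq> I - {j}" for B
  proof -
    define Z where "Z = (\<Sum>i\<in>I - {j}. u i * of_bool (i \<in> B))"
    have Z: "(\<Sum>i\<in>I. u i * of_bool (i \<in> B \<union> C)) = u j * of_bool (j \<in> C) + Z" if "C \<subseteq> {j}" for C
      unfolding Z_def using B that by (subst sum.remove[OF fin j(1)], intro arg_cong2[of _ _ _ _ "(+)"] sum.cong) auto
    have "Pr {j} (\<lambda>C. \<bar>(\<Sum>i\<in>I. u i * of_bool (i \<in> B \<union> C)) - a\<bar> \<le> c0)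
       = Pr {j} (\<lambda>C. \<bar>u j * of_bool (j \<in> C) + Z - a\<bar> \<le> c0)"
      using Z by (intro Pr_cong) simp
    also have "\<dots> = p * of_bool (\<bar>u j + Z - a\<bar> \<le> c0) + (1 - p) * of_bool (\<bar>Z - a\<bar> \<le> c0)"
      unfolding Pr_def by (subst EV_insert) auto
    also have "\<dots> \<le> q0"
    proof -
      have "\<not> (\<bar>u j + Z - a\<bar> \<le> c0 \<and> \<bar>Z - a\<bar> \<le> c0)" using j(2) by linarith
      then show ?thesis using p_pos p_less_1 by (auto simp: q0_def)
    qed
    finally show ?thesis .
  qed
  show ?thesis unfolding Pr_row[OF r, of "\<lambda>x. \<bar>x - a\<bar> \<le> c0"]
    by (rule Pr_cond_le[OF fin, of "{j}"]) (use j * in auto)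
next
  case False
  have pq: "0 < p * (1 - p)" using p_pos p_less_1 by simp
  have "Pr (star r I) (\<lambda>C. \<bar>row_sum C I u r - a\<bar> \<le> c0) \<le> Pr (star r I) (\<lambda>C. \<bar>row_sum C I u r - a\<bar> \<le> 2 * c0)"
    using c0_pos by (intro Pr_mono) auto
  also have "\<dots> \<le> 2 * (2 * c0) / sqrt (p * (1 - p) * (\<Sum>i\<in>I. (u i)\<^sup>2))"
    using False u c0_pos by (intro small_ball_row r fin order_refl) (auto simp: not_less)
  also have "\<dots> \<le> 2 * (2 * c0) / sqrt (p * (1 - p) * (1 / 16))"
    using pq u c0_pos by (intro divide_left_mono real_sqrt_le_mono mult_left_mono mult_pos_pos) auto
  also have "\<dots> = 1 / 2" using pq p_pos p_less_1 by (simp add: c0_def real_sqrt_divide real_sqrt_mult)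
  also have "\<dots> \<le> q0" by (simp add: q0_def)
  finally show ?thesis .
qed

lemma rows_all:
  assumes "finite R" "finite S" "(\<Union>r\<in>R. star r I) \<subseteq> S" "R \<inter> I = {}" "0 \<le> \<rho>"
    and "\<And>r a. r \<in> R \<Longrightarrow> Pr (star r I) (\<lambda>C. \<bar>row_sum C I u r - a\<bar> \<le> t) \<le> \<rho>"
  shows "Pr S (\<lambda>B. \<forall>r\<in>R. \<bar>row_sum B I u r - a\<bar> \<le> t) \<le> \<rho> ^ card R"
  using assms
proof (induction R arbitrary: S rule: finite_induct)
  case empty
  then show ?case using Pr_le_1 by simp
next
  case (insert r R)
  let ?T = "star r I"
  have T: "?T \<subseteq> S" using insert by auto
  have other: "row_sum (B \<union> C) I u s = row_sum B I u s" if "s \<in> R" "C \<subseteq> ?T" for B C s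
  proof -
    have "{s, i} \<notin> C" if "i \<in> I" for i
      using \<open>s \<in> R\<close> \<open>C \<subseteq> ?T\<close> that insert(2,6) by (auto simp: star_def doubleton_eq_iff)
    then show ?thesis unfolding row_sum_def adj_def by (intro sum.cong) auto
  qed
  have own: "row_sum (B \<union> C) I u r = row_sum C I u r" if "B \<subseteq> S - ?T" for B C
    unfolding row_sum_def adj_def using that by (intro sum.cong) (auto simp: star_def)
  have stars: "star s I \<subseteq> S - ?T" if "s \<in> R" for s
    using that insert(2,5,6) by (auto simp: star_def doubleton_eq_iff)
  have "Pr S (\<lambda>B. \<forall>s\<in>insert r R. \<bar>row_sum B I u s - a\<bar> \<le> t)
     = Pr S (\<lambda>B. (\<forall>s\<in>R. \<bar>row_sum B I u s - a\<bar> \<le> t) \<and> \<bar>row_sum B I u r - a\<bar> \<le> t)"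
    by (intro Pr_cong) auto
  also have "\<dots> \<le> \<rho> * Pr (S - ?T) (\<lambda>B. \<forall>s\<in>R. \<bar>row_sum B I u s - a\<bar> \<le> t)"
    using insert.prems by (intro Pr_conj_le T) (auto simp: other own)
  also have "\<dots> \<le> \<rho> * \<rho> ^ card R"
    using insert.prems stars by (intro mult_left_mono insert.IH) auto
  finally show ?case using insert by simp
qed

text \<open>A bound on the sum of squares of the rows controls all but a few of them. The
  exceptional set is guessed by a union bound, which is the origin of the polynomial factor to the
  power \<open>k\<close>.\<close>

lemma rows_most:
  assumes "finite R" "finite S" "(\<Union>r\<in>R. star r I) \<subseteq> S" "R \<inter> I = {}" "0 < \<rho>" "\<rho> \<le> 1"
    and "\<And>r a. r \<in> R \<Longrightarrow> Pr (star r I) (\<lambda>C. \<bar>row_sum C I u r - a\<bar> \<le> t) \<le> \<rho>"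
  shows "Pr S (\<lambda>B. card {r\<in>R. t < \<bar>row_sum B I u r - a\<bar>} \<le> k) \<le> (real (card R) + 1) ^ k * \<rho> powr (real (card R) - real k)"
proof -
  let ?X = "{D. D \<subseteq> R \<and> card D \<le> k}"
  have finX: "finite ?X" using assms(1) by auto
  have "Pr S (\<lambda>B. card {r\<in>R. t < \<bar>row_sum B I u r - a\<bar>} \<le> k)
     \<le> Pr S (\<lambda>B. \<exists>D\<in>?X. \<forall>r\<in>R - D. \<bar>row_sum B I u r - a\<bar> \<le> t)"
  proof (rule Pr_mono)
    fix B assume "card {r\<in>R. t < \<bar>row_sum B I u r - a\<bar>} \<le> k"
    then show "\<exists>D\<in>?X. \<forall>r\<in>R - D. \<bar>row_sum B I u r - a\<bar> \<le> t"
      by (intro bexI[of _ "{r\<in>R. t < \<bar>row_sum B I u r - a\<bar>}"]) auto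
  qed
  also have "\<dots> \<le> real (card ?X) * \<rho> powr (real (card R) - real k)"
  proof (rule Pr_Bex_le_card[OF finX])
    fix D assume D: "D \<in> ?X"
    have "Pr S (\<lambda>B. \<forall>r\<in>R - D. \<bar>row_sum B I u r - a\<bar> \<le> t) \<le> \<rho> ^ card (R - D)"
      using assms D by (intro rows_all) auto
    also have "\<dots> = \<rho> powr (real (card R) - real (card D))"
    proof -
      have "finite D" "card D \<le> card R" using D assms(1) by (auto intro: finite_subset card_mono)
      then have "real (card (R - D)) = real (card R) - real (card D)"
        using D by (simp add: card_Diff_subset of_nat_diff)
      then show ?thesis using assms(5) by (simp flip: powr_realpow)
    qed
    also have "\<dots> \<le> \<rho> powr (real (card R) - real k)"
      using D assms by (intro powr_mono') auto
    finally show "Pr S (\<lambda>B. \<forall>r\<in>R - D. \<bar>row_sum B I u r - a\<bar> \<le> t) \<le> \<rho> powr (real (card R) - real k)" .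
  qed
  also have "\<dots> \<le> (real (card R) + 1) ^ k * \<rho> powr (real (card R) - real k)"
    using of_nat_mono[OF card_small_subsets[OF assms(1), of k], where 'a = real]
    by (intro mult_right_mono) (auto simp: add.commute)
  finally show ?thesis .
qed

end

section \<open>Projections and restricted invertibility\<close>

definition app :: "nat set \<Rightarrow> (nat \<Rightarrow> nat \<Rightarrow> real) \<Rightarrow> (nat \<Rightarrow> real) \<Rightarrow> nat \<Rightarrow> real" where
  "app U Q x a = (\<Sum>b\<in>U. Q a b * x b)"

text \<open>A subspace of the functions on \<open>U\<close> is encoded by the kernel of its
  orthogonal projection. Its dimension is then the trace, and membership is the linear equation
  \<open>range_of\<close>.\<close>

definition is_proj :: "nat set \<Rightarrow> (nat \<Rightarrow> nat \<Rightarrow> real) \<Rightarrow> bool" where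
  "is_proj U Q \<longleftrightarrow> (\<forall>a\<in>U. \<forall>b\<in>U. Q a b = Q b a) \<and> (\<forall>a\<in>U. \<forall>b\<in>U. (\<Sum>c\<in>U. Q a c * Q c b) = Q a b)"

definition tr :: "nat set \<Rightarrow> (nat \<Rightarrow> nat \<Rightarrow> real) \<Rightarrow> real" where
  "tr U Q = (\<Sum>a\<in>U. Q a a)"

definition range_of :: "nat set \<Rightarrow> (nat \<Rightarrow> nat \<Rightarrow> real) \<Rightarrow> (nat \<Rightarrow> real) \<Rightarrow> bool" where
  "range_of U Q x \<longleftrightarrow> (\<forall>a\<in>U. app U Q x a = x a)"

lemma projD:
  assumes "is_proj U Q" "a \<in> U" "b \<in> U"
  shows "Q a b = Q b a" "(\<Sum>c\<in>U. Q a c * Q c b) = Q a b"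
  using assms unfolding is_proj_def by blast+

lemma app_idem:
  assumes "is_proj U Q" "a \<in> U"
  shows "app U Q (app U Q x) a = app U Q x a"
proof -
  have "app U Q (app U Q x) a = (\<Sum>b\<in>U. \<Sum>c\<in>U. Q a b * Q b c * x c)"
    by (simp add: app_def sum_distrib_left mult.assoc)
  also have "\<dots> = (\<Sum>c\<in>U. (\<Sum>b\<in>U. Q a b * Q b c) * x c)"
    by (subst sum.swap) (simp add: sum_distrib_right)
  also have "\<dots> = app U Q x a"
    unfolding app_def using assms by (intro sum.cong refl) (simp add: projD(2))
  finally show ?thesis .
qed

lemma range_of_app: "is_proj U Q \<Longrightarrow> range_of U Q (app U Q x)"
  by (simp add: range_of_def app_idem)

lemma app_adjoint:
  assumes "is_proj U Q"
  shows "(\<Sum>a\<in>U. app U Q x a * y a) = (\<Sum>a\<in>U. x a * app U Q y a)"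
proof -
  have "(\<Sum>a\<in>U. app U Q x a * y a) = (\<Sum>b\<in>U. \<Sum>a\<in>U. Q a b * x b * y a)"
    unfolding app_def sum_distrib_right by (subst sum.swap) simp
  also have "\<dots> = (\<Sum>b\<in>U. x b * app U Q y b)"
    unfolding app_def sum_distrib_left using assms
    by (intro sum.cong refl) (simp add: projD(1)[OF assms] mult_ac)
  finally show ?thesis .
qed

lemma app_cong: "(\<And>b. b \<in> U \<Longrightarrow> x b = y b) \<Longrightarrow> app U Q x a = app U Q y a"
  unfolding app_def by (intro sum.cong) auto

lemma app_norm:
  assumes "is_proj U Q"
  shows "(\<Sum>a\<in>U. (app U Q x a)\<^sup>2) = (\<Sum>a\<in>U. x a * app U Q x a)"
proof -
  have "(\<Sum>a\<in>U. (app U Q x a)\<^sup>2) = (\<Sum>a\<in>U. x a * app U Q (app U Q x) a)"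
    by (simp add: power2_eq_square app_adjoint[OF assms])
  also have "\<dots> = (\<Sum>a\<in>U. x a * app U Q x a)"
    using app_idem[OF assms] by (intro sum.cong) auto
  finally show ?thesis .
qed

lemma app_norm_le:
  assumes "is_proj U Q"
  shows "(\<Sum>a\<in>U. (app U Q x a)\<^sup>2) \<le> (\<Sum>a\<in>U. (x a)\<^sup>2)"
proof -
  have "0 \<le> (\<Sum>a\<in>U. (x a - app U Q x a)\<^sup>2)" by (intro sum_nonneg) auto
  also have "\<dots> = (\<Sum>a\<in>U. (x a)\<^sup>2) - 2 * (\<Sum>a\<in>U. x a * app U Q x a) + (\<Sum>a\<in>U. (app U Q x a)\<^sup>2)"
    by (simp add: power2_diff sum.distrib sum_subtractf sum_distrib_left mult.assoc)
  finally show ?thesis using app_norm[OF assms, of x] by simp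
qed

lemma proj_col:
  assumes "is_proj U Q" "j \<in> U"
  shows "range_of U Q (\<lambda>a. Q a j)" "(\<Sum>a\<in>U. (Q a j)\<^sup>2) = Q j j"
proof -
  show "range_of U Q (\<lambda>a. Q a j)"
    unfolding range_of_def app_def using assms projD(2) by auto
  have "(\<Sum>a\<in>U. (Q a j)\<^sup>2) = (\<Sum>a\<in>U. Q j a * Q a j)"
    using projD(1)[OF assms(1)] assms(2) by (intro sum.cong) (auto simp: power2_eq_square)
  then show "(\<Sum>a\<in>U. (Q a j)\<^sup>2) = Q j j" using projD(2)[OF assms assms(2)] by simp
qed

text \<open>Subtracting the normalised rank one kernel of \<open>g\<close> removes the direction
  \<open>g\<close> from the range. Idempotence comes down to \<open>Q\<close> fixing
  \<open>g\<close>.\<close>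

lemma proj_rank_one:
  assumes Q: "is_proj U Q" and fin: "finite U" and g: "range_of U Q g"
    and n2: "n2 = (\<Sum>a\<in>U. (g a)\<^sup>2)" "n2 \<noteq> 0"
  defines "Q' \<equiv> \<lambda>a b. Q a b - g a * g b / n2"
  shows "is_proj U Q'" "tr U Q' = tr U Q - 1"
    "\<And>x a. app U Q' x a = app U Q x a - g a * (\<Sum>b\<in>U. g b * x b) / n2"
    "\<And>x. range_of U Q' x \<Longrightarrow> range_of U Q x"
proof -
  have Qg: "(\<Sum>c\<in>U. Q a c * g c) = g a" if "a \<in> U" for a
    using g that by (auto simp: range_of_def app_def)
  have gQ: "(\<Sum>c\<in>U. g c * Q c b) = g b" if "b \<in> U" for b
  proof -
    have "(\<Sum>c\<in>U. g c * Q c b) = (\<Sum>c\<in>U. Q b c * g c)"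
      using projD(1)[OF Q] that by (intro sum.cong) auto
    then show ?thesis using Qg[OF that] by simp
  qed
  have gg: "(\<Sum>c\<in>U. g c * g c) = n2" using n2 by (simp add: power2_eq_square)
  show A: "app U Q' x a = app U Q x a - g a * (\<Sum>b\<in>U. g b * x b) / n2" for x a
    by (simp add: app_def Q'_def left_diff_distrib sum_subtractf)
      (simp add: sum_distrib_left sum_divide_distrib mult_ac)
  show "is_proj U Q'" unfolding is_proj_def
  proof (intro conjI ballI)
    fix a b assume ab: "a \<in> U" "b \<in> U"
    show "Q' a b = Q' b a" using projD(1)[OF Q ab] by (simp add: Q'_def mult.commute)
    have "(\<Sum>c\<in>U. Q' a c * Q' c b) = (\<Sum>c\<in>U. Q a c * Q c b) - (\<Sum>c\<in>U. Q a c * g c) * g b / n2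
        - g a * (\<Sum>c\<in>U. g c * Q c b) / n2 + g a * (\<Sum>c\<in>U. g c * g c) * g b / (n2 * n2)"
      unfolding Q'_def
      by (simp add: algebra_simps sum.distrib sum_subtractf sum_distrib_left sum_distrib_right sum_divide_distrib)
    then show "(\<Sum>c\<in>U. Q' a c * Q' c b) = Q' a b"
      using n2(2) by (simp add: projD(2)[OF Q ab] Qg[OF ab(1)] gQ[OF ab(2)] gg Q'_def)
  qed
  have "tr U Q' = tr U Q - (\<Sum>a\<in>U. g a * g a) / n2"
    by (simp add: tr_def Q'_def sum_subtractf sum_divide_distrib)
  then show "tr U Q' = tr U Q - 1" using gg n2(2) by simp
  show "range_of U Q x" if x: "range_of U Q' x" for x
    unfolding range_of_def
  proof
    fix a assume a: "a \<in> U"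
    define k where "k = (\<Sum>b\<in>U. g b * x b) / n2"
    have "app U Q x a = app U Q (\<lambda>b. app U Q x b - g b * k) a"
      using x A by (intro app_cong) (simp add: range_of_def k_def)
    also have "\<dots> = app U Q (app U Q x) a - (\<Sum>b\<in>U. Q a b * g b) * k"
      by (simp add: app_def right_diff_distrib sum_subtractf sum_distrib_right mult.assoc)
    also have "\<dots> = app U Q' x a"
      using A Qg[OF a] app_idem[OF Q a] by (simp add: k_def)
    finally show "app U Q x a = x a" using x a by (simp add: range_of_def)
  qed
qed

text \<open>Within the range of \<open>Q\<close>, orthogonality to \<open>z\<close> is the same as
  orthogonality to the projection of \<open>z\<close>. So a linear condition removes at most one
  direction.\<close>

lemma proj_reduce:
  assumes Q: "is_proj U Q" and fin: "finite U"
  obtains Q' where "is_proj U Q'" "tr U Q - 1 \<le> tr U Q'" 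
    "\<And>x. range_of U Q' x \<Longrightarrow> range_of U Q x \<and> (\<Sum>a\<in>U. z a * x a) = 0"
    "\<And>a. a \<in> U \<Longrightarrow> app U Q' z a = 0"
proof -
  define g where "g = app U Q z"
  define n2 where "n2 = (\<Sum>a\<in>U. (g a)\<^sup>2)"
  have rg: "range_of U Q g" unfolding g_def by (rule range_of_app[OF Q])
  have orth: "(\<Sum>a\<in>U. z a * x a) = (\<Sum>a\<in>U. app U Q' z a * x a)" if "is_proj U Q'" "range_of U Q' x" for Q' x
    using app_adjoint[OF that(1), of z x] that(2) by (auto simp: range_of_def)
  show ?thesis
  proof (cases "n2 = 0")
    case True
    then have g0: "\<forall>a\<in>U. g a = 0" using fin by (simp add: n2_def sum_nonneg_eq_0_iff)
    show ?thesis
      by (rule that[of Q]) (use Q g0 orth[OF Q] in \<open>auto simp: g_def\<close>)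
  next
    case False
    note R = proj_rank_one[OF Q fin rg n2_def False]
    define Q' where "Q' = (\<lambda>a b. Q a b - g a * g b / n2)"
    have "(\<Sum>b\<in>U. g b * z b) = n2"
      unfolding n2_def g_def app_norm[OF Q] by (simp add: mult.commute)
    then have z0: "app U Q' z a = 0" for a using R(3)[of z a] False by (simp add: Q'_def g_def)
    show ?thesis
      by (rule that[of Q']) (use R z0 orth[of Q'] in \<open>auto simp: Q'_def[symmetric]\<close>)
  qed
qed

lemma proj_reduce_set:
  assumes Q: "is_proj U Q" and fin: "finite U" and Z: "finite Z"
  shows "\<exists>Q'. is_proj U Q' \<and> tr U Q - card Z \<le> tr U Q' \<and>
    (\<forall>x. range_of U Q' x \<longrightarrow> range_of U Q x \<and> (\<forall>z\<in>Z. (\<Sum>a\<in>U. \<phi> z a * x a) = 0))"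
  using Z
proof (induction Z rule: finite_induct)
  case empty
  then show ?case using Q by (intro exI[of _ Q]) auto
next
  case (insert z Z)
  then obtain Q1 where Q1: "is_proj U Q1" "tr U Q - card Z \<le> tr U Q1"
    "\<And>x. range_of U Q1 x \<Longrightarrow> range_of U Q x \<and> (\<forall>z\<in>Z. (\<Sum>a\<in>U. \<phi> z a * x a) = 0)" by auto
  obtain Q2 where Q2: "is_proj U Q2" "tr U Q1 - 1 \<le> tr U Q2" 
    "\<And>x. range_of U Q2 x \<Longrightarrow> range_of U Q1 x \<and> (\<Sum>a\<in>U. \<phi> z a * x a) = 0"
    using proj_reduce[OF Q1(1) fin, of "\<phi> z"] by metis
  show ?case using Q1 Q2 insert(1,2) by (intro exI[of _ Q2]) auto
qed

lemma proj_id: "finite U \<Longrightarrow> is_proj U (\<lambda>a b. of_bool (a = b))"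
  by (auto simp: is_proj_def of_bool_def if_distrib[of "\<lambda>x. x * _"] cong: if_cong)

text \<open>Cutting the identity by \<open>card Z\<close> conditions leaves a projection of positive
  trace. Some diagonal entry is then positive, and its column is a nonzero vector of the
  range.\<close>

lemma nontrivial_solution:
  fixes \<phi> :: "'z \<Rightarrow> nat \<Rightarrow> real"
  assumes "finite U" "finite Z" "card Z < card U"
  obtains x where "\<exists>a\<in>U. x a \<noteq> 0" "\<And>z. z \<in> Z \<Longrightarrow> (\<Sum>a\<in>U. \<phi> z a * x a) = 0"
proof -
  obtain Q where Q: "is_proj U Q" "tr U (\<lambda>a b. of_bool (a = b)) - card Z \<le> tr U Q"
    "\<forall>x. range_of U Q x \<longrightarrow> (\<forall>z\<in>Z. (\<Sum>a\<in>U. \<phi> z a * x a) = 0)"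
    using proj_reduce_set[OF proj_id[OF assms(1)] assms(1,2), of \<phi>] by metis
  have "0 < tr U Q" using Q(2) assms by (simp add: tr_def)
  then obtain j where j: "j \<in> U" "Q j j > 0"
    unfolding tr_def by (meson not_less sum_nonpos)
  have "range_of U Q (\<lambda>a. Q a j)" by (rule proj_col[OF Q(1) j(1)])
  then show ?thesis using Q(3) j by (intro that[of "\<lambda>a. Q a j"] bexI[of _ j]) auto
qed

section \<open>Restricted invertibility\<close>

lemma weighted_average_pick:
  fixes f g :: "'a \<Rightarrow> real"
  assumes "finite U" "U \<noteq> {}"
  obtains j where "j \<in> U" "f j * sum g U \<le> sum f U * g j"
proof -
  have "\<exists>j\<in>U. f j * sum g U \<le> sum f U * g j"
  proof (rule ccontr)
    assume "\<not> ?thesis"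
    then have "(\<Sum>j\<in>U. sum f U * g j) < (\<Sum>j\<in>U. f j * sum g U)"
      using assms by (intro sum_strict_mono) auto
    then show False by (simp flip: sum_distrib_left sum_distrib_right)
  qed
  then show ?thesis using that by auto
qed

text \<open>A Hilbert-Schmidt version of restricted invertibility: a greedy choice of coordinates on which
  the range of \<open>Q\<close> contains a dual family with small total norm.\<close>

lemma dual_family_step:
  fixes N :: real
  assumes Q0: "is_proj U Q0" and fin: "finite U" and N: "N = tr U Q0"
  shows "real k < N \<Longrightarrow> \<exists>T (w :: nat \<Rightarrow> nat \<Rightarrow> real) Q. T \<subseteq> U \<and> card T = k \<and> is_proj U Q \<and> N - k \<le> tr U Q
     \<and> (\<forall>x. range_of U Q x \<longrightarrow> range_of U Q0 x)
     \<and> (\<forall>a\<in>T. \<forall>b\<in>U. Q a b = 0) \<and> (\<forall>a\<in>T. \<forall>b\<in>U. app U Q (w a) b = 0)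
     \<and> (\<forall>a\<in>T. range_of U Q0 (w a) \<and> (\<forall>b\<in>T. w a b = of_bool (a = b)))
     \<and> (real (card U) + (\<Sum>a\<in>T. \<Sum>b\<in>U. (w a b)\<^sup>2)) * (N - k + 1) \<le> real (card U) * (N + 1)"
proof (induction k)
  case 0
  show ?case by (rule exI[of _ "{}"], rule exI, rule exI[of _ Q0]) (use Q0 N in auto)
next
  case (Suc k)
  then have "real k < N" by simp
  from Suc.IH[OF this] obtain T and w :: "nat \<Rightarrow> nat \<Rightarrow> real" and Q where T: "T \<subseteq> U" "card T = k"
    and Q': "is_proj U Q" "N - k \<le> tr U Q" "\<forall>x. range_of U Q x \<longrightarrow> range_of U Q0 x" "\<forall>a\<in>T. \<forall>b\<in>U. Q a b = 0" 
    and w': "\<forall>a\<in>T. \<forall>b\<in>U. app U Q (w a) b = 0"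
     "\<forall>a\<in>T. range_of U Q0 (w a) \<and> (\<forall>b\<in>T. w a b = of_bool (a = b))"
    and \<Phi>: "(real (card U) + (\<Sum>a\<in>T. \<Sum>b\<in>U. (w a b)\<^sup>2)) * (N - k + 1) \<le> real (card U) * (N + 1)"
    by (elim exE conjE) (rule that; assumption)
  note Q = Q'[rule_format]
  have w: "app U Q (w a) b = 0" if "a \<in> T" "b \<in> U" for a b using w'(1) that by blast
  have w0: "range_of U Q0 (w a)" if "a \<in> T" for a using w'(2) that by blast
  have wd: "w a b = of_bool (a = b)" if "a \<in> T" "b \<in> T" for a b using w'(2) that by blast
  \<comment> \<open>This potential is at most multiplied by 1 + 1/(N - k) in the step, so its
    product with \<open>N - k + 1\<close> never increases. That is the last clause of the induction
    claim.\<close>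
  define \<Phi>0 where "\<Phi>0 = real (card U) + (\<Sum>a\<in>T. \<Sum>b\<in>U. (w a b)\<^sup>2)"
  have finT: "finite T" using T fin finite_subset by auto
  have trpos: "tr U Q > 0" using Q(2) Suc.prems by simp
  then have "U \<noteq> {}" by (auto simp: tr_def)
  \<comment> \<open>The left hand bracket divided by \<open>Q j j\<close> is exactly the growth of
    the potential when \<open>j\<close> is added; the average over \<open>j\<close> guarantees an
    index where it is at most \<open>\<Phi>0 / tr U Q\<close>.\<close>
  then obtain j where j: "j \<in> U"
    and pick: "(1 + (\<Sum>a\<in>T. (w a j)\<^sup>2)) * sum (\<lambda>j. Q j j) U \<le> (\<Sum>j\<in>U. 1 + (\<Sum>a\<in>T. (w a j)\<^sup>2)) * Q j j"
    by (rule weighted_average_pick[OF fin])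
  have \<Phi>0_eq: "(\<Sum>j\<in>U. 1 + (\<Sum>a\<in>T. (w a j)\<^sup>2)) = \<Phi>0"
    unfolding \<Phi>0_def sum.distrib by (subst sum.swap) simp
  have \<Phi>0_nonneg: "0 \<le> \<Phi>0" unfolding \<Phi>0_def by (intro add_nonneg_nonneg sum_nonneg) auto
  define x where "x = Q j j"
  have pick': "(1 + (\<Sum>a\<in>T. (w a j)\<^sup>2)) * tr U Q \<le> \<Phi>0 * x"
    using pick by (simp only: \<Phi>0_eq tr_def x_def)
  have "0 < (1 + (\<Sum>a\<in>T. (w a j)\<^sup>2)) * tr U Q"
    using trpos by (intro mult_pos_pos add_pos_nonneg sum_nonneg) auto
  then have "0 < \<Phi>0 * x" using pick' by linarith
  then have x: "0 < x" using \<Phi>0_nonneg by (simp add: zero_less_mult_iff)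
  define g where "g = (\<lambda>a. Q a j)"
  have rg: "range_of U Q g" and gx: "x = (\<Sum>a\<in>U. (g a)\<^sup>2)"
    unfolding g_def x_def using proj_col[OF Q(1) j] by auto
  define Q' where "Q' = (\<lambda>a b. Q a b - g a * g b / x)"
  note R = proj_rank_one[OF Q(1) fin rg gx less_imp_neq[OF x, symmetric], folded Q'_def]
  \<comment> \<open>Column \<open>g\<close> divided by its entry \<open>x\<close> at
    \<open>j\<close> is the new dual vector; multiples of it are subtracted from the old ones to
    make them vanish at \<open>j\<close>. As \<open>g\<close> is orthogonal to the old vectors,
    squared norms simply add.\<close>
  define w' where "w' = (\<lambda>a b. if a = j then g b / x else w a b - w a j * (g b / x))"
  have jT: "j \<notin> T" using Q(4)[of j j] j x by (auto simp: x_def)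
  have gT: "g a = 0" if "a \<in> T" for a using Q(4)[OF that j] by (simp add: g_def)
  have gj: "g j = x" by (simp add: g_def x_def)
  have gw: "(\<Sum>b\<in>U. g b * w a b) = 0" if "a \<in> T" for a
  proof -
    have "(\<Sum>b\<in>U. g b * w a b) = app U Q (w a) j"
      unfolding app_def g_def using projD(1)[OF Q(1)] j by (intro sum.cong) auto
    then show ?thesis using w[OF that j] by simp
  qed
  have gg: "(\<Sum>b\<in>U. g b * g b) = x" using gx by (simp add: power2_eq_square)
  have sgn: "(\<Sum>b\<in>U. g b * (g b / x)) = 1"
    using gg x by (simp flip: sum_divide_distrib)
  have appg: "app U Q g a = g a" if "a \<in> U" for a using rg that by (simp add: range_of_def)
  have applin: "app U M (\<lambda>b. u b - c * v b) a = app U M u a - c * app U M v a" for M u c v a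
    by (simp add: app_def right_diff_distrib sum_subtractf sum_distrib_left mult_ac)
  have appscale: "app U M (\<lambda>b. v b / c) a = app U M v a / c" for M v c a
    by (simp add: app_def sum_divide_distrib)
  have rg0: "range_of U Q0 (\<lambda>b. g b / x)"
    using Q(3)[OF rg] by (simp add: range_of_def appscale)
  have "insert j T \<subseteq> U" "card (insert j T) = Suc k" using T j jT finT by auto
  moreover have "is_proj U Q'" by (rule R(1))
  moreover have "N - Suc k \<le> tr U Q'" using R(2) Q(2) by simp
  moreover have "\<forall>x. range_of U Q' x \<longrightarrow> range_of U Q0 x" using R(4) Q(3) by auto
  moreover have "\<forall>a\<in>insert j T. \<forall>b\<in>U. Q' a b = 0"
  proof (intro ballI)
    fix a b assume a: "a \<in> insert j T" and b: "b \<in> U"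
    show "Q' a b = 0"
    proof (cases "a = j")
      case True
      have "Q j b = g b" using projD(1)[OF Q(1) j b] by (simp add: g_def)
      then show ?thesis using True x gj by (simp add: Q'_def)
    next
      case False
      then show ?thesis using a gT Q(4) b by (auto simp: Q'_def)
    qed
  qed
  moreover have "\<forall>a\<in>insert j T. \<forall>b\<in>U. app U Q' (w' a) b = 0"
  proof (intro ballI)
    fix a b assume a: "a \<in> insert j T" and b: "b \<in> U"
    have base: "app U Q' (\<lambda>b. g b / x) b = 0"
      unfolding R(3) sgn using appg[OF b] by (simp add: appscale)
    show "app U Q' (w' a) b = 0"
    proof (cases "a = j")
      case True
      then show ?thesis using base by (simp add: w'_def)
    next
      case False
      then have aT: "a \<in> T" using a by auto
      have "app U Q' (w a) b = 0" unfolding R(3) using w[OF aT b] gw[OF aT] by simp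
      then show ?thesis using False base by (simp add: w'_def applin del: times_divide_eq_right)
    qed
  qed
  moreover have "\<forall>a\<in>insert j T. range_of U Q0 (w' a) \<and> (\<forall>b\<in>insert j T. w' a b = of_bool (a = b))"
  proof (intro ballI conjI)
    fix a assume a: "a \<in> insert j T"
    show "range_of U Q0 (w' a)"
    proof (cases "a = j")
      case True
      then show ?thesis using rg0 by (simp add: w'_def)
    next
      case False
      then have aT: "a \<in> T" using a by auto
      show ?thesis using False w0[OF aT] rg0
        unfolding range_of_def w'_def by (simp add: applin del: times_divide_eq_right)
    qed
    fix b assume b: "b \<in> insert j T"
    show "w' a b = of_bool (a = b)"
      using a b jT gT gj x wd by (auto simp: w'_def)
  qed
  moreover have "(real (card U) + (\<Sum>a\<in>insert j T. \<Sum>b\<in>U. (w' a b)\<^sup>2)) * (N - Suc k + 1) \<le> real (card U) * (N + 1)"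
  proof -
    have nj: "(\<Sum>b\<in>U. (w' j b)\<^sup>2) = 1 / x"
    proof -
      have "(\<Sum>b\<in>U. (w' j b)\<^sup>2) = (\<Sum>b\<in>U. (g b)\<^sup>2) / x\<^sup>2"
        by (simp add: w'_def power_divide sum_divide_distrib)
      then show ?thesis using gx x by (simp add: power2_eq_square)
    qed
    have na: "(\<Sum>b\<in>U. (w' a b)\<^sup>2) = (\<Sum>b\<in>U. (w a b)\<^sup>2) + (w a j)\<^sup>2 / x" if "a \<in> T" for a
    proof -
      have "a \<noteq> j" using that jT by auto
      then have "(\<Sum>b\<in>U. (w' a b)\<^sup>2) = (\<Sum>b\<in>U. (w a b)\<^sup>2 - 2 * (w a j / x) * (g b * w a b) + (w a j / x)\<^sup>2 * (g b)\<^sup>2)"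
        by (intro sum.cong) (auto simp: w'_def power2_eq_square algebra_simps)
      also have "\<dots> = (\<Sum>b\<in>U. (w a b)\<^sup>2) - 2 * (w a j / x) * (\<Sum>b\<in>U. g b * w a b) + (w a j / x)\<^sup>2 * (\<Sum>b\<in>U. (g b)\<^sup>2)"
        by (simp add: sum.distrib sum_subtractf sum_distrib_left)
      also have "\<dots> = (\<Sum>b\<in>U. (w a b)\<^sup>2) + (w a j)\<^sup>2 / x"
        using gw[OF that] gx[symmetric] x by (simp add: power2_eq_square)
      finally show ?thesis .
    qed
    have "real (card U) + (\<Sum>a\<in>insert j T. \<Sum>b\<in>U. (w' a b)\<^sup>2)
        = \<Phi>0 + (1 + (\<Sum>a\<in>T. (w a j)\<^sup>2)) / x"
      using finT jT na by (simp add: nj \<Phi>0_def sum.distrib add_divide_distrib sum_divide_distrib)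
    also have "\<dots> \<le> \<Phi>0 + \<Phi>0 / tr U Q"
      using pick' x trpos by (intro add_left_mono) (simp add: field_simps)
    also have "\<dots> \<le> \<Phi>0 + \<Phi>0 / (N - k)"
      using Q(2) Suc.prems \<Phi>0_nonneg by (intro add_left_mono divide_left_mono) auto
    finally have le: "real (card U) + (\<Sum>a\<in>insert j T. \<Sum>b\<in>U. (w' a b)\<^sup>2) \<le> \<Phi>0 + \<Phi>0 / (N - k)" .
    have "(real (card U) + (\<Sum>a\<in>insert j T. \<Sum>b\<in>U. (w' a b)\<^sup>2)) * (N - k) \<le> (\<Phi>0 + \<Phi>0 / (N - k)) * (N - k)"
      using Suc.prems by (intro mult_right_mono le) auto
    also have "\<dots> = \<Phi>0 * (N - k + 1)" using Suc.prems by (simp add: distrib_left distrib_right)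
    also have "\<dots> \<le> real (card U) * (N + 1)" using \<Phi> by (simp add: \<Phi>0_def)
    finally show ?thesis by simp
  qed
  ultimately show ?case by (intro exI[of _ "insert j T"] exI[of _ w'] exI[of _ Q']) auto
qed

text \<open>When \<open>k\<close> is at most half the dimension, the potential has at most doubled
  from its initial value \<open>card U\<close>, which leaves \<open>card U\<close> for the squared
  norms.\<close>

lemma dual_family:
  assumes Q: "is_proj U Q" and fin: "finite U" and k: "2 * real k \<le> tr U Q"
  obtains T and w :: "nat \<Rightarrow> nat \<Rightarrow> real" where "T \<subseteq> U" "card T = k" "\<And>a. a \<in> T \<Longrightarrow> range_of U Q (w a)"
    "\<And>a b. a \<in> T \<Longrightarrow> b \<in> T \<Longrightarrow> w a b = of_bool (a = b)"
    "(\<Sum>a\<in>T. \<Sum>b\<in>U. (w a b)\<^sup>2) \<le> card U"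
proof (cases "k = 0")
  case True
  show ?thesis by (rule that[of "{}"]) (use True in auto)
next
  case False
  define N where "N = tr U Q"
  have kN: "real k < N" using False k by (simp add: N_def)
  obtain T and w :: "nat \<Rightarrow> nat \<Rightarrow> real" where T: "T \<subseteq> U" "card T = k"
    and w': "\<forall>a\<in>T. range_of U Q (w a) \<and> (\<forall>b\<in>T. w a b = of_bool (a = b))"
    and \<Phi>: "(real (card U) + (\<Sum>a\<in>T. \<Sum>b\<in>U. (w a b)\<^sup>2)) * (N - k + 1) \<le> real (card U) * (N + 1)"
    using dual_family_step[OF Q fin N_def kN] by (elim exE conjE) (rule that; assumption)
  have w: "range_of U Q (w a)" if "a \<in> T" for a using w' that by blast
  have wd: "w a b = of_bool (a = b)" if "a \<in> T" "b \<in> T" for a b using w' that by blast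
  have nonneg: "0 \<le> (\<Sum>a\<in>T. \<Sum>b\<in>U. (w a b)\<^sup>2)" by (intro sum_nonneg) auto
  have "real (card U) * (N + 1) \<le> 2 * card U * (N - k + 1)"
  proof -
    have "N + 1 \<le> 2 * (N - k + 1)" using k by (simp add: N_def)
    then have "real (card U) * (N + 1) \<le> real (card U) * (2 * (N - k + 1))" by (intro mult_left_mono) auto
    also have "\<dots> = 2 * card U * (N - k + 1)" by (simp add: mult_ac)
    finally show ?thesis .
  qed
  with \<Phi> have "(real (card U) + (\<Sum>a\<in>T. \<Sum>b\<in>U. (w a b)\<^sup>2)) * (N - k + 1) \<le> (2 * card U) * (N - k + 1)" by simp
  moreover have "0 < N - k + 1" using kN by simp
  ultimately have "real (card U) + (\<Sum>a\<in>T. \<Sum>b\<in>U. (w a b)\<^sup>2) \<le> 2 * card U"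
    by (simp only: mult_le_cancel_right_pos)
  then have "(\<Sum>a\<in>T. \<Sum>b\<in>U. (w a b)\<^sup>2) \<le> card U" by simp
  then show ?thesis by (intro that[of T w] T w wd)
qed

section \<open>Spectral windows\<close>

text \<open>The eigenvectors form an orthogonal matrix that conjugates \<open>M\<close> to a
  diagonal one, hence the characteristic polynomial. The second conclusion holds because a left
  inverse of a square matrix is a right inverse.\<close>

lemma ordered_eigenvalues_unique:
  fixes M :: "real mat"
  assumes M: "M \<in> carrier_mat n n"
    and orth: "\<And>i j. i < n \<Longrightarrow> j < n \<Longrightarrow> (\<Sum>a<n. v i a * v j a) = of_bool (i = j)"
    and eig: "\<And>i a. i < n \<Longrightarrow> a < n \<Longrightarrow> (\<Sum>b<n. M $$ (a, b) * v i b) = d i * v i a"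
  shows "mset (ordered_eigenvalues M) = mset (map d [0..<n])"
    and "\<And>a b. a < n \<Longrightarrow> b < n \<Longrightarrow> (\<Sum>i<n. v i a * v i b) = of_bool (a = b)"
proof -
  define P where "P = Matrix.mat n n (\<lambda>(a, i). v i a)"
  define D where "D = Matrix.mat n n (\<lambda>(i, j). if i = j then d i else 0)"
  have carr: "P \<in> carrier_mat n n" "transpose_mat P \<in> carrier_mat n n" "D \<in> carrier_mat n n"
    by (auto simp: P_def D_def)
  have PP: "transpose_mat P * P = 1\<^sub>m n"
    by (rule eq_matI) (auto simp: P_def scalar_prod_def orth atLeast0LessThan of_bool_def)
  then have PP': "P * transpose_mat P = 1\<^sub>m n"
    using mat_mult_left_right_inverse[OF carr(2,1)] by simp
  show "(\<Sum>i<n. v i a * v i b) = of_bool (a = b)" if "a < n" "b < n" for a b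
  proof -
    have "(\<Sum>i<n. v i a * v i b) = (P * transpose_mat P) $$ (a, b)"
      using that by (simp add: P_def scalar_prod_def atLeast0LessThan)
    also have "\<dots> = of_bool (a = b)" unfolding PP' using that by simp
    finally show ?thesis .
  qed
  have MP: "M * P = P * D"
  proof (rule eq_matI)
    fix a i assume "a < dim_row (P * D)" "i < dim_col (P * D)"
    then have ai: "a < n" "i < n" using carr by auto
    have "(M * P) $$ (a, i) = (\<Sum>b<n. M $$ (a, b) * v i b)"
      using M ai by (simp add: P_def scalar_prod_def atLeast0LessThan)
    moreover have "(P * D) $$ (a, i) = (\<Sum>j<n. v j a * (if j = i then d j else 0))"
      using ai by (simp add: P_def D_def scalar_prod_def atLeast0LessThan)
    moreover have "\<dots> = d i * v i a" using ai by (simp add: if_distrib mult.commute cong: if_cong)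
    ultimately show "(M * P) $$ (a, i) = (P * D) $$ (a, i)" using eig[OF ai(2,1)] by simp
  qed (use M carr in auto)
  have "M = P * D * transpose_mat P"
  proof -
    have "M = M * (P * transpose_mat P)" using M PP' by simp
    also have "\<dots> = M * P * transpose_mat P" using M carr by (simp add: assoc_mult_mat[of M n n P n _ n])
    finally show ?thesis by (simp add: MP)
  qed
  then have "similar_mat_wit M D P (transpose_mat P)"
    using PP PP' M carr by (auto simp: similar_mat_wit_def Let_def)
  then have "char_poly M = char_poly D"
    by (intro char_poly_similar) (auto simp: similar_mat_def)
  also have "\<dots> = (\<Prod>a\<leftarrow>diag_mat D. [:- a, 1:])"
    by (rule char_poly_upper_triangular[OF carr(3)]) (auto simp: D_def)
  also have "diag_mat D = map d [0..<n]"
    unfolding diag_mat_def by (auto simp: D_def)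
  finally have cp: "char_poly M = (\<Prod>a\<leftarrow>map d [0..<n]. [:- a, 1:])" .
  have pr: "proots (\<Prod>a\<leftarrow>xs. [:- a, 1:]) = mset xs" for xs :: "real list"
  proof (induction xs)
    case (Cons x xs)
    have "(\<Prod>a\<leftarrow>xs. [:- a, 1:]) \<noteq> 0" by (auto simp: prod_list_zero_iff)
    then show ?case using Cons by (simp add: proots_mult del: mult_pCons_left)
  qed simp
  show "mset (ordered_eigenvalues M) = mset (map d [0..<n])"
    unfolding ordered_eigenvalues_def cp pr by simp
qed

definition spectral :: "nat set \<Rightarrow> (nat \<Rightarrow> nat \<Rightarrow> real) \<Rightarrow> (nat \<Rightarrow> nat \<Rightarrow> real) \<Rightarrow> (nat \<Rightarrow> real) \<Rightarrow> bool" where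
  "spectral U S v \<mu> \<longleftrightarrow>
     (\<forall>i<card U. \<forall>j<card U. (\<Sum>a\<in>U. v i a * v j a) = of_bool (i = j)) \<and>
     (\<forall>i<card U. \<forall>a\<in>U. (\<Sum>b\<in>U. S a b * v i b) = \<mu> i * v i a) \<and>
     (\<forall>a\<in>U. \<forall>b\<in>U. (\<Sum>i<card U. v i a * v i b) = of_bool (a = b))"

definition sym_mat :: "nat \<Rightarrow> (nat \<Rightarrow> nat \<Rightarrow> real) \<Rightarrow> real mat" where
  "sym_mat n S = Matrix.mat n n (\<lambda>(a, b). S a b)"

text \<open>Diagonalisation is read off from \<open>V\<close>, which is a choice for every real
  symmetric matrix. Therefore it serves auxiliary Gram matrices too, and
  \<open>eigenvector_choice V\<close> appears in lemmas that do not concern the eigenvectors of the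
  graph.\<close>

lemma spectral_sorted:
  assumes V: "eigenvector_choice V" and sym: "\<And>a b. a < n \<Longrightarrow> b < n \<Longrightarrow> S a b = S b a"
  defines "M \<equiv> sym_mat n S"
  shows "spectral {..<n} S (\<lambda>i a. vec_index (V M i) a) (\<lambda>i. ordered_eigenvalues M ! i)"
    and "length (ordered_eigenvalues M) = n" and "sorted (ordered_eigenvalues M)"
proof -
  have M: "M \<in> carrier_mat n n" by (simp add: M_def sym_mat_def)
  have "transpose_mat M = M" by (rule eq_matI) (auto simp: M_def sym_mat_def sym)
  then have B: "ordered_eigenbasis M (V M)" using V by (simp add: eigenvector_choice_def)
  have dim: "dim_row M = n" "dim_col M = n" using M by auto
  have carr: "V M i \<in> carrier_vec n" if "i < n" for i
    using B that dim by (auto simp: ordered_eigenbasis_def)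
  have orth: "(\<Sum>a<n. V M i $ a * V M j $ a) = of_bool (i = j)" if "i < n" "j < n" for i j
  proof -
    have "V M i \<bullet> V M j = (if i = j then 1 else 0)"
      using B that dim by (auto simp: ordered_eigenbasis_def)
    moreover have "V M i \<bullet> V M j = (\<Sum>a<n. V M i $ a * V M j $ a)"
      using carr[OF that(2)] by (simp add: scalar_prod_def atLeast0LessThan)
    ultimately show ?thesis by simp
  qed
  have eig: "(\<Sum>b<n. M $$ (a, b) * V M i $ b) = ordered_eigenvalues M ! i * V M i $ a" if "i < n" "a < n" for i a
  proof -
    have "M *\<^sub>v V M i = (ordered_eigenvalues M ! i) \<cdot>\<^sub>v V M i"
      using B that dim by (auto simp: ordered_eigenbasis_def)
    then have "(M *\<^sub>v V M i) $ a = ((ordered_eigenvalues M ! i) \<cdot>\<^sub>v V M i) $ a" by simp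
    then show ?thesis using carr[OF that(1)] that dim by (simp add: scalar_prod_def atLeast0LessThan)
  qed
  note U = ordered_eigenvalues_unique[OF M orth eig]
  \<comment> \<open>Indexing with \<open>!\<close> says nothing beyond the end of the list; it is
    this equality of multisets that shows the list to have length \<open>n\<close>.\<close>
  have "mset (ordered_eigenvalues M) = mset (map (\<lambda>i. ordered_eigenvalues M ! i) [0..<n])" by (rule U(1))
  then have "size (mset (ordered_eigenvalues M)) = n" by (metis size_mset length_map length_upt minus_nat.diff_0)
  then show "length (ordered_eigenvalues M) = n" by simp
  show "sorted (ordered_eigenvalues M)" by (simp add: ordered_eigenvalues_def)
  have "S a b = M $$ (a, b)" if "a < n" "b < n" for a b using that by (simp add: M_def sym_mat_def)
  then show "spectral {..<n} S (\<lambda>i a. vec_index (V M i) a) (\<lambda>i. ordered_eigenvalues M ! i)"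
    using orth eig U(2) by (auto simp: spectral_def)
qed

lemma spectral_exists:
  assumes V: "eigenvector_choice V" and fin: "finite U" and sym: "\<And>a b. a \<in> U \<Longrightarrow> b \<in> U \<Longrightarrow> S a b = S b a"
  obtains v \<mu> where "spectral U S v \<mu>"
proof -
  obtain f where f: "bij_betw f {..<card U} U"
    using ex_bij_betw_nat_finite[OF fin] by (auto simp: atLeast0LessThan)
  define n where "n = card U"
  define g where "g = the_inv_into {..<n} f"
  have fU: "f i \<in> U" if "i < n" for i using f that by (auto simp: bij_betw_def n_def)
  have gf: "g (f i) = i" if "i < n" for i
    using f that unfolding g_def by (intro the_inv_into_f_f) (auto simp: bij_betw_def n_def)
  have gU: "g a < n" "f (g a) = a" if "a \<in> U" for a
  proof -
    have "f ` {..<n} = U" using f by (simp add: bij_betw_def n_def)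
    then have "a \<in> f ` {..<n}" using that by simp
    then obtain i where "i < n" "a = f i" by auto
    then show "g a < n" "f (g a) = a" using gf by auto
  qed
  have reidx: "(\<Sum>a\<in>U. h a) = (\<Sum>i<n. h (f i))" for h :: "nat \<Rightarrow> real"
    using sum.reindex_bij_betw[OF f, of h] by (simp add: n_def)
  define S' where "S' = (\<lambda>i j. S (f i) (f j))"
  obtain v \<mu> where sp: "spectral {..<n} S' v \<mu>"
    using spectral_sorted(1)[OF V, of n S'] sym fU by (auto simp: S'_def)
  have "spectral U S (\<lambda>i a. v i (g a)) \<mu>"
    unfolding spectral_def reidx
  proof (intro conjI allI ballI impI)
    fix i j assume ij: "i < card U" "j < card U"
    have "(\<Sum>k<n. v i (g (f k)) * v j (g (f k))) = (\<Sum>k<n. v i k * v j k)"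
      using gf by (intro sum.cong) auto
    then show "(\<Sum>k<n. v i (g (f k)) * v j (g (f k))) = of_bool (i = j)"
      using sp ij by (simp add: spectral_def n_def)
  next
    fix i a assume ia: "i < card U" "a \<in> U"
    have "(\<Sum>k<n. S a (f k) * v i (g (f k))) = (\<Sum>k<n. S' (g a) k * v i k)"
      using gf gU[OF ia(2)] by (intro sum.cong) (auto simp: S'_def)
    then show "(\<Sum>k<n. S a (f k) * v i (g (f k))) = \<mu> i * v i (g a)"
      using sp ia gU[OF ia(2)] by (simp add: spectral_def n_def)
  next
    fix a b assume ab: "a \<in> U" "b \<in> U"
    show "(\<Sum>i<card U. v i (g a) * v i (g b)) = of_bool (a = b)"
    proof -
      have "(g a = g b) = (a = b)" using gU(2)[OF ab(1)] gU(2)[OF ab(2)] by metis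
      moreover have "(\<Sum>i<n. v i (g a) * v i (g b)) = of_bool (g a = g b)"
        using sp gU(1)[OF ab(1)] gU(1)[OF ab(2)] unfolding spectral_def by simp
      ultimately show ?thesis by (simp add: n_def)
    qed
  qed
  then show ?thesis using that by blast
qed

lemma spectral_expand:
  assumes sp: "spectral U S v \<mu>" and fin: "finite U"
  defines "c \<equiv> \<lambda>x i. \<Sum>a\<in>U. x a * v i a"
  shows "\<And>a. a \<in> U \<Longrightarrow> x a = (\<Sum>i<card U. c x i * v i a)"
    and "(\<Sum>a\<in>U. x a * y a) = (\<Sum>i<card U. c x i * c y i)"
    and "(\<Sum>a\<in>U. x a * (\<Sum>b\<in>U. S a b * x b)) = (\<Sum>i<card U. \<mu> i * (c x i)\<^sup>2)"
proof -
  have exp: "x a = (\<Sum>i<card U. c x i * v i a)" if "a \<in> U" for a x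
  proof -
    have "(\<Sum>i<card U. c x i * v i a) = (\<Sum>b\<in>U. x b * (\<Sum>i<card U. v i b * v i a))"
      by (simp add: c_def sum_distrib_left sum_distrib_right sum.swap[of _ _ "{..<card U}"] mult.assoc)
    also have "\<dots> = (\<Sum>b\<in>U. x b * of_bool (b = a))"
      using sp that by (intro sum.cong) (auto simp: spectral_def)
    also have "\<dots> = x a" using fin that by (simp add: of_bool_def if_distrib cong: if_cong)
    finally show ?thesis by simp
  qed
  show "x a = (\<Sum>i<card U. c x i * v i a)" if "a \<in> U" for a using exp[OF that] .
  have ip: "(\<Sum>a\<in>U. x a * y a) = (\<Sum>i<card U. c x i * c y i)" for x y
  proof -
    have "(\<Sum>a\<in>U. x a * y a) = (\<Sum>a\<in>U. (\<Sum>i<card U. c x i * v i a) * y a)"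
      using exp by (intro sum.cong) auto
    also have "\<dots> = (\<Sum>i<card U. c x i * (\<Sum>a\<in>U. y a * v i a))"
      by (simp add: sum_distrib_left sum_distrib_right sum.swap[of _ _ "{..<card U}"] mult_ac)
    finally show ?thesis by (simp add: c_def)
  qed
  show "(\<Sum>a\<in>U. x a * y a) = (\<Sum>i<card U. c x i * c y i)" by (rule ip)
  have Sx: "(\<Sum>b\<in>U. S a b * x b) = (\<Sum>i<card U. (\<mu> i * c x i) * v i a)" if a: "a \<in> U" for a
  proof -
    have "(\<Sum>b\<in>U. S a b * x b) = (\<Sum>b\<in>U. S a b * (\<Sum>i<card U. c x i * v i b))"
      using exp by (intro sum.cong) auto
    also have "\<dots> = (\<Sum>i<card U. c x i * (\<Sum>b\<in>U. S a b * v i b))"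
      by (simp add: sum_distrib_left sum.swap[of _ _ "{..<card U}"] mult_ac)
    also have "\<dots> = (\<Sum>i<card U. (\<mu> i * c x i) * v i a)"
      using sp a by (intro sum.cong) (auto simp: spectral_def)
    finally show ?thesis .
  qed
  have "(\<Sum>a\<in>U. x a * (\<Sum>b\<in>U. S a b * x b)) = (\<Sum>a\<in>U. x a * (\<Sum>i<card U. (\<mu> i * c x i) * v i a))"
    using Sx by (intro sum.cong) auto
  also have "\<dots> = (\<Sum>i<card U. (\<mu> i * c x i) * (\<Sum>a\<in>U. x a * v i a))"
    by (simp add: sum_distrib_left sum_distrib_right sum.swap[of _ _ "{..<card U}"] mult_ac)
  finally show "(\<Sum>a\<in>U. x a * (\<Sum>b\<in>U. S a b * x b)) = (\<Sum>i<card U. \<mu> i * (c x i)\<^sup>2)"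
    by (simp add: c_def power2_eq_square mult.assoc)
qed

section \<open>Windows of small singular values\<close>

definition qf :: "nat set \<Rightarrow> nat set \<Rightarrow> (nat \<Rightarrow> nat \<Rightarrow> real) \<Rightarrow> (nat \<Rightarrow> real) \<Rightarrow> real" where
  "qf R U m x = (\<Sum>r\<in>R. (\<Sum>a\<in>U. m r a * x a)\<^sup>2)"

definition comb :: "nat set \<Rightarrow> (nat \<Rightarrow> nat \<Rightarrow> real) \<Rightarrow> (nat \<Rightarrow> real) \<Rightarrow> nat \<Rightarrow> real" where
  "comb D v c a = (\<Sum>i\<in>D. c i * v i a)"

text \<open>\<open>window U R m \<theta> D v\<close>: the family \<open>v i\<close>, \<open>i \<in> D\<close>, spans the singular subspace of the array
  \<open>m\<close> belonging to squared singular values at most \<open>\<theta>\<close>.\<close>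

definition window :: "nat set \<Rightarrow> nat set \<Rightarrow> (nat \<Rightarrow> nat \<Rightarrow> real) \<Rightarrow> real \<Rightarrow> nat set \<Rightarrow> (nat \<Rightarrow> nat \<Rightarrow> real) \<Rightarrow> bool" where
  "window U R m \<theta> D v \<longleftrightarrow> finite D \<and> card D \<le> card U \<and>
     (\<forall>i\<in>D. \<forall>j\<in>D. (\<Sum>a\<in>U. v i a * v j a) = of_bool (i = j)) \<and>
     (\<forall>x. (\<Sum>a\<in>U. (x a - comb D v (\<lambda>i. \<Sum>a\<in>U. x a * v i a) a)\<^sup>2) * \<theta> \<le> qf R U m x) \<and>
     (\<forall>c. qf R U m (comb D v c) \<le> \<theta> * (\<Sum>i\<in>D. (c i)\<^sup>2))"

lemma qf_gram:
  "qf R U m x = (\<Sum>a\<in>U. x a * (\<Sum>b\<in>U. (\<Sum>r\<in>R. m r a * m r b) * x b))"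
proof -
  have "qf R U m x = (\<Sum>r\<in>R. \<Sum>a\<in>U. \<Sum>b\<in>U. (m r a * x a) * (m r b * x b))"
    by (simp add: qf_def power2_eq_square sum_product)
  also have "\<dots> = (\<Sum>a\<in>U. \<Sum>b\<in>U. \<Sum>r\<in>R. (m r a * x a) * (m r b * x b))"
    by (subst sum.swap) (intro sum.cong refl sum.swap)
  also have "\<dots> = (\<Sum>a\<in>U. x a * (\<Sum>b\<in>U. (\<Sum>r\<in>R. m r a * m r b) * x b))"
    by (simp add: sum_distrib_left sum_distrib_right mult_ac)
  finally show ?thesis .
qed

text \<open>The squared singular values are the eigenvalues of the Gram matrix of the columns; the
  window consists of the eigenvectors whose eigenvalue is at most \<theta>.\<close>

lemma window_exists:
  assumes V: "eigenvector_choice V" and fin: "finite U" and \<theta>: "0 \<le> \<theta>"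
  shows "\<exists>D v. window U R m \<theta> D v"
proof -
  define S where "S = (\<lambda>a b. \<Sum>r\<in>R. m r a * m r b)"
  obtain v \<mu> where sp: "spectral U S v \<mu>"
    using spectral_exists[OF V fin, of S] by (auto simp: S_def mult.commute)
  define c where "c x i = (\<Sum>a\<in>U. x a * v i a)" for x i
  note E = spectral_expand[OF sp fin, folded c_def]
  have q: "qf R U m x = (\<Sum>i<card U. \<mu> i * (c x i)\<^sup>2)" for x
    unfolding qf_gram using E(3)[of x] by (simp add: S_def)
  have orth: "(\<Sum>a\<in>U. v i a * v j a) = of_bool (i = j)" if "i < card U" "j < card U" for i j
    using sp that by (simp add: spectral_def)
  have cv: "c (v i) j = of_bool (i = j)" if "i < card U" "j < card U" for i j
    unfolding c_def using orth that by auto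
  have \<mu>: "0 \<le> \<mu> i" if "i < card U" for i
  proof -
    have "qf R U m (v i) = (\<Sum>j<card U. if i = j then \<mu> j else 0)"
      unfolding q using that by (intro sum.cong) (auto simp: cv)
    also have "\<dots> = \<mu> i" using that by simp
    finally have "qf R U m (v i) = \<mu> i" .
    moreover have "0 \<le> qf R U m (v i)" unfolding qf_def by (intro sum_nonneg) auto
    ultimately show ?thesis by simp
  qed
  define D where "D = {i. i < card U \<and> \<mu> i \<le> \<theta>}"
  have D: "finite D" "D \<subseteq> {..<card U}" by (auto simp: D_def)
  have ccomb: "c (comb D v k) j = (if j \<in> D then k j else 0)" if "j < card U" for j k
  proof -
    have "c (comb D v k) j = (\<Sum>i\<in>D. k i * (\<Sum>a\<in>U. v i a * v j a))"
      by (simp add: c_def comb_def sum_distrib_right sum_distrib_left sum.swap[of _ _ D] mult.assoc)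
    also have "\<dots> = (\<Sum>i\<in>D. k i * of_bool (i = j))"
      using orth that D by (intro sum.cong) auto
    also have "\<dots> = (if j \<in> D then k j else 0)" using D(1) by (simp add: of_bool_def if_distrib cong: if_cong)
    finally show ?thesis .
  qed
  have "window U R m \<theta> D v" unfolding window_def
  proof (intro conjI ballI allI)
    show "card D \<le> card U" using card_mono[OF _ D(2)] by simp
  next
    fix i j assume "i \<in> D" "j \<in> D"
    then show "(\<Sum>a\<in>U. v i a * v j a) = of_bool (i = j)" using orth[of i j] D(2) by blast
  next
    fix x
    define y where "y = (\<lambda>a. x a - comb D v (c x) a)"
    have cy: "c y j = (if j \<in> D then 0 else c x j)" if "j < card U" for j
    proof -
      have "c y j = c x j - c (comb D v (c x)) j"
        unfolding c_def y_def left_diff_distrib sum_subtractf ..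
      then show ?thesis using ccomb[OF that, of "c x"] by simp
    qed
    have "(\<Sum>a\<in>U. (y a)\<^sup>2) * \<theta> = (\<Sum>j<card U. (c y j)\<^sup>2 * \<theta>)"
      using E(2)[of y y] by (simp add: power2_eq_square sum_distrib_right)
    also have "\<dots> \<le> (\<Sum>j<card U. \<mu> j * (c x j)\<^sup>2)"
    proof (rule sum_mono)
      fix j assume "j \<in> {..<card U}"
      then have j: "j < card U" by simp
      show "(c y j)\<^sup>2 * \<theta> \<le> \<mu> j * (c x j)\<^sup>2"
      proof (cases "j \<in> D")
        case True
        then show ?thesis using cy[OF j] \<mu>[OF j] by simp
      next
        case False
        then have "\<theta> \<le> \<mu> j" using j by (simp add: D_def)
        then have "\<theta> * (c x j)\<^sup>2 \<le> \<mu> j * (c x j)\<^sup>2" by (rule mult_right_mono) simp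
        then show ?thesis using cy[OF j] False by (simp add: mult.commute)
      qed
    qed
    finally show "(\<Sum>a\<in>U. (x a - comb D v (\<lambda>i. \<Sum>a\<in>U. x a * v i a) a)\<^sup>2) * \<theta> \<le> qf R U m x"
      unfolding q by (simp add: y_def c_def[abs_def])
  next
    fix k
    have "qf R U m (comb D v k) = (\<Sum>j<card U. if j \<in> D then \<mu> j * (k j)\<^sup>2 else 0)"
      unfolding q by (intro sum.cong) (auto simp: ccomb)
    also have "\<dots> = (\<Sum>j\<in>D. \<mu> j * (k j)\<^sup>2)"
      using D by (subst sum.inter_restrict[symmetric]) (auto intro!: sum.cong)
    also have "\<dots> \<le> (\<Sum>j\<in>D. \<theta> * (k j)\<^sup>2)"
      by (intro sum_mono mult_right_mono) (auto simp: D_def)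
    finally show "qf R U m (comb D v k) \<le> \<theta> * (\<Sum>i\<in>D. (k i)\<^sup>2)" by (simp add: sum_distrib_left)
  qed (use D in auto)
  then show ?thesis by blast
qed

definition kernel_of :: "nat set \<Rightarrow> (nat \<Rightarrow> nat \<Rightarrow> real) \<Rightarrow> nat \<Rightarrow> nat \<Rightarrow> real" where
  "kernel_of D v a b = (\<Sum>i\<in>D. v i a * v i b)"

lemma kernel_of_proj:
  assumes D: "finite D" and orth: "\<And>i j. i \<in> D \<Longrightarrow> j \<in> D \<Longrightarrow> (\<Sum>a\<in>U. v i a * v j a) = of_bool (i = j)"
  shows "is_proj U (kernel_of D v)" "tr U (kernel_of D v) = card D"
    "app U (kernel_of D v) x a = comb D v (\<lambda>i. \<Sum>a\<in>U. x a * v i a) a"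
proof -
  show "app U (kernel_of D v) x a = comb D v (\<lambda>i. \<Sum>a\<in>U. x a * v i a) a"
    by (simp add: app_def kernel_of_def comb_def sum_distrib_left sum_distrib_right sum.swap[of _ _ D] mult_ac)
  have "tr U (kernel_of D v) = (\<Sum>i\<in>D. \<Sum>a\<in>U. v i a * v i a)"
    by (simp add: tr_def kernel_of_def sum.swap[of _ _ D])
  then show "tr U (kernel_of D v) = card D" using orth by simp
  have "(\<Sum>c\<in>U. kernel_of D v a c * kernel_of D v c b) = kernel_of D v a b" for a b
  proof -
    have "(\<Sum>c\<in>U. kernel_of D v a c * kernel_of D v c b)
       = (\<Sum>i\<in>D. \<Sum>j\<in>D. v i a * v j b * (\<Sum>c\<in>U. v i c * v j c))"
    proof -
      have "(\<Sum>c\<in>U. kernel_of D v a c * kernel_of D v c b) = (\<Sum>c\<in>U. \<Sum>i\<in>D. \<Sum>j\<in>D. v i a * v j b * (v i c * v j c))"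
        by (simp add: kernel_of_def sum_product mult_ac)
      also have "\<dots> = (\<Sum>i\<in>D. \<Sum>c\<in>U. \<Sum>j\<in>D. v i a * v j b * (v i c * v j c))" by (rule sum.swap)
      also have "\<dots> = (\<Sum>i\<in>D. \<Sum>j\<in>D. \<Sum>c\<in>U. v i a * v j b * (v i c * v j c))" by (intro sum.cong refl sum.swap)
      finally show ?thesis by (simp add: sum_distrib_left)
    qed
    also have "\<dots> = (\<Sum>i\<in>D. \<Sum>j\<in>D. v i a * v j b * of_bool (i = j))"
      using orth by (intro sum.cong) auto
    also have "\<dots> = kernel_of D v a b"
      using D by (simp add: kernel_of_def of_bool_def if_distrib cong: if_cong)
    finally show ?thesis .
  qed
  then show "is_proj U (kernel_of D v)" by (simp add: is_proj_def kernel_of_def mult.commute)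
qed

text \<open>Comparing traces replaces the usual dimension count, at the price of a factor \<open>2\<close>.\<close>

lemma window_dim_ge:
  assumes win: "window U R m (2 * h) D v" and h: "0 < h" and fin: "finite U" and Q: "is_proj U Q"
    and small: "\<And>x. range_of U Q x \<Longrightarrow> qf R U m x \<le> h * (\<Sum>a\<in>U. (x a)\<^sup>2)"
  shows "tr U Q \<le> 2 * card D"
proof -
  define c where "c x i = (\<Sum>a\<in>U. x a * v i a)" for x i
  have D: "finite D" and orth: "\<And>i j. i \<in> D \<Longrightarrow> j \<in> D \<Longrightarrow> (\<Sum>a\<in>U. v i a * v j a) = of_bool (i = j)"
    using win by (auto simp: window_def)
  note K = kernel_of_proj[OF D orth]
  \<comment> \<open>The threshold of the window is \<open>2 * h\<close>, twice the bound on the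
    range of \<open>Q\<close>, so at most half of the squared norm of \<open>x\<close> can lie
    outside the window.\<close>
  have low: "(\<Sum>a\<in>U. (x a)\<^sup>2) \<le> 2 * (\<Sum>i\<in>D. (c x i)\<^sup>2)" if x: "range_of U Q x" for x
  proof -
    have "(\<Sum>a\<in>U. (x a - comb D v (c x) a)\<^sup>2) * (2 * h) \<le> h * (\<Sum>a\<in>U. (x a)\<^sup>2)"
    proof -
      have "(\<Sum>a\<in>U. (x a - comb D v (c x) a)\<^sup>2) * (2 * h) \<le> qf R U m x"
        using win unfolding window_def c_def[abs_def] by blast
      then show ?thesis using small[OF x] by linarith
    qed
    then have 1: "2 * (\<Sum>a\<in>U. (x a - comb D v (c x) a)\<^sup>2) \<le> (\<Sum>a\<in>U. (x a)\<^sup>2)"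
      using h by (simp add: mult.commute mult.left_commute)
    have 2: "(\<Sum>a\<in>U. x a * comb D v (c x) a) = (\<Sum>i\<in>D. (c x i)\<^sup>2)"
      by (simp add: comb_def c_def power2_eq_square sum_distrib_left sum_distrib_right sum.swap[of _ _ D] mult_ac)
    have K3: "app U (kernel_of D v) x a = comb D v (c x) a" for a
      by (simp add: K(3) c_def[abs_def])
    have 3: "(\<Sum>a\<in>U. (comb D v (c x) a)\<^sup>2) = (\<Sum>i\<in>D. (c x i)\<^sup>2)"
      using app_norm[OF K(1), of x] unfolding K3 2 .
    have "(\<Sum>a\<in>U. (x a - comb D v (c x) a)\<^sup>2) = (\<Sum>a\<in>U. (x a)\<^sup>2) - 2 * (\<Sum>a\<in>U. x a * comb D v (c x) a) + (\<Sum>a\<in>U. (comb D v (c x) a)\<^sup>2)"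
      by (simp add: power2_diff sum.distrib sum_subtractf sum_distrib_left mult.assoc)
    with 1 2 3 show ?thesis by simp
  qed
  \<comment> \<open>The trace is the sum of the squared norms of the columns of \<open>Q\<close>, to
    which \<open>low\<close> applies. By symmetry of \<open>Q\<close>, the coefficients of the
    columns along \<open>v i\<close> are the entries of the projection of
    \<open>v i\<close>.\<close>
  have "tr U Q = (\<Sum>j\<in>U. \<Sum>a\<in>U. (Q a j)\<^sup>2)"
    unfolding tr_def using proj_col(2)[OF Q] by simp
  also have "\<dots> \<le> (\<Sum>j\<in>U. 2 * (\<Sum>i\<in>D. (c (\<lambda>a. Q a j) i)\<^sup>2))"
    using low proj_col(1)[OF Q] by (intro sum_mono) auto
  also have "\<dots> = 2 * (\<Sum>i\<in>D. \<Sum>j\<in>U. (app U Q (v i) j)\<^sup>2)"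
  proof -
    have "c (\<lambda>a. Q a j) i = app U Q (v i) j" if "j \<in> U" for i j
      unfolding c_def app_def using projD(1)[OF Q] that by (intro sum.cong) auto
    then have "(\<Sum>j\<in>U. 2 * (\<Sum>i\<in>D. (c (\<lambda>a. Q a j) i)\<^sup>2)) = (\<Sum>j\<in>U. 2 * (\<Sum>i\<in>D. (app U Q (v i) j)\<^sup>2))"
      by (intro sum.cong) auto
    also have "\<dots> = 2 * (\<Sum>i\<in>D. \<Sum>j\<in>U. (app U Q (v i) j)\<^sup>2)"
      by (subst sum.swap) (simp add: sum_distrib_left)
    finally show ?thesis .
  qed
  also have "\<dots> \<le> 2 * (\<Sum>i\<in>D. \<Sum>a\<in>U. (v i a)\<^sup>2)"
    by (intro mult_left_mono sum_mono app_norm_le[OF Q]) auto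
  also have "\<dots> = 2 * card D" using orth by (simp add: power2_eq_square)
  finally show ?thesis by simp
qed

section \<open>Projection of a random row to a fixed subspace\<close>

context bernoulli_sets begin

text \<open>Adding a coordinate changes the centred form by a martingale increment, so the cross
  term vanishes and variances add up.\<close>

lemma EV_quadratic_form_variance:
  assumes "finite U" and "\<And>a b. Q a b = Q b a"
  shows "EV U (\<lambda>B. ((\<Sum>a\<in>U. \<Sum>b\<in>U. Q a b * (of_bool (a \<in> B) - p) * (of_bool (b \<in> B) - p)) - p * (1 - p) * (\<Sum>a\<in>U. Q a a))\<^sup>2)
     \<le> (\<Sum>a\<in>U. \<Sum>b\<in>U. (Q a b)\<^sup>2)"
  using assms(1)
proof (induction U rule: finite_induct)
  case (insert j U)
  define y where "y B a = of_bool (a \<in> B) - p" for B :: "'a set" and a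
  define D where "D B = (\<Sum>a\<in>U. \<Sum>b\<in>U. Q a b * y B a * y B b) - p * (1 - p) * (\<Sum>a\<in>U. Q a a)" for B
  define L where "L B = (\<Sum>b\<in>U. Q j b * y B b)" for B
  define s where "s = (\<Sum>b\<in>U. (Q j b)\<^sup>2)"
  define d where "d = 1 - p - p"
  \<comment> \<open>Since \<open>y B j\<close> takes only the values \<open>1 - p\<close> and
    \<open>- p\<close>, its square minus \<open>p * (1 - p)\<close> equals \<open>d\<close> times
    itself. The whole increment is therefore \<open>y B j\<close> times
    \<open>\<alpha> B\<close>.\<close>
  define \<alpha> where "\<alpha> B = Q j j * d + 2 * L B" for B
  let ?D' = "\<lambda>B. (\<Sum>a\<in>insert j U. \<Sum>b\<in>insert j U. Q a b * y B a * y B b) - p * (1 - p) * (\<Sum>a\<in>insert j U. Q a a)"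
  have Lsym: "(\<Sum>a\<in>U. Q a j * y B a * c) = c * L B" for B c
    unfolding L_def sum_distrib_left by (intro sum.cong refl) (simp add: assms(2)[of _ j] mult_ac)
  have D': "?D' B = D B + Q j j * ((y B j)\<^sup>2 - p * (1 - p)) + 2 * y B j * L B" for B
  proof -
    have "(\<Sum>b\<in>U. Q j b * y B j * y B b) = y B j * L B"
      unfolding L_def sum_distrib_left by (intro sum.cong refl) simp
    then show ?thesis using insert(1,2) Lsym[of B "y B j"]
      by (simp add: D_def sum.distrib power2_eq_square algebra_simps)
  qed
  have Dins: "D (insert j B) = D B" "L (insert j B) = L B" for B
  proof -
    have "y (insert j B) a = y B a" if "a \<in> U" for a using that insert(2) by (auto simp: y_def)
    then show "D (insert j B) = D B" "L (insert j B) = L B"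
      unfolding D_def L_def by simp_all
  qed
  have yj: "y (insert j B) j = 1 - p" for B by (simp add: y_def)
  have yj': "y B j = - p" if "B \<subseteq> U" for B using that insert(2) by (auto simp: y_def)
  have "EV (insert j U) (\<lambda>B. (?D' B)\<^sup>2) = p * EV U (\<lambda>B. (?D' (insert j B))\<^sup>2) + (1 - p) * EV U (\<lambda>B. (?D' B)\<^sup>2)"
    by (rule EV_insert[OF insert(1,2)])
  also have "EV U (\<lambda>B. (?D' (insert j B))\<^sup>2) = EV U (\<lambda>B. (D B + (1 - p) * \<alpha> B)\<^sup>2)"
    unfolding D' Dins yj by (intro EV_cong arg_cong[of _ _ "\<lambda>x. x\<^sup>2"]) (simp add: \<alpha>_def d_def power2_eq_square algebra_simps)
  also have "EV U (\<lambda>B. (?D' B)\<^sup>2) = EV U (\<lambda>B. (D B - p * \<alpha> B)\<^sup>2)"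
    unfolding D' by (intro EV_cong arg_cong[of _ _ "\<lambda>x. x\<^sup>2"]) (simp add: yj' \<alpha>_def d_def power2_eq_square algebra_simps)
  also have "p * EV U (\<lambda>B. (D B + (1 - p) * \<alpha> B)\<^sup>2) + (1 - p) * EV U (\<lambda>B. (D B - p * \<alpha> B)\<^sup>2)
     = EV U (\<lambda>B. (D B)\<^sup>2 + p * (1 - p) * (\<alpha> B)\<^sup>2)"
    unfolding EV_cmult[symmetric] EV_add[symmetric]
    by (intro EV_cong) (simp add: power2_eq_square algebra_simps)
  also have "\<dots> = EV U (\<lambda>B. (D B)\<^sup>2) + p * (1 - p) * EV U (\<lambda>B. (\<alpha> B)\<^sup>2)"
    unfolding EV_add EV_cmult ..
  also have "EV U (\<lambda>B. (\<alpha> B)\<^sup>2) = (Q j j * d)\<^sup>2 + 4 * (p * (1 - p) * s)"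
  proof -
    have "EV U (\<lambda>B. (\<alpha> B)\<^sup>2) = EV U (\<lambda>B. ((Q j j * d)\<^sup>2 + (4 * Q j j * d) * L B) + 4 * (L B)\<^sup>2)"
      by (intro EV_cong) (simp add: \<alpha>_def power2_eq_square algebra_simps)
    also have "\<dots> = (Q j j * d)\<^sup>2 + (4 * Q j j * d) * EV U L + 4 * EV U (\<lambda>B. (L B)\<^sup>2)"
      using insert(1) unfolding EV_add EV_cmult by (simp add: EV_cmult[of U _ L])
    also have "EV U L = 0" unfolding L_def y_def by (rule EV_centered_sum[OF insert(1)])
    also have "EV U (\<lambda>B. (L B)\<^sup>2) = p * (1 - p) * s"
      unfolding L_def y_def s_def by (rule EV_centered_sum_sq[OF insert(1)])
    finally show ?thesis by simp
  qed
  also have "EV U (\<lambda>B. (D B)\<^sup>2) + p * (1 - p) * ((Q j j * d)\<^sup>2 + 4 * (p * (1 - p) * s))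
     \<le> (\<Sum>a\<in>U. \<Sum>b\<in>U. (Q a b)\<^sup>2) + ((Q j j)\<^sup>2 + s)"
  proof (rule add_mono)
    show "EV U (\<lambda>B. (D B)\<^sup>2) \<le> (\<Sum>a\<in>U. \<Sum>b\<in>U. (Q a b)\<^sup>2)"
      using insert.IH by (simp add: D_def y_def)
    have "(1 - 2 * p)\<^sup>2 \<ge> 0" by simp
    then have pq: "0 \<le> p * (1 - p)" "p * (1 - p) \<le> 1 / 4"
      using p_pos p_less_1 by (auto simp: power2_eq_square algebra_simps)
    have d: "d\<^sup>2 \<le> 1" using p_pos p_less_1 by (simp add: d_def abs_square_le_1)
    have s0: "0 \<le> s" unfolding s_def by (intro sum_nonneg) auto
    have "4 * (p * (1 - p) * s) \<le> s" using mult_right_mono[OF pq(2) s0] by simp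
    moreover have "(Q j j * d)\<^sup>2 \<le> (Q j j)\<^sup>2"
      using d mult_left_mono[of "d\<^sup>2" 1 "(Q j j)\<^sup>2"] by (simp add: power_mult_distrib)
    ultimately have "(Q j j * d)\<^sup>2 + 4 * (p * (1 - p) * s) \<le> (Q j j)\<^sup>2 + s" by linarith
    moreover have "p * (1 - p) * ((Q j j * d)\<^sup>2 + 4 * (p * (1 - p) * s)) \<le> 1 * ((Q j j * d)\<^sup>2 + 4 * (p * (1 - p) * s))"
      using pq s0 p_pos p_less_1 by (intro mult_right_mono add_nonneg_nonneg mult_nonneg_nonneg) auto
    ultimately show "p * (1 - p) * ((Q j j * d)\<^sup>2 + 4 * (p * (1 - p) * s)) \<le> (Q j j)\<^sup>2 + s"
      unfolding mult_1_left by (rule order_trans[rotated])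
  qed
  also have "\<dots> \<le> (\<Sum>a\<in>insert j U. \<Sum>b\<in>insert j U. (Q a b)\<^sup>2)"
  proof -
    have "0 \<le> (\<Sum>a\<in>U. (Q a j)\<^sup>2)" by (intro sum_nonneg) auto
    then show ?thesis using insert(1,2) by (simp add: s_def sum.distrib)
  qed
  finally show ?case by (simp only: y_def)
qed simp

text \<open>Making the range orthogonal to the all-ones vector costs one dimension, whence
  \<open>N - 1\<close>, and removes the mean of the row. The remaining quadratic form has mean
  \<open>p * (1 - p)\<close> times the trace and variance at most the trace, so Chebyshev's
  inequality gives a probability of order 1/N.\<close>

lemma proj_small_ball:
  fixes U :: "nat set"
  assumes fin: "finite U" and Q: "is_proj U Q" and N: "1 < N" "N \<le> tr U Q"
    and z: "z \<le> p * (1 - p) * (N - 1) / 2"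
  shows "Pr U (\<lambda>B. (\<Sum>a\<in>U. (app U Q (\<lambda>b. of_bool (b \<in> B)) a)\<^sup>2) \<le> z) \<le> 4 / ((p * (1 - p))\<^sup>2 * (N - 1))"
proof -
  obtain Q1 where Q1: "is_proj U Q1" "tr U Q - 1 \<le> tr U Q1" 
    "\<And>x. range_of U Q1 x \<Longrightarrow> range_of U Q x \<and> (\<Sum>a\<in>U. (\<lambda>_. 1) a * x a) = 0"
    "\<And>a. a \<in> U \<Longrightarrow> app U Q1 (\<lambda>_. 1) a = 0"
    using proj_reduce[OF Q fin, of "\<lambda>_. 1"] by blast
  \<comment> \<open>Cutting off outside \<open>U\<close> makes the kernel symmetric for all
    arguments, as the variance bound demands.\<close>
  define Q' where "Q' = (\<lambda>a b. if a \<in> U \<and> b \<in> U then Q1 a b else 0)"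
  have sym: "Q' a b = Q' b a" for a b using projD(1)[OF Q1(1)] by (auto simp: Q'_def)
  have app': "app U Q' x a = app U Q1 x a" if "a \<in> U" for x a
    using that unfolding app_def Q'_def by (intro sum.cong) auto
  have Q': "is_proj U Q'" using Q1(1) unfolding is_proj_def Q'_def by (auto cong: sum.cong)
  define N' where "N' = tr U Q'"
  have N': "N' = tr U Q1" unfolding N'_def tr_def Q'_def by (intro sum.cong) auto
  then have N'ge: "N - 1 \<le> N'" using N Q1(2) by simp
  have pq: "0 < p * (1 - p)" using p_pos p_less_1 by simp
  define X where "X B = (\<lambda>b. of_bool (b \<in> B) :: real)" for B :: "nat set"
  define Z where "Z B = (\<Sum>a\<in>U. \<Sum>b\<in>U. Q' a b * (of_bool (a \<in> B) - p) * (of_bool (b \<in> B) - p))" for B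
  have ZX: "Z B \<le> (\<Sum>a\<in>U. (app U Q (X B) a)\<^sup>2)" for B
  proof -
    define y where "y = (\<lambda>a. X B a - p)"
    have "Z B = (\<Sum>a\<in>U. y a * app U Q' y a)"
      by (simp add: Z_def y_def X_def app_def sum_distrib_left mult_ac)
    also have "\<dots> = (\<Sum>a\<in>U. (app U Q' y a)\<^sup>2)" by (rule app_norm[OF Q', symmetric])
    also have "\<dots> = (\<Sum>a\<in>U. (app U Q1 (X B) a)\<^sup>2)"
    proof (rule sum.cong[OF refl])
      fix a assume a: "a \<in> U"
      have "app U Q1 y a = app U Q1 (X B) a - p * app U Q1 (\<lambda>_. 1) a"
        by (simp add: app_def y_def right_diff_distrib sum_subtractf sum_distrib_left mult.commute)
      then show "(app U Q' y a)\<^sup>2 = (app U Q1 (X B) a)\<^sup>2" using a by (simp add: app' Q1(4))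
    qed
    also have "\<dots> \<le> (\<Sum>a\<in>U. (app U Q (X B) a)\<^sup>2)"
    proof -
      let ?u = "app U Q (X B)" and ?w = "app U Q1 (X B)"
      have "range_of U Q ?w" using Q1(3)[OF range_of_app[OF Q1(1)]] by blast
      then have "(\<Sum>a\<in>U. ?u a * ?w a) = (\<Sum>a\<in>U. X B a * ?w a)"
        unfolding app_adjoint[OF Q] by (intro sum.cong) (auto simp: range_of_def)
      also have "\<dots> = (\<Sum>a\<in>U. (?w a)\<^sup>2)" by (rule app_norm[OF Q1(1), symmetric])
      finally have 1: "(\<Sum>a\<in>U. ?u a * ?w a) = (\<Sum>a\<in>U. (?w a)\<^sup>2)" .
      have "0 \<le> (\<Sum>a\<in>U. (?u a - ?w a)\<^sup>2)" by (intro sum_nonneg) auto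
      also have "\<dots> = (\<Sum>a\<in>U. (?u a)\<^sup>2) - 2 * (\<Sum>a\<in>U. ?u a * ?w a) + (\<Sum>a\<in>U. (?w a)\<^sup>2)"
        by (simp add: power2_diff sum.distrib sum_subtractf sum_distrib_left mult.assoc)
      finally show ?thesis using 1 by simp
    qed
    finally show ?thesis .
  qed
  have "(p * (1 - p) * N' / 2)\<^sup>2 * Pr U (\<lambda>B. (\<Sum>a\<in>U. (app U Q (X B) a)\<^sup>2) \<le> z) \<le> EV U (\<lambda>B. (Z B - p * (1 - p) * N')\<^sup>2)"
  proof (rule Pr_markov)
    fix B assume "(\<Sum>a\<in>U. (app U Q (X B) a)\<^sup>2) \<le> z"
    then have "Z B \<le> p * (1 - p) * (N - 1) / 2" using ZX[of B] z by linarith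
    also have "\<dots> \<le> p * (1 - p) * N' / 2" using pq N'ge by (intro divide_right_mono mult_left_mono) auto
    finally have le: "p * (1 - p) * N' / 2 \<le> p * (1 - p) * N' - Z B" by linarith
    have "0 \<le> p * (1 - p) * N' / 2" using pq N'ge N by simp
    then show "(p * (1 - p) * N' / 2)\<^sup>2 \<le> (Z B - p * (1 - p) * N')\<^sup>2"
      using power_mono[OF le, of 2] by (simp add: power2_commute)
  qed auto
  also have "\<dots> \<le> (\<Sum>a\<in>U. \<Sum>b\<in>U. (Q' a b)\<^sup>2)"
    using EV_quadratic_form_variance[OF fin, of Q'] sym by (simp add: Z_def N'_def tr_def)
  also have "\<dots> = N'" unfolding N'_def tr_def
    by (subst sum.swap) (simp add: proj_col(2)[OF Q'])
  finally have "(p * (1 - p) * N' / 2)\<^sup>2 * Pr U (\<lambda>B. (\<Sum>a\<in>U. (app U Q (X B) a)\<^sup>2) \<le> z) \<le> N'" .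
  then have "N' * ((p * (1 - p))\<^sup>2 * N' / 4 * Pr U (\<lambda>B. (\<Sum>a\<in>U. (app U Q (X B) a)\<^sup>2) \<le> z)) \<le> N' * 1"
    by (simp add: power2_eq_square mult_ac)
  then have "(p * (1 - p))\<^sup>2 * N' / 4 * Pr U (\<lambda>B. (\<Sum>a\<in>U. (app U Q (X B) a)\<^sup>2) \<le> z) \<le> 1"
    using N'ge N by (simp only: mult_le_cancel_left_pos)
  moreover have "0 < (p * (1 - p))\<^sup>2 * N'" using pq N'ge N by (intro mult_pos_pos) auto
  ultimately have "Pr U (\<lambda>B. (\<Sum>a\<in>U. (app U Q (X B) a)\<^sup>2) \<le> z) \<le> 4 / ((p * (1 - p))\<^sup>2 * N')"
    by (simp only: pos_le_divide_eq) (simp add: mult_ac)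
  also have "\<dots> \<le> 4 / ((p * (1 - p))\<^sup>2 * (N - 1))"
    using pq N'ge N by (intro divide_left_mono mult_left_mono mult_pos_pos) auto
  finally show ?thesis by (simp add: X_def)
qed

end

section \<open>Revealing rows one at a time\<close>

definition shifted :: "real \<Rightarrow> nat set set \<Rightarrow> nat \<Rightarrow> nat \<Rightarrow> real" where
  "shifted lam B r i = adj B r i - lam * of_bool (r = i)"

definition restr :: "nat set \<Rightarrow> nat set \<Rightarrow> (nat \<Rightarrow> nat \<Rightarrow> real) \<Rightarrow> nat \<Rightarrow> nat \<Rightarrow> real" where
  "restr R U m = (\<lambda>r i. if r \<in> R \<and> i \<in> U then m r i else 0)"

text \<open>Passing to \<open>restr\<close> makes the choice depend on the entries in \<open>R \<times> U\<close> only, hence independent of the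
  rows that are revealed later.\<close>

definition window_of :: "nat set \<Rightarrow> nat set \<Rightarrow> (nat \<Rightarrow> nat \<Rightarrow> real) \<Rightarrow> real \<Rightarrow> nat set \<times> (nat \<Rightarrow> nat \<Rightarrow> real)" where
  "window_of R U m \<theta> = (SOME Dv. window U R (restr R U m) \<theta> (fst Dv) (snd Dv))"

lemma qf_restr: "qf R U (restr R U m) x = qf R U m x"
  unfolding qf_def restr_def by (intro sum.cong arg_cong[of _ _ "\<lambda>x. x\<^sup>2"]) auto

lemma window_of:
  assumes V: "eigenvector_choice V" and "finite U" "0 \<le> \<theta>"
  shows "window U R m \<theta> (fst (window_of R U m \<theta>)) (snd (window_of R U m \<theta>))"
proof -
  have "window U R (restr R U m) \<theta> (fst (window_of R U m \<theta>)) (snd (window_of R U m \<theta>))"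
    unfolding window_of_def
    by (rule someI_ex) (use window_exists[OF assms, of R "restr R U m"] in auto)
  then show ?thesis by (simp add: window_def qf_restr)
qed

lemma window_of_cong:
  assumes "\<And>r i. r \<in> R \<Longrightarrow> i \<in> U \<Longrightarrow> m r i = m' r i"
  shows "window_of R U m \<theta> = window_of R U m' \<theta>"
proof -
  have "restr R U m = restr R U m'" using assms by (auto simp: restr_def fun_eq_iff)
  then show ?thesis by (simp add: window_of_def)
qed

text \<open>The lower bound on the window dimension is part of the event. In this way its
  conditional probability given the entries inside \<open>U\<close> is small whatever those entries
  are.\<close>

definition near_orth :: "real \<Rightarrow> real \<Rightarrow> real \<Rightarrow> real \<Rightarrow> nat set set \<Rightarrow> nat set \<Rightarrow> nat \<Rightarrow> bool" where
  "near_orth lam \<theta> N z B U a \<longleftrightarrow> (let (D, v) = window_of U U (shifted lam B) \<theta> in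
     N \<le> card D \<and> (\<Sum>i\<in>U. (app U (kernel_of D v) (adj B a) i)\<^sup>2) \<le> z)"

text \<open>For \<open>near_orth\<close>, the condition at \<open>a\<close> involves the star of
  \<open>a\<close> in \<open>I - {a}\<close>, while the rest of the chain lives inside
  \<open>I - {a}\<close>. Revealing the list from its end, every condition meets a fresh row, so the
  probabilities multiply.\<close>

fun chain :: "(nat set \<Rightarrow> nat \<Rightarrow> bool) \<Rightarrow> nat set \<Rightarrow> nat list \<Rightarrow> bool" where
  "chain P I [] = True"
| "chain P I (a # as) = (P (I - {a}) a \<and> chain P (I - {a}) as)"

lemma chain_cong:
  "set as \<subseteq> I \<Longrightarrow> distinct as \<Longrightarrow>
   (\<And>U a. U \<subseteq> I \<Longrightarrow> a \<in> I \<Longrightarrow> a \<notin> U \<Longrightarrow> P U a = P' U a) \<Longrightarrow> chain P I as = chain P' I as"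
proof (induction as arbitrary: I)
  case (Cons a as)
  have "chain P (I - {a}) as = chain P' (I - {a}) as"
    using Cons.prems by (intro Cons.IH) auto
  then show ?case using Cons.prems(3)[of "I - {a}" a] Cons.prems(1) by auto
qed simp

context bernoulli_sets begin

lemma near_orth_local:
  assumes "C \<inter> {{x, y} | x y. x \<in> insert a U \<and> y \<in> U} = {}"
  shows "near_orth lam \<theta> N z (B \<union> C) U a = near_orth lam \<theta> N z B U a"
proof -
  have adj: "adj (B \<union> C) x y = adj B x y" if "x \<in> insert a U" "y \<in> U" for x y
    using assms that unfolding adj_def by auto
  have "window_of U U (shifted lam (B \<union> C)) \<theta> = window_of U U (shifted lam B) \<theta>"
    by (rule window_of_cong) (simp add: shifted_def adj)
  moreover have "app U K (adj (B \<union> C) a) i = app U K (adj B a) i" for K i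
    by (rule app_cong) (simp add: adj)
  ultimately show ?thesis by (simp add: near_orth_def)
qed

lemma chain_prob:
  assumes V: "eigenvector_choice V" and N: "1 < N" and z: "z \<le> p * (1 - p) * (N - 1) / 2" and \<theta>: "0 \<le> \<theta>"
  defines "\<rho> \<equiv> 4 / ((p * (1 - p))\<^sup>2 * (N - 1))"
  shows "distinct as \<Longrightarrow> set as \<subseteq> I \<Longrightarrow> finite I \<Longrightarrow> finite S \<Longrightarrow> (\<Union>a\<in>set as. star a (I - {a})) \<subseteq> S \<Longrightarrow>
    Pr S (\<lambda>B. chain (near_orth lam \<theta> N z B) I as) \<le> \<rho> ^ length as"
proof (induction as arbitrary: I S)
  case Nil
  then show ?case using Pr_le_1 by simp
next
  case (Cons a as)
  define U where "U = I - {a}"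
  define T where "T = star a U"
  have aU: "a \<notin> U" "finite U" using Cons.prems by (auto simp: U_def)
  have T: "T \<subseteq> S" using Cons.prems by (auto simp: T_def U_def)
  have \<rho>: "0 \<le> \<rho>" using N p_pos p_less_1 by (simp add: \<rho>_def)
  have loc: "near_orth lam \<theta> N z (B \<union> C) W b = near_orth lam \<theta> N z B W b"
    if "W \<subseteq> U" "b \<in> U" "C \<subseteq> T" for W b B C
  proof (rule near_orth_local)
    have "a \<in> e" if "e \<in> C" for e using that \<open>C \<subseteq> T\<close> by (auto simp: T_def star_def)
    then show "C \<inter> {{x, y} |x y. x \<in> insert b W \<and> y \<in> W} = {}"
      using that(1,2) aU(1) by blast
  qed
  have "Pr S (\<lambda>B. chain (near_orth lam \<theta> N z B) I (a # as))
     = Pr S (\<lambda>B. chain (near_orth lam \<theta> N z B) U as \<and> near_orth lam \<theta> N z B U a)"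
    by (intro Pr_cong) (auto simp: U_def)
  also have "\<dots> \<le> \<rho> * Pr (S - T) (\<lambda>B. chain (near_orth lam \<theta> N z B) U as)"
  proof (rule Pr_conj_le[OF Cons.prems(4) T])
    fix B C assume BC: "B \<subseteq> S - T" "C \<subseteq> T" "chain (near_orth lam \<theta> N z (B \<union> C)) U as"
    have "chain (near_orth lam \<theta> N z (B \<union> C)) U as = chain (near_orth lam \<theta> N z B) U as"
      using Cons.prems BC loc by (intro chain_cong) (auto simp: U_def)
    then show "chain (near_orth lam \<theta> N z B) U as" using BC by simp
  next
    fix B assume B: "B \<subseteq> S - T"
    obtain D v where Dv: "window_of U U (shifted lam B) \<theta> = (D, v)" by fastforce
    have win: "window U U (shifted lam B) \<theta> D v"
      using window_of[OF V aU(2) \<theta>, of U "shifted lam B"] Dv by simp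
    then have D: "finite D" and orth: "\<And>i j. i \<in> D \<Longrightarrow> j \<in> D \<Longrightarrow> (\<Sum>a\<in>U. v i a * v j a) = of_bool (i = j)"
      by (auto simp: window_def)
    have eq: "near_orth lam \<theta> N z (B \<union> C) U a \<longleftrightarrow> N \<le> card D \<and>
      (\<Sum>i\<in>U. (app U (kernel_of D v) (\<lambda>i. of_bool ({a, i} \<in> C)) i)\<^sup>2) \<le> z" if "C \<subseteq> T" for C
    proof -
      have w: "window_of U U (shifted lam (B \<union> C)) \<theta> = window_of U U (shifted lam B) \<theta>"
        by (rule window_of_cong)
          (use that aU in \<open>auto simp: shifted_def adj_def T_def star_def doubleton_eq_iff\<close>)
      have "app U K (adj (B \<union> C) a) i = app U K (\<lambda>i. of_bool ({a, i} \<in> C)) i" for K i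
        by (rule app_cong) (use B in \<open>auto simp: adj_def T_def star_def\<close>)
      then show ?thesis by (simp add: near_orth_def w Dv)
    qed
    show "Pr T (\<lambda>C. near_orth lam \<theta> N z (B \<union> C) U a) \<le> \<rho>"
    proof (cases "N \<le> card D")
      case True
      have "Pr T (\<lambda>C. near_orth lam \<theta> N z (B \<union> C) U a)
        = Pr T (\<lambda>C. (\<Sum>i\<in>U. (app U (kernel_of D v) (\<lambda>i. of_bool ({a, i} \<in> C)) i)\<^sup>2) \<le> z)"
        using eq True by (intro Pr_cong) auto
      also have "\<dots> = Pr U (\<lambda>C. (\<Sum>i\<in>U. (app U (kernel_of D v) (\<lambda>i. of_bool (i \<in> C)) i)\<^sup>2) \<le> z)"
        unfolding Pr_def T_def
        using EV_star[OF aU(1), of "\<lambda>g. of_bool ((\<Sum>i\<in>U. (app U (kernel_of D v) (\<lambda>i. of_bool (g i)) i)\<^sup>2) \<le> z)"] by simp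
      also have "\<dots> \<le> \<rho>" unfolding \<rho>_def
        using kernel_of_proj[OF D orth] True N z by (intro proj_small_ball aU(2)) auto
      finally show ?thesis .
    next
      case False
      then have "Pr T (\<lambda>C. near_orth lam \<theta> N z (B \<union> C) U a) = Pr T (\<lambda>C. False)"
        using eq by (intro Pr_cong) auto
      then show ?thesis using \<rho> by (simp add: Pr_def EV_def)
    qed
  qed
  also have "\<dots> \<le> \<rho> * \<rho> ^ length as"
  proof (intro mult_left_mono \<rho> Cons.IH)
    show "(\<Union>b\<in>set as. star b (U - {b})) \<subseteq> S - T"
      using Cons.prems(5) Cons.prems(1,2) by (auto simp: U_def T_def star_def doubleton_eq_iff)
  qed (use Cons.prems in \<open>auto simp: U_def\<close>)
  finally show ?case by simp
qed

end

lemma sum_extend_zero: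
  fixes f :: "nat \<Rightarrow> real"
  assumes "finite I" "U \<subseteq> I" "\<And>i. i \<in> I - U \<Longrightarrow> f i = 0"
  shows "(\<Sum>i\<in>I. f i) = (\<Sum>i\<in>U. f i)"
  using assms by (intro sum.mono_neutral_right) auto

text \<open>Vanishing on \<open>Z\<close> amounts to \<open>card Z\<close> linear conditions. The
  kernel obtained has zero rows and columns on \<open>Z\<close>, so it can be restricted to
  \<open>I - Z\<close> without changing products or trace.\<close>

lemma proj_vanishing:
  assumes Q: "is_proj I Q" and fin: "finite I" and Z: "finite Z" "Z \<subseteq> I"
  obtains Q' where "is_proj (I - Z) Q'" "tr I Q - card Z \<le> tr (I - Z) Q'"
    "\<And>x. range_of (I - Z) Q' x \<Longrightarrow> range_of I Q (\<lambda>a. if a \<in> Z then 0 else x a)"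
proof -
  obtain Q' where Q': "is_proj I Q'" "tr I Q - card Z \<le> tr I Q'"
    "\<And>x. range_of I Q' x \<Longrightarrow> range_of I Q x \<and> (\<forall>z\<in>Z. (\<Sum>a\<in>I. of_bool (a = z) * x a) = 0)"
    using proj_reduce_set[OF Q fin Z(1), of "\<lambda>z a. of_bool (a = z)"] by blast
  have pick: "(\<Sum>a\<in>I. of_bool (a = z) * x a) = x z" if "z \<in> Z" for z and x :: "nat \<Rightarrow> real"
  proof -
    have "(\<Sum>a\<in>I. of_bool (a = z) * x a) = (\<Sum>a\<in>I. if a = z then x a else 0)"
      by (intro sum.cong) auto
    then show ?thesis using fin Z that by auto
  qed
  have van: "Q' z b = 0" "Q' b z = 0" if "z \<in> Z" "b \<in> I" for z b
  proof -
    show "Q' z b = 0" using Q'(3)[OF proj_col(1)[OF Q'(1) that(2)]] pick[OF that(1), of "\<lambda>a. Q' a b"] that(1) by simp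
    then show "Q' b z = 0" using projD(1)[OF Q'(1), of b z] that Z(2) by auto
  qed
  have ext: "(\<Sum>c\<in>I. f c) = (\<Sum>c\<in>I - Z. f c)" if "\<And>c. c \<in> Z \<Longrightarrow> f c = 0" for f :: "nat \<Rightarrow> real"
    using fin that by (intro sum_extend_zero) auto
  show ?thesis
  proof (rule that[of Q'])
    show "is_proj (I - Z) Q'" unfolding is_proj_def
    proof (intro conjI ballI)
      fix a b assume "a \<in> I - Z" "b \<in> I - Z"
      then have ab: "a \<in> I" "b \<in> I" by auto
      show "Q' a b = Q' b a" using projD(1)[OF Q'(1) ab] .
      have "(\<Sum>c\<in>I. Q' a c * Q' c b) = (\<Sum>c\<in>I - Z. Q' a c * Q' c b)"
        using van ab by (intro ext) auto
      then show "(\<Sum>c\<in>I - Z. Q' a c * Q' c b) = Q' a b" using projD(2)[OF Q'(1) ab] by simp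
    qed
    have "tr I Q' = tr (I - Z) Q'" unfolding tr_def using van Z(2) by (intro ext) auto
    then show "tr I Q - card Z \<le> tr (I - Z) Q'" using Q'(2) by simp
    show "range_of I Q (\<lambda>a. if a \<in> Z then 0 else x a)" if x: "range_of (I - Z) Q' x" for x
    proof -
      let ?x = "\<lambda>a. if a \<in> Z then 0 else x a"
      have "app I Q' ?x a = ?x a" if a: "a \<in> I" for a
      proof (cases "a \<in> Z")
        case True
        then show ?thesis unfolding app_def using van a by (auto intro!: sum.neutral)
      next
        case False
        have "app I Q' ?x a = app (I - Z) Q' ?x a" unfolding app_def by (intro ext) auto
        also have "\<dots> = app (I - Z) Q' x a" by (rule app_cong) auto
        finally show ?thesis using x a False by (auto simp: range_of_def)
      qed
      then have "range_of I Q' ?x" by (simp add: range_of_def)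
      then show ?thesis using Q'(3) by blast
    qed
  qed
qed

lemma shifted_sym: "shifted lam B r i = shifted lam B i r"
  by (auto simp: shifted_def adj_commute)

text \<open>A vector \<open>w a\<close> of the dual family has entry \<open>1\<close> at \<open>a\<close> and vanishes on the other indices of \<open>T\<close>, so
  smallness of \<open>(A - \<lambda>) w a\<close> says that row \<open>a\<close> of \<open>A\<close> is close to the image under \<open>A - \<lambda>\<close> of a vector
  supported off \<open>T\<close>, and therefore nearly orthogonal to the window of the remaining indices.\<close>

lemma chain_of_dual:
  assumes V: "eigenvector_choice V" and fin: "finite I" and Q: "is_proj I Q" and h: "0 < h"
    and small: "\<And>x. range_of I Q x \<Longrightarrow> qf I I (shifted lam B) x \<le> h * (\<Sum>a\<in>I. (x a)\<^sup>2)"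
    and T: "T \<subseteq> I"
    and w: "\<And>a. a \<in> T \<Longrightarrow> range_of I Q (w a)" "\<And>a b. a \<in> T \<Longrightarrow> b \<in> T \<Longrightarrow> w a b = of_bool (a = b)"
      "\<And>a. a \<in> T \<Longrightarrow> (\<Sum>b\<in>I. (w a b)\<^sup>2) \<le> c"
    and N: "2 * N \<le> tr I Q - card T" and adj0: "\<And>a. a \<in> I \<Longrightarrow> {a} \<notin> B"
  shows "distinct as \<Longrightarrow> P \<union> set as \<subseteq> T \<Longrightarrow> P \<inter> set as = {} \<Longrightarrow>
    chain (near_orth lam (2 * h) N (6 * h * c) B) (I - P) as"
proof (induction as arbitrary: P)
  case (Cons a as)
  define Z where "Z = insert a P"
  define U where "U = I - Z"
  define m where "m = shifted lam B"
  have IP: "I - P - {a} = U" by (auto simp: U_def Z_def)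
  have aT: "a \<in> T" "a \<in> I" "Z \<subseteq> T" "Z \<subseteq> I" "a \<notin> U" using Cons.prems T by (auto simp: Z_def U_def)
  have finT: "finite T" using T fin finite_subset by auto
  have finU: "finite U" and finZ: "finite Z" using fin aT finT finite_subset by (auto simp: U_def)
  have UI: "U \<subseteq> I" by (auto simp: U_def)
  have "chain (near_orth lam (2 * h) N (6 * h * c) B) (I - Z) as"
    using Cons.prems by (intro Cons.IH) (auto simp: Z_def)
  moreover have "near_orth lam (2 * h) N (6 * h * c) B U a"
  proof -
    obtain D v where Dv: "window_of U U m (2 * h) = (D, v)" by fastforce
    have win: "window U U m (2 * h) D v"
      using window_of[OF V finU, of "2 * h" U m] h Dv by simp
    then have D: "finite D" and orth: "\<And>i j. i \<in> D \<Longrightarrow> j \<in> D \<Longrightarrow> (\<Sum>a\<in>U. v i a * v j a) = of_bool (i = j)"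
      by (auto simp: window_def)
    note K = kernel_of_proj[OF D orth]
    \<comment> \<open>Vectors of the range of \<open>Q\<close> that vanish on \<open>Z\<close> form
      a space of dimension at least \<open>2 * N\<close> on which \<open>m\<close> is small. The
      factor 2 is consumed by \<open>window_dim_ge\<close>.\<close>
    have "N \<le> card D"
    proof -
      obtain Q' where Q': "is_proj U Q'" "tr I Q - card Z \<le> tr U Q'"
        "\<And>x. range_of U Q' x \<Longrightarrow> range_of I Q (\<lambda>a. if a \<in> Z then 0 else x a)"
        using proj_vanishing[OF Q fin finZ aT(4)] unfolding U_def by blast
      have "tr U Q' \<le> 2 * card D"
      proof (rule window_dim_ge[OF win h finU Q'(1)])
        fix x assume "range_of U Q' x"
        then have r: "range_of I Q (\<lambda>a. if a \<in> Z then 0 else x a)" (is "range_of I Q ?x") by (rule Q'(3))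
        have "qf U U m x \<le> qf I U m x"
          unfolding qf_def using fin UI by (intro sum_mono2) auto
        also have "\<dots> = qf I I m ?x"
        proof -
          have "(\<Sum>a\<in>I. m r a * ?x a) = (\<Sum>a\<in>U. m r a * x a)" for r
          proof -
            have "(\<Sum>a\<in>I. m r a * ?x a) = (\<Sum>a\<in>U. m r a * ?x a)"
              using fin UI by (intro sum_extend_zero) (auto simp: U_def)
            also have "\<dots> = (\<Sum>a\<in>U. m r a * x a)" by (intro sum.cong) (auto simp: U_def)
            finally show ?thesis .
          qed
          then show ?thesis by (simp add: qf_def)
        qed
        also have "\<dots> \<le> h * (\<Sum>a\<in>I. (?x a)\<^sup>2)" using small[OF r] by (simp add: m_def)
        also have "(\<Sum>a\<in>I. (?x a)\<^sup>2) = (\<Sum>a\<in>U. (?x a)\<^sup>2)"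
          using fin UI by (intro sum_extend_zero) (auto simp: U_def)
        also have "\<dots> = (\<Sum>a\<in>U. (x a)\<^sup>2)" by (intro sum.cong) (auto simp: U_def)
        finally show "qf U U m x \<le> h * (\<Sum>a\<in>U. (x a)\<^sup>2)" .
      qed
      moreover have "card Z \<le> card T" using aT(3) finT by (rule card_mono[rotated])
      ultimately show ?thesis using N Q'(2) by linarith
    qed
    moreover have "(\<Sum>i\<in>U. (app U (kernel_of D v) (adj B a) i)\<^sup>2) \<le> 6 * h * c"
    proof -
      define X where "X = adj B a"
      define y where "y = w a"
      define k where "k i = (\<Sum>a\<in>U. X a * v i a)" for i
      define u where "u = comb D v k"
      define n2 where "n2 = (\<Sum>i\<in>U. (u i)\<^sup>2)"
      have appu: "app U (kernel_of D v) X i = u i" for i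
        by (simp add: K(3) u_def k_def[abs_def])
      have n2: "n2 = (\<Sum>i\<in>U. X i * u i)"
        unfolding n2_def using app_norm[OF K(1), of X] by (simp add: appu)
      have n2k: "n2 = (\<Sum>i\<in>D. (k i)\<^sup>2)"
        unfolding n2 u_def comb_def
        by (simp add: power2_eq_square k_def sum_distrib_left sum_distrib_right sum.swap[of _ _ D] mult_ac)
      have Mu: "qf U U m u \<le> 2 * h * n2"
        using win unfolding n2k u_def window_def by blast
      have My: "qf I I m y \<le> h * (\<Sum>a\<in>I. (y a)\<^sup>2)"
        using small[OF w(1)[OF aT(1)]] by (simp add: m_def y_def)
      have yc: "(\<Sum>b\<in>I. (y b)\<^sup>2) \<le> c" using w(3)[OF aT(1)] by (simp add: y_def)
      have c0: "0 \<le> c" using yc sum_nonneg[of I "\<lambda>b. (y b)\<^sup>2"] by simp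
      define S1 where "S1 = (\<Sum>r\<in>U. (\<Sum>i\<in>I. m r i * y i) * u r)"
      define S2 where "S2 = (\<Sum>r\<in>U. y r * (\<Sum>i\<in>U. m r i * u i))"
      have yZ: "y r = of_bool (a = r)" if "r \<in> Z" for r
        using w(2)[OF aT(1)] that aT(3) by (auto simp: y_def)
      \<comment> \<open>By symmetry of \<open>m\<close>, pairing its image of \<open>y\<close> with
        \<open>u\<close> gives the image of \<open>u\<close> paired with \<open>y\<close>. On
        \<open>Z\<close> the vector \<open>y\<close> lives only at \<open>a\<close>, with value 1,
        and this entry contributes the product of row \<open>a\<close> with \<open>u\<close>, which
        is \<open>n2\<close>.\<close>
      have key: "S1 = n2 + S2"
      proof -
        have "S1 = (\<Sum>i\<in>I. y i * (\<Sum>r\<in>U. m i r * u r))"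
          unfolding S1_def m_def
          by (simp add: sum_distrib_left sum_distrib_right sum.swap[of _ U] shifted_sym[of lam B _ _] mult_ac)
        also have "\<dots> = (\<Sum>i\<in>insert a U. y i * (\<Sum>r\<in>U. m i r * u r))"
          using fin aT UI yZ by (intro sum_extend_zero) (auto simp: U_def)
        also have "\<dots> = y a * (\<Sum>r\<in>U. m a r * u r) + S2"
          using finU aT(5) by (simp add: S2_def)
        also have "(\<Sum>r\<in>U. m a r * u r) = n2"
          unfolding n2 X_def m_def shifted_def using aT(5) by (intro sum.cong) auto
        also have "y a = 1" using yZ[of a] by (simp add: Z_def)
        finally show ?thesis by simp
      qed
      have S1: "S1\<^sup>2 \<le> h * c * n2"
      proof -
        have "S1\<^sup>2 \<le> (\<Sum>r\<in>U. (\<Sum>i\<in>I. m r i * y i)\<^sup>2) * n2"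
          unfolding S1_def n2_def by (rule Cauchy_Schwarz_ineq_sum)
        also have "(\<Sum>r\<in>U. (\<Sum>i\<in>I. m r i * y i)\<^sup>2) \<le> qf I I m y"
          unfolding qf_def using fin UI by (intro sum_mono2) auto
        also have "\<dots> \<le> h * c" using My mult_left_mono[OF yc, of h] h by linarith
        finally show ?thesis by (simp add: mult_right_mono n2_def sum_nonneg)
      qed
      have S2: "S2\<^sup>2 \<le> 2 * h * c * n2"
      proof -
        have "S2\<^sup>2 \<le> (\<Sum>r\<in>U. (y r)\<^sup>2) * qf U U m u"
          unfolding S2_def qf_def by (rule Cauchy_Schwarz_ineq_sum)
        also have "\<dots> \<le> c * (2 * h * n2)"
        proof (rule mult_mono[OF _ Mu c0])
          have "(\<Sum>r\<in>U. (y r)\<^sup>2) \<le> (\<Sum>r\<in>I. (y r)\<^sup>2)" using fin UI by (intro sum_mono2) auto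
          then show "(\<Sum>r\<in>U. (y r)\<^sup>2) \<le> c" using yc by simp
          show "0 \<le> qf U U m u" unfolding qf_def by (intro sum_nonneg) auto
        qed
        finally show ?thesis by (simp add: mult_ac)
      qed
      \<comment> \<open>Since \<open>n2 = S1 - S2\<close>, its square is at most twice the sum of
        the two squares; the bounds \<open>h * c * n2\<close> and \<open>2 * h * c * n2\<close> add
        up to the constant 6.\<close>
      have "0 \<le> (S1 + S2)\<^sup>2" by simp
      then have "n2\<^sup>2 \<le> 2 * S1\<^sup>2 + 2 * S2\<^sup>2"
        using key by (simp add: power2_eq_square algebra_simps)
      also have "\<dots> \<le> 6 * h * c * n2" using S1 S2 by linarith
      finally have le: "n2 * n2 \<le> 6 * h * c * n2" by (simp add: power2_eq_square)
      have n20: "0 \<le> n2" unfolding n2_def by (intro sum_nonneg) auto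
      have "n2 \<le> 6 * h * c"
      proof (cases "n2 = 0")
        case True
        then show ?thesis using h c0 by simp
      next
        case False
        then show ?thesis using le n20 by simp
      qed
      then show ?thesis using appu by (simp add: n2_def X_def)
    qed
    ultimately show ?thesis by (simp add: near_orth_def m_def[symmetric] Dv)
  qed
  ultimately show ?case using IP by (simp add: U_def)
qed simp

context bernoulli_sets begin

text \<open>By Markov's inequality at least half of the \<open>k\<close> dual vectors have squared
  norm at most \<open>2 * card I / k\<close>. They yield a chain of length at least
  \<open>k / 2\<close>, and the unknown index set costs the factor 2 to the power
  \<open>card I\<close>.\<close>

lemma rich_window_improbable:
  fixes h N \<tau> :: real
  assumes V: "eigenvector_choice V" and fin: "finite I" and finS: "finite S"
    and S: "(\<Union>a\<in>I. star a (I - {a})) \<subseteq> S" "\<And>a. a \<in> I \<Longrightarrow> {a} \<notin> S"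
    and h: "0 < h" and k: "0 < k" "4 * real k \<le> \<tau>" and N: "4 * N \<le> \<tau>" "1 < N"
    and \<rho>: "\<rho> = 4 / ((p * (1 - p))\<^sup>2 * (N - 1))" "\<rho> \<le> 1"
    and z: "12 * h * card I / k \<le> p * (1 - p) * (N - 1) / 2"
  shows "Pr S (\<lambda>B. \<exists>Q. is_proj I Q \<and> \<tau> \<le> tr I Q \<and>
      (\<forall>x. range_of I Q x \<longrightarrow> qf I I (shifted lam B) x \<le> h * (\<Sum>a\<in>I. (x a)\<^sup>2)))
    \<le> 2 ^ card I * \<rho> powr (k / 2)"
proof -
  define c where "c = 2 * card I / k"
  let ?X = "{T'. T' \<subseteq> I \<and> k / 2 \<le> card T'}"
  have "Pr S (\<lambda>B. \<exists>Q. is_proj I Q \<and> \<tau> \<le> tr I Q \<and>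
      (\<forall>x. range_of I Q x \<longrightarrow> qf I I (shifted lam B) x \<le> h * (\<Sum>a\<in>I. (x a)\<^sup>2)))
    \<le> Pr S (\<lambda>B. \<exists>T'\<in>?X. chain (near_orth lam (2 * h) N (6 * h * c) B) I (sorted_list_of_set T'))"
  proof (rule Pr_mono, elim exE conjE)
    fix B Q assume B: "B \<subseteq> S" and Q: "is_proj I Q" "\<tau> \<le> tr I Q"
      and small: "\<forall>x. range_of I Q x \<longrightarrow> qf I I (shifted lam B) x \<le> h * (\<Sum>a\<in>I. (x a)\<^sup>2)"
    have k2: "2 * real k \<le> tr I Q" using k Q(2) by simp
    obtain T w where T: "T \<subseteq> I" "card T = k" and w: "\<And>a. a \<in> T \<Longrightarrow> range_of I Q (w a)"
      "\<And>a b. a \<in> T \<Longrightarrow> b \<in> T \<Longrightarrow> w a b = of_bool (a = b)"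
      and tot: "(\<Sum>a\<in>T. \<Sum>b\<in>I. (w a b)\<^sup>2) \<le> card I"
      using dual_family[OF Q(1) fin k2] by blast
    have finT: "finite T" using T fin finite_subset by auto
    define T' where "T' = {a\<in>T. (\<Sum>b\<in>I. (w a b)\<^sup>2) \<le> c}"
    have T': "T' \<subseteq> T" "finite T'" using finT by (auto simp: T'_def)
    have Ipos: "0 < card I" using T k fin by (metis card_mono finT le_zero_eq not_gr_zero)
    have "real (card (T - T')) * c \<le> (\<Sum>a\<in>T - T'. \<Sum>b\<in>I. (w a b)\<^sup>2)"
      by (rule sum_bounded_below) (auto simp: T'_def)
    also have "\<dots> \<le> (\<Sum>a\<in>T. \<Sum>b\<in>I. (w a b)\<^sup>2)"
      using finT by (intro sum_mono2 sum_nonneg) auto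
    also have "\<dots> \<le> card I" by (rule tot)
    finally have "real (card (T - T')) \<le> k / 2" using k Ipos by (simp add: c_def field_simps)
    moreover have "real (card (T - T')) = k - real (card T')"
      using T' T(2) finT card_mono[OF finT T'(1)] by (simp add: card_Diff_subset of_nat_diff)
    ultimately have "T' \<in> ?X" using T' T by auto
    moreover have "chain (near_orth lam (2 * h) N (6 * h * c) B) (I - {}) (sorted_list_of_set T')"
    proof (rule chain_of_dual[OF V fin Q(1) h])
      show "T' \<subseteq> I" using T T' by auto
      have "card T' \<le> k" using T T' finT card_mono by auto
      then show "2 * N \<le> tr I Q - card T'" using N Q(2) k by linarith
      show "range_of I Q (w a)" if "a \<in> T'" for a using w T' that by auto
      show "w a b = of_bool (a = b)" if "a \<in> T'" "b \<in> T'" for a b using w(2)[of a b] T'(1) that by blast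
      show "(\<Sum>b\<in>I. (w a b)\<^sup>2) \<le> c" if "a \<in> T'" for a using that by (simp add: T'_def)
      show "{a} \<notin> B" if "a \<in> I" for a using S(2) B that by auto
    qed (use small T' in auto)
    ultimately show "\<exists>T'\<in>?X. chain (near_orth lam (2 * h) N (6 * h * c) B) I (sorted_list_of_set T')"
      by auto
  qed
  also have "\<dots> \<le> card ?X * \<rho> powr (k / 2)"
  proof (rule Pr_Bex_le_card)
    show "finite ?X" using fin by auto
    fix T' assume T': "T' \<in> ?X"
    then have finT': "finite T'" using fin finite_subset by auto
    have z': "6 * h * c \<le> p * (1 - p) * (N - 1) / 2" using z by (simp add: c_def)
    have "Pr S (\<lambda>B. chain (near_orth lam (2 * h) N (6 * h * c) B) I (sorted_list_of_set T'))
       \<le> \<rho> ^ length (sorted_list_of_set T')"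
      unfolding \<rho>(1) using T' finT' S(1) h fin finS
      by (intro chain_prob[OF V N(2) z']) auto
    also have "\<dots> = \<rho> powr real (card T')"
      using N p_pos p_less_1 by (subst powr_realpow) (auto simp: \<rho>(1))
    also have "\<dots> \<le> \<rho> powr (k / 2)"
      using T' \<rho>(2) N p_pos p_less_1 by (intro powr_mono') (auto simp: \<rho>(1))
    finally show "Pr S (\<lambda>B. chain (near_orth lam (2 * h) N (6 * h * c) B) I (sorted_list_of_set T')) \<le> \<rho> powr (k / 2)" .
  qed
  also have "\<dots> \<le> 2 ^ card I * \<rho> powr (k / 2)"
  proof (rule mult_right_mono)
    have "card ?X \<le> card (Pow I)" using fin by (intro card_mono) auto
    then have "real (card ?X) \<le> real (2 ^ card I)" using fin by (simp only: card_Pow of_nat_le_iff)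
    then show "real (card ?X) \<le> 2 ^ card I" by simp
  qed simp
  finally show ?thesis .
qed

end

section \<open>Nets and the operator norm\<close>

definition grid1 :: "nat \<Rightarrow> nat \<Rightarrow> real set" where
  "grid1 D M = (\<lambda>k. of_int k / real D) ` {- int (M * D)..int (M * D)}"

definition grid :: "nat set \<Rightarrow> nat \<Rightarrow> nat \<Rightarrow> (nat \<Rightarrow> real) set" where
  "grid U D M = PiE_dflt U 0 (\<lambda>_. grid1 D M)"

lemma finite_grid1 [simp]: "finite (grid1 D M)" by (simp add: grid1_def)

lemma card_grid1: "card (grid1 D M) \<le> 2 * M * D + 1"
proof -
  have "card (grid1 D M) \<le> card {- int (M * D)..int (M * D)}" unfolding grid1_def by (rule card_image_le) simp
  also have "\<dots> = 2 * (M * D) + 1" unfolding card_atLeastAtMost_int by linarith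
  finally show ?thesis by (simp only: mult.assoc)
qed

lemma finite_grid: "finite U \<Longrightarrow> finite (grid U D M)"
  unfolding grid_def by (intro finite_PiE_dflt) auto

lemma card_grid: "finite U \<Longrightarrow> card (grid U D M) \<le> (2 * M * D + 1) ^ card U"
  unfolding grid_def using card_grid1[of D M]
  by (subst card_PiE_dflt) (auto simp: power_mono)

text \<open>Rounding goes towards zero, so net points inherit the size bounds of what they
  approximate.\<close>

lemma grid1_round:
  assumes D: "0 < D" and t: "\<bar>t\<bar> \<le> real M"
  obtains g where "g \<in> grid1 D M" "\<bar>t - g\<bar> \<le> 1 / D" "\<bar>g\<bar> \<le> \<bar>t\<bar>"
proof -
  define f where "f = \<lfloor>\<bar>t\<bar> * D\<rfloor>"
  have f0: "0 \<le> f" by (simp add: f_def)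
  have f1: "of_int f \<le> \<bar>t\<bar> * D" "\<bar>t\<bar> * D < of_int f + 1" unfolding f_def by linarith+
  have "of_int f \<le> real M * real D" using f1(1) t D by (meson mult_right_mono of_nat_0_le_iff order_trans)
  then have "of_int f \<le> (of_int (int (M * D)) :: real)" by simp
  then have fM: "f \<le> int (M * D)" by (simp only: of_int_le_iff)
  have g1: "of_int f / D \<le> \<bar>t\<bar>" "\<bar>t\<bar> \<le> of_int f / D + 1 / D" using f1 D by (auto simp: field_simps)
  show ?thesis
  proof (cases "0 \<le> t")
    case True
    have "of_int f / real D \<in> grid1 D M" unfolding grid1_def using f0 fM by (intro imageI) auto
    then show ?thesis using True g1 f0 by (intro that[of "of_int f / D"]) auto
  next
    case False
    have "of_int (- f) / real D \<in> grid1 D M" unfolding grid1_def using f0 fM by (intro imageI) auto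
    then show ?thesis using False g1 f0 by (intro that[of "of_int (- f) / D"]) auto
  qed
qed

lemma grid_round:
  assumes D: "0 < D" and x: "\<And>i. i \<in> U \<Longrightarrow> \<bar>x i\<bar> \<le> real M"
  obtains g where "g \<in> grid U D M" "\<And>i. i \<in> U \<Longrightarrow> \<bar>x i - g i\<bar> \<le> 1 / D" "\<And>i. i \<in> U \<Longrightarrow> \<bar>g i\<bar> \<le> \<bar>x i\<bar>"
proof -
  have "\<forall>i\<in>U. \<exists>g. g \<in> grid1 D M \<and> \<bar>x i - g\<bar> \<le> 1 / D \<and> \<bar>g\<bar> \<le> \<bar>x i\<bar>"
    using grid1_round[OF D x] by metis
  then obtain f where f: "\<forall>i\<in>U. f i \<in> grid1 D M \<and> \<bar>x i - f i\<bar> \<le> 1 / D \<and> \<bar>f i\<bar> \<le> \<bar>x i\<bar>" by metis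
  show ?thesis
    by (rule that[of "\<lambda>i. if i \<in> U then f i else 0"]) (use f in \<open>auto simp: grid_def PiE_dflt_def\<close>)
qed

section \<open>Operator norm of the centred adjacency matrix\<close>

lemma bernoulli_mgf:
  fixes u p :: real
  assumes "0 < p" "p < 1"
  shows "p * exp (u * (1 - p)) + (1 - p) * exp (- (u * p)) \<le> exp (u\<^sup>2)"
proof -
  have pos: "p * exp (u * (1 - p)) + (1 - p) * exp (- (u * p)) \<le> exp (u\<^sup>2)"
    if u: "0 \<le> u" and p: "0 < p" "p < 1" for u p :: real
  proof -
    have "0 < 1 + p * (exp u - 1)" using u p by (intro add_pos_nonneg mult_nonneg_nonneg) auto
    then have "exp (- u * p) * (1 + p * (exp u - 1)) = exp (- u * p + ln (1 + p * (exp u - 1)))"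
      by (simp add: exp_add exp_diff exp_minus field_simps)
    also have "\<dots> \<le> exp (u\<^sup>2 / 8)"
      using Hoeffdings_lemma_aux[of u p] u p by simp
    also have "\<dots> \<le> exp (u\<^sup>2)" by simp
    finally have "exp (- u * p) * (1 + p * (exp u - 1)) \<le> exp (u\<^sup>2)" .
    moreover have "exp (u * (1 - p)) = exp (- u * p) * exp u"
      by (simp add: exp_add[symmetric] algebra_simps)
    ultimately show ?thesis by (simp add: algebra_simps)
  qed
  show ?thesis
  proof (cases "0 \<le> u")
    \<comment> \<open>A negative \<open>u\<close> is the case of \<open>- u\<close> with
      \<open>p\<close> and \<open>1 - p\<close> exchanged.\<close>
    case False
    then show ?thesis using pos[of "- u" "1 - p"] assms by (simp add: add.commute)
  qed (use pos assms in auto)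
qed

context bernoulli_sets begin

lemma EV_exp_le:
  assumes "finite S"
  shows "EV S (\<lambda>B. exp (\<Sum>e\<in>S. c e * (of_bool (e \<in> B) - p))) \<le> exp (\<Sum>e\<in>S. (c e)\<^sup>2)"
  using assms
proof (induction S rule: finite_induct)
  case (insert e S)
  let ?Y = "\<lambda>B. \<Sum>x\<in>S. c x * (of_bool (x \<in> B) - p)"
  have ins: "?Y (insert e B) = ?Y B" for B using insert(2) by (intro sum.cong) auto
  have "EV (insert e S) (\<lambda>B. exp (\<Sum>x\<in>insert e S. c x * (of_bool (x \<in> B) - p)))
     = p * EV S (\<lambda>B. exp (c e * (1 - p)) * exp (?Y B)) + (1 - p) * EV S (\<lambda>B. exp (- (c e * p)) * exp (?Y B))"
    unfolding EV_insert[OF insert(1,2)] sum.insert[OF insert(1,2)] ins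
    using insert(2) by (intro arg_cong2[of _ _ _ _ "(+)"] arg_cong2[of _ _ _ _ "(*)"] refl EV_cong) (auto simp: exp_add[symmetric])
  also have "\<dots> = (p * exp (c e * (1 - p)) + (1 - p) * exp (- (c e * p))) * EV S (\<lambda>B. exp (?Y B))"
    unfolding EV_cmult by (simp add: algebra_simps)
  also have "\<dots> \<le> exp ((c e)\<^sup>2) * exp (\<Sum>x\<in>S. (c x)\<^sup>2)"
    using bernoulli_mgf[OF p_pos p_less_1, of "c e"] insert.IH by (intro mult_mono EV_nonneg) auto
  finally show ?case using insert(1,2) by (simp add: exp_add)
qed simp

lemma hoeffding_tail:
  assumes "finite S" "(\<Sum>e\<in>S. (c e)\<^sup>2) \<le> 2" "0 \<le> L"
  shows "Pr S (\<lambda>B. L \<le> (\<Sum>e\<in>S. c e * (of_bool (e \<in> B) - p))) \<le> exp (- (L\<^sup>2 / 8))"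
proof -
  let ?Y = "\<lambda>B. \<Sum>e\<in>S. c e * (of_bool (e \<in> B) - p)"
  \<comment> \<open>The multiplier \<open>L / 4\<close> minimises the exponent 2 s^2 - s L over s,
    with value - L^2/8.\<close>
  let ?Y' = "\<lambda>B. \<Sum>e\<in>S. (L / 4 * c e) * (of_bool (e \<in> B) - p)"
  have Y': "?Y' B = L / 4 * ?Y B" for B by (simp add: sum_distrib_left mult.assoc)
  have "exp (L\<^sup>2 / 4) * Pr S (\<lambda>B. L \<le> ?Y B) \<le> EV S (\<lambda>B. exp (?Y' B))"
  proof (rule Pr_markov)
    fix B assume "L \<le> ?Y B"
    then have "L / 4 * L \<le> L / 4 * ?Y B" using assms(3) by (intro mult_left_mono) auto
    then show "exp (L\<^sup>2 / 4) \<le> exp (?Y' B)" unfolding Y' by (simp add: power2_eq_square)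
  qed simp
  also have "\<dots> \<le> exp (\<Sum>e\<in>S. (L / 4 * c e)\<^sup>2)" by (rule EV_exp_le[OF assms(1)])
  also have "(\<Sum>e\<in>S. (L / 4 * c e)\<^sup>2) = (L / 4)\<^sup>2 * (\<Sum>e\<in>S. (c e)\<^sup>2)"
    unfolding sum_distrib_left by (intro sum.cong refl) (simp add: power_mult_distrib power_divide)
  also have "exp ((L / 4)\<^sup>2 * (\<Sum>e\<in>S. (c e)\<^sup>2)) \<le> exp ((L / 4)\<^sup>2 * 2)"
    using assms(2) by (simp add: mult_left_mono)
  also have "\<dots> = exp (L\<^sup>2 / 4) * exp (- (L\<^sup>2 / 8))" by (simp add: exp_add[symmetric] power2_eq_square)
  finally show ?thesis by simp
qed

definition centered :: "nat set set \<Rightarrow> nat \<Rightarrow> nat \<Rightarrow> real" where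
  "centered B r i = adj B r i - p * of_bool (r \<noteq> i)"

text \<open>States that the operator norm of the adjacency matrix minus its expectation is at most
  \<Lambda>.\<close>

definition norm_ok :: "nat \<Rightarrow> real \<Rightarrow> nat set set \<Rightarrow> bool" where
  "norm_ok n \<Lambda> B \<longleftrightarrow> (\<forall>x. (\<Sum>r<n. (\<Sum>i<n. centered B r i * x i)\<^sup>2) \<le> \<Lambda>\<^sup>2 * (\<Sum>i<n. (x i)\<^sup>2))"

text \<open>Each edge occurs in two ordered pairs and thus has the sum of two products as its
  coefficient; this is the reason for the bound 2 on the squared coefficients in
  \<open>hoeffding_tail\<close>.\<close>

lemma bilinear_tail:
  assumes L: "0 \<le> L" and x: "(\<Sum>i<n. (x i)\<^sup>2) \<le> 1" and y: "(\<Sum>i<n. (y i)\<^sup>2) \<le> 1"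
  shows "Pr (all_edges n) (\<lambda>B. L \<le> (\<Sum>r<n. \<Sum>i<n. y r * centered B r i * x i)) \<le> exp (- (L\<^sup>2 / 8))"
proof -
  define P where "P = {(r, i). r < n \<and> i < n \<and> r \<noteq> i}"
  define e where "e = (\<lambda>(r::nat, i). {r, i})"
  define f where "f = (\<lambda>(r, i). y r * x i)"
  define c where "c E = sum f {q\<in>P. e q = E}" for E
  have finP: "finite P" unfolding P_def by (rule finite_subset[of _ "{..<n} \<times> {..<n}"]) auto
  have eP: "e ` P \<subseteq> all_edges n" by (auto simp: P_def e_def all_edges_def)
  note fe = finite_all_edges[of n]
  have pairs: "(\<Sum>r<n. \<Sum>i<n. h r i) = (\<Sum>q\<in>P. case q of (r, i) \<Rightarrow> h r i)" if "\<And>r. r < n \<Longrightarrow> h r r = 0" for h :: "nat \<Rightarrow> nat \<Rightarrow> real"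
    unfolding sum.cartesian_product P_def
    by (rule sum.mono_neutral_right) (use that in auto)
  have bil: "(\<Sum>r<n. \<Sum>i<n. y r * centered B r i * x i) = (\<Sum>E\<in>all_edges n. c E * (of_bool (E \<in> B) - p))"
    if B: "B \<subseteq> all_edges n" for B
  proof -
    have "{r} \<notin> B" for r using B by (auto simp: all_edges_def)
    then have "(\<Sum>r<n. \<Sum>i<n. y r * centered B r i * x i) = (\<Sum>q\<in>P. case q of (r, i) \<Rightarrow> y r * centered B r i * x i)"
      by (intro pairs) (simp add: centered_def adj_def)
    also have "\<dots> = (\<Sum>q\<in>P. f q * (of_bool (e q \<in> B) - p))"
      by (intro sum.cong refl) (auto simp: P_def f_def e_def centered_def adj_def)
    also have "\<dots> = (\<Sum>E\<in>all_edges n. \<Sum>q\<in>{q\<in>P. e q = E}. f q * (of_bool (e q \<in> B) - p))"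
      by (rule sum.group[OF finP fe eP, symmetric])
    also have "\<dots> = (\<Sum>E\<in>all_edges n. c E * (of_bool (E \<in> B) - p))"
      unfolding c_def sum_distrib_right by (intro sum.cong refl) auto
    finally show ?thesis .
  qed
  have "(\<Sum>E\<in>all_edges n. (c E)\<^sup>2) \<le> (\<Sum>E\<in>all_edges n. 2 * (\<Sum>q\<in>{q\<in>P. e q = E}. (f q)\<^sup>2))"
  proof (rule sum_mono)
    fix E assume "E \<in> all_edges n"
    then obtain a b where E: "E = {a, b}" by (auto simp: all_edges_def card_2_iff)
    have sub: "{q\<in>P. e q = E} \<subseteq> {(a, b), (b, a)}"
    proof
      fix q assume "q \<in> {q\<in>P. e q = E}"
      then have "{fst q, snd q} = {a, b}" unfolding E by (simp add: e_def case_prod_unfold)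
      then show "q \<in> {(a, b), (b, a)}" unfolding doubleton_eq_iff by (cases q) simp
    qed
    have "card {q\<in>P. e q = E} \<le> card {(a, b), (b, a)}" by (intro card_mono sub) auto
    also have "\<dots> \<le> 2" using card_length[of "[(a, b), (b, a)]"] by simp
    finally have card: "real (card {q\<in>P. e q = E}) \<le> 2" by simp
    have "(c E)\<^sup>2 \<le> (\<Sum>q\<in>{q\<in>P. e q = E}. 1\<^sup>2) * (\<Sum>q\<in>{q\<in>P. e q = E}. (f q)\<^sup>2)"
      using Cauchy_Schwarz_ineq_sum[of "\<lambda>_. 1" f "{q\<in>P. e q = E}"] by (simp add: c_def)
    also have "\<dots> \<le> 2 * (\<Sum>q\<in>{q\<in>P. e q = E}. (f q)\<^sup>2)"
      using card by (intro mult_right_mono sum_nonneg) auto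
    finally show "(c E)\<^sup>2 \<le> 2 * (\<Sum>q\<in>{q\<in>P. e q = E}. (f q)\<^sup>2)" .
  qed
  also have "\<dots> = 2 * (\<Sum>q\<in>P. (f q)\<^sup>2)"
    unfolding sum_distrib_left[symmetric] by (simp only: sum.group[OF finP fe eP])
  also have "(\<Sum>q\<in>P. (f q)\<^sup>2) \<le> (\<Sum>q\<in>{..<n} \<times> {..<n}. (f q)\<^sup>2)"
    by (intro sum_mono2) (auto simp: P_def)
  also have "\<dots> = (\<Sum>r<n. (y r)\<^sup>2) * (\<Sum>i<n. (x i)\<^sup>2)"
    by (simp add: f_def sum_product power_mult_distrib sum.cartesian_product case_prod_unfold)
  also have "\<dots> \<le> 1 * 1" using x y by (intro mult_mono sum_nonneg) auto
  finally have c2: "(\<Sum>E\<in>all_edges n. (c E)\<^sup>2) \<le> 2" by simp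
  have "Pr (all_edges n) (\<lambda>B. L \<le> (\<Sum>r<n. \<Sum>i<n. y r * centered B r i * x i))
     = Pr (all_edges n) (\<lambda>B. L \<le> (\<Sum>E\<in>all_edges n. c E * (of_bool (E \<in> B) - p)))"
    using bil by (intro Pr_cong) simp
  also have "\<dots> \<le> exp (- (L\<^sup>2 / 8))" by (rule hoeffding_tail[OF fe c2 L])
  finally show ?thesis .
qed

text \<open>On a net of mesh n^(-2) the bilinear form changes by at most 2, which is at most half of
  \<Lambda>. So fine a net costs a logarithm: the bound is useful only for \<Lambda> above order
  sqrt(n log n), which the later choice of \<Lambda> exceeds by a power of n.\<close>

lemma norm_ok_probable:
  assumes n: "1 \<le> n" and \<Lambda>: "4 \<le> \<Lambda>"
  shows "Pr (all_edges n) (\<lambda>B. \<not> norm_ok n \<Lambda> B) \<le> (2 * real n ^ 2 + 1) ^ (2 * n) * exp (- (\<Lambda>\<^sup>2 / 32))"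
proof -
  let ?G = "grid {..<n} (n\<^sup>2) 1"
  let ?X = "{x\<in>?G. (\<Sum>i<n. (x i)\<^sup>2) \<le> 1}"
  have finX: "finite ?X" using finite_grid[of "{..<n}" "n\<^sup>2" 1] by simp
  have "Pr (all_edges n) (\<lambda>B. \<not> norm_ok n \<Lambda> B) \<le>
    Pr (all_edges n) (\<lambda>B. \<exists>xy\<in>?X \<times> ?X. \<Lambda> / 2 \<le> (\<Sum>r<n. \<Sum>i<n. snd xy r * centered B r i * fst xy i))"
  proof (rule Pr_mono)
    fix B assume "\<not> norm_ok n \<Lambda> B"
    then obtain x where x: "\<Lambda>\<^sup>2 * (\<Sum>i<n. (x i)\<^sup>2) < (\<Sum>r<n. (\<Sum>i<n. centered B r i * x i)\<^sup>2)"
      by (auto simp: norm_ok_def not_le)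
    define s where "s = (\<Sum>i<n. (x i)\<^sup>2)"
    have s0: "s \<noteq> 0"
    proof
      assume "s = 0"
      then have "\<forall>i<n. x i = 0" by (simp add: s_def sum_nonneg_eq_0_iff)
      then show False using x by simp
    qed
    have "0 \<le> s" unfolding s_def by (intro sum_nonneg) auto
    then have s: "0 < s" using s0 by simp
    define u where "u = (\<lambda>i. x i / sqrt s)"
    define z where "z = (\<lambda>r. \<Sum>i<n. centered B r i * u i)"
    define N where "N = sqrt (\<Sum>r<n. (z r)\<^sup>2)"
    have u1: "(\<Sum>i<n. (u i)\<^sup>2) = 1"
      using s by (simp add: u_def power_divide s_def sum_divide_distrib[symmetric])
    have "z r = (\<Sum>i<n. centered B r i * x i) / sqrt s" for r
      by (simp add: z_def u_def sum_divide_distrib)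
    then have "(\<Sum>r<n. (z r)\<^sup>2) = (\<Sum>r<n. ((\<Sum>i<n. centered B r i * x i) / sqrt s)\<^sup>2)" by (simp only:)
    also have "\<dots> = (\<Sum>r<n. (\<Sum>i<n. centered B r i * x i)\<^sup>2) / s"
      using s by (simp add: power_divide flip: sum_divide_distrib)
    finally have "(\<Sum>r<n. (z r)\<^sup>2) = (\<Sum>r<n. (\<Sum>i<n. centered B r i * x i)\<^sup>2) / s" .
    then have "\<Lambda>\<^sup>2 < (\<Sum>r<n. (z r)\<^sup>2)" using x s by (simp add: s_def[symmetric] pos_less_divide_eq)
    then have N: "\<Lambda> < N" unfolding N_def by (rule real_less_rsqrt)
    have Npos: "0 < N" using N \<Lambda> by simp
    define w where "w = (\<lambda>r. z r / N)"
    have N2: "(\<Sum>r<n. (z r)\<^sup>2) = N\<^sup>2" unfolding N_def by (simp add: sum_nonneg)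
    have w1: "(\<Sum>r<n. (w r)\<^sup>2) = 1"
      using Npos by (simp add: w_def power_divide N2 flip: sum_divide_distrib)
    have "(\<Sum>r<n. w r * z r) = (\<Sum>r<n. (z r)\<^sup>2) / N"
      by (simp add: w_def power2_eq_square flip: sum_divide_distrib)
    also have "\<dots> = N" unfolding N2 using Npos by (simp add: power2_eq_square)
    finally have wz: "(\<Sum>r<n. \<Sum>i<n. w r * centered B r i * u i) = N"
      by (simp add: z_def sum_distrib_left mult.assoc)
    have le1: "\<bar>v i\<bar> \<le> 1" if "(\<Sum>i<n. (v i)\<^sup>2) = 1" "i < n" for v :: "nat \<Rightarrow> real" and i
      using member_le_sum[of i "{..<n}" "\<lambda>i. (v i)\<^sup>2"] that by (simp add: abs_square_le_1)
    have D: "0 < n\<^sup>2" using n by simp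
    have "\<bar>u i\<bar> \<le> real 1" if "i \<in> {..<n}" for i using le1[OF u1] that by simp
    then obtain u' where u': "u' \<in> ?G" "\<And>i. i \<in> {..<n} \<Longrightarrow> \<bar>u i - u' i\<bar> \<le> 1 / real (n\<^sup>2)" "\<And>i. i \<in> {..<n} \<Longrightarrow> \<bar>u' i\<bar> \<le> \<bar>u i\<bar>"
      using grid_round[OF D, of "{..<n}" u 1] by blast
    have "\<bar>w i\<bar> \<le> real 1" if "i \<in> {..<n}" for i using le1[OF w1] that by simp
    then obtain w' where w': "w' \<in> ?G" "\<And>i. i \<in> {..<n} \<Longrightarrow> \<bar>w i - w' i\<bar> \<le> 1 / real (n\<^sup>2)" "\<And>i. i \<in> {..<n} \<Longrightarrow> \<bar>w' i\<bar> \<le> \<bar>w i\<bar>"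
      using grid_round[OF D, of "{..<n}" w 1] by blast
    have sq: "(\<Sum>i<n. (v' i)\<^sup>2) \<le> 1" if "(\<Sum>i<n. (v i)\<^sup>2) = 1" "\<And>i. i \<in> {..<n} \<Longrightarrow> \<bar>v' i\<bar> \<le> \<bar>v i\<bar>" for v v' :: "nat \<Rightarrow> real"
      unfolding that(1)[symmetric] using that(2) by (intro sum_mono) (simp add: abs_le_square_iff)
    have X: "u' \<in> ?X" "w' \<in> ?X" using u' w' sq[OF u1] sq[OF w1] by auto
    have cb: "\<bar>centered B r i\<bar> \<le> 1" for r i
      using p_pos p_less_1 by (auto simp: centered_def adj_def of_bool_def)
    have diff: "\<bar>w r * centered B r i * u i - w' r * centered B r i * u' i\<bar> \<le> 2 / real (n\<^sup>2)"
      if "r < n" "i < n" for r i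
    proof -
      have "w r * centered B r i * u i - w' r * centered B r i * u' i
        = centered B r i * (w r * (u i - u' i) + (w r - w' r) * u' i)" by (simp add: algebra_simps)
      also have "\<bar>\<dots>\<bar> \<le> 1 * (\<bar>w r * (u i - u' i)\<bar> + \<bar>(w r - w' r) * u' i\<bar>)"
        unfolding abs_mult[of "centered B r i"] using cb by (intro mult_mono abs_triangle_ineq) auto
      also have "\<bar>w r * (u i - u' i)\<bar> \<le> 1 * (1 / real (n\<^sup>2))"
        unfolding abs_mult using le1[OF w1] u'(2) that by (intro mult_mono) auto
      also have "\<bar>(w r - w' r) * u' i\<bar> \<le> (1 / real (n\<^sup>2)) * 1"
        unfolding abs_mult using le1[OF u1, of i] u'(3)[of i] w'(2) that by (intro mult_mono) auto
      finally show ?thesis by simp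
    qed
    have "N - (\<Sum>r<n. \<Sum>i<n. w' r * centered B r i * u' i)
       = (\<Sum>r<n. \<Sum>i<n. w r * centered B r i * u i - w' r * centered B r i * u' i)"
      by (simp add: wz[symmetric] sum_subtractf)
    also have "\<dots> \<le> (\<Sum>r<n. \<Sum>i<n. 2 / real (n\<^sup>2))"
      by (intro sum_mono) (use diff in \<open>auto simp: abs_le_iff\<close>)
    also have "\<dots> = 2" using n by (simp add: power2_eq_square)
    finally have "\<Lambda> / 2 \<le> (\<Sum>r<n. \<Sum>i<n. w' r * centered B r i * u' i)" using N \<Lambda> by linarith
    then show "\<exists>xy\<in>?X \<times> ?X. \<Lambda> / 2 \<le> (\<Sum>r<n. \<Sum>i<n. snd xy r * centered B r i * fst xy i)"
      using X by (intro bexI[of _ "(u', w')"]) auto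
  qed
  also have "\<dots> \<le> real (card (?X \<times> ?X)) * exp (- ((\<Lambda> / 2)\<^sup>2 / 8))"
    using finX \<Lambda> by (intro Pr_Bex_le_card bilinear_tail finite_cartesian_product) auto
  also have "\<dots> \<le> (2 * real n ^ 2 + 1) ^ (2 * n) * exp (- (\<Lambda>\<^sup>2 / 32))"
  proof (intro mult_mono)
    have "card ?X \<le> card ?G" by (intro card_mono finite_grid) auto
    also have "\<dots> \<le> (2 * n\<^sup>2 + 1) ^ n" using card_grid[of "{..<n}" "n\<^sup>2" 1] by simp
    finally have cX: "card ?X \<le> (2 * n\<^sup>2 + 1) ^ n" .
    have "card (?X \<times> ?X) \<le> (2 * n\<^sup>2 + 1) ^ n * (2 * n\<^sup>2 + 1) ^ n"
      unfolding card_cartesian_product by (rule mult_mono[OF cX cX]) auto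
    also have "\<dots> = (2 * n\<^sup>2 + 1) ^ (2 * n)" by (simp add: power_add[symmetric] mult_2)
    finally have "real (card (?X \<times> ?X)) \<le> real ((2 * n\<^sup>2 + 1) ^ (2 * n))" by (rule of_nat_mono)
    then show "real (card (?X \<times> ?X)) \<le> (2 * real n ^ 2 + 1) ^ (2 * n)" by (simp add: add.commute)
    show "exp (- ((\<Lambda> / 2)\<^sup>2 / 8)) \<le> exp (- (\<Lambda>\<^sup>2 / 32))" by (simp add: power_divide)
  qed auto
  finally show ?thesis .
qed

section \<open>Incompressibility of eigenvectors\<close>

text \<open>The constant \<beta> stands for the mean contribution of the coordinates outside
  \<open>L\<close>, which is the same in all rows up to the diagonal.\<close>

definition sparse_bad :: "nat \<Rightarrow> nat \<Rightarrow> real \<Rightarrow> nat set set \<Rightarrow> bool" where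
  "sparse_bad n K h B \<longleftrightarrow> (\<exists>L u \<beta>. L \<subseteq> {..<n} \<and> card L \<le> K \<and> 1 / 4 \<le> (\<Sum>i\<in>L. (u i)\<^sup>2) \<and> (\<forall>i\<in>L. \<bar>u i\<bar> \<le> 1)
     \<and> \<bar>\<beta>\<bar> \<le> real n \<and> (\<Sum>r\<in>{..<n} - L. (row_sum B L u r + \<beta>)\<^sup>2) \<le> h)"

lemma row_sum_diff_le:
  fixes d :: real
  assumes "\<And>i. i \<in> L \<Longrightarrow> \<bar>u i - u' i\<bar> \<le> d" "0 \<le> d"
  shows "\<bar>row_sum B L u r - row_sum B L u' r\<bar> \<le> card L * d"
proof -
  have "row_sum B L u r - row_sum B L u' r = (\<Sum>i\<in>L. adj B r i * (u i - u' i))"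
    by (simp add: row_sum_def right_diff_distrib sum_subtractf)
  also have "\<bar>\<dots>\<bar> \<le> (\<Sum>i\<in>L. \<bar>adj B r i * (u i - u' i)\<bar>)" by (rule sum_abs)
  also have "\<dots> \<le> (\<Sum>i\<in>L. d)"
  proof (rule sum_mono)
    fix i assume "i \<in> L"
    then show "\<bar>adj B r i * (u i - u' i)\<bar> \<le> d" using assms by (auto simp: adj_def)
  qed
  finally show ?thesis by simp
qed

lemma abs_gt_half: "\<bar>x - y\<bar> \<le> c / 2 \<Longrightarrow> c < \<bar>x\<bar> \<Longrightarrow> c / 2 < \<bar>y\<bar>" for x y c :: real
  by linarith

lemma card_large_le:
  fixes f :: "nat \<Rightarrow> real"
  assumes "finite R" "(\<Sum>r\<in>R. (f r)\<^sup>2) \<le> h" "0 < c"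
  shows "real (card {r\<in>R. c < \<bar>f r\<bar>}) \<le> h / c\<^sup>2"
proof -
  have "real (card {r\<in>R. c < \<bar>f r\<bar>}) * c\<^sup>2 \<le> (\<Sum>r\<in>{r\<in>R. c < \<bar>f r\<bar>}. (f r)\<^sup>2)"
  proof (rule sum_bounded_below)
    fix r assume "r \<in> {r\<in>R. c < \<bar>f r\<bar>}"
    then show "c\<^sup>2 \<le> (f r)\<^sup>2" using assms(3) power_mono[of c "\<bar>f r\<bar>" 2] by auto
  qed
  also have "\<dots> \<le> (\<Sum>r\<in>R. (f r)\<^sup>2)" using assms(1) by (intro sum_mono2) auto
  finally show ?thesis using assms(2,3) by (simp add: pos_le_divide_eq)
qed

lemma stars_in_all_edges: "L \<subseteq> {..<n} \<Longrightarrow> (\<Union>r\<in>{..<n} - L. star r L) \<subseteq> all_edges n"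
proof
  fix e assume L: "L \<subseteq> {..<n}" and "e \<in> (\<Union>r\<in>{..<n} - L. star r L)"
  then obtain r i where "r < n" "r \<notin> L" "i \<in> L" "e = {r, i}" by (auto simp: star_def)
  moreover from this have "r \<noteq> i" by auto
  ultimately show "e \<in> all_edges n" using L by (auto simp: all_edges_def)
qed

text \<open>Here a constant failure probability \<open>q0\<close> per row suffices. The nets for
  \<open>L\<close>, \<open>u\<close> and \<beta> cost only a polynomial to the power
  \<open>K\<close>, against a gain of \<open>q0\<close> for nearly all of the n rows.\<close>

lemma sparse_improbable:
  assumes D: "1 \<le> n" "4 * (real K + 1) \<le> c0 * D" "16 * real K \<le> D" and k: "4 * h / c0\<^sup>2 \<le> real k"
  shows "Pr (all_edges n) (sparse_bad n K h)
    \<le> (real n + 1) ^ K * (2 * real D + 1) ^ K * (2 * real n * real D + 1) * (real n + 1) ^ k * q0 powr (real n - real K - real k)"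
    (is "_ \<le> ?rhs")
proof -
  define X where "X = {L. L \<subseteq> {..<n} \<and> card L \<le> K}"
  define G where "G L = {u\<in>grid L D 1. 1 / 16 \<le> (\<Sum>i\<in>L. (u i)\<^sup>2)}" for L
  define E where "E L u \<beta> B \<longleftrightarrow> card {r\<in>{..<n} - L. c0 < \<bar>row_sum B L u r - (- \<beta>)\<bar>} \<le> k" for L u \<beta> B
  define \<rho> where "\<rho> = (real n + 1) ^ k * q0 powr (real n - real K - real k)"
  have Dpos: "0 < D" using D(2) c0_pos by (cases D) auto
  have finX: "finite X" unfolding X_def by simp
  have finL: "finite L" if "L \<in> X" for L using that finite_subset by (auto simp: X_def)
  have finG: "finite (G L)" if "L \<in> X" for L using finite_grid[OF finL[OF that]] by (simp add: G_def)
  have \<rho>0: "0 \<le> \<rho>" by (simp add: \<rho>_def)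
  have "Pr (all_edges n) (sparse_bad n K h) \<le> Pr (all_edges n) (\<lambda>B. \<exists>L\<in>X. \<exists>u\<in>G L. \<exists>\<beta>\<in>grid1 D n. E L u \<beta> B)"
  proof (rule Pr_mono)
    fix B assume "sparse_bad n K h B"
    then obtain L u \<beta> where L: "L \<subseteq> {..<n}" "card L \<le> K" and u: "1 / 4 \<le> (\<Sum>i\<in>L. (u i)\<^sup>2)" "\<forall>i\<in>L. \<bar>u i\<bar> \<le> 1"
      and \<beta>: "\<bar>\<beta>\<bar> \<le> real n" and small: "(\<Sum>r\<in>{..<n} - L. (row_sum B L u r + \<beta>)\<^sup>2) \<le> h"
      unfolding sparse_bad_def by blast
    have LX: "L \<in> X" using L by (simp add: X_def)
    obtain u' where u': "u' \<in> grid L D 1" "\<And>i. i \<in> L \<Longrightarrow> \<bar>u i - u' i\<bar> \<le> 1 / D" "\<And>i. i \<in> L \<Longrightarrow> \<bar>u' i\<bar> \<le> \<bar>u i\<bar>"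
      using grid_round[OF Dpos, of L u 1] u(2) by auto
    obtain \<beta>' where \<beta>': "\<beta>' \<in> grid1 D n" "\<bar>\<beta> - \<beta>'\<bar> \<le> 1 / D"
      using grid1_round[OF Dpos \<beta>] by blast
    \<comment> \<open>Rounding loses at most 1/8 of the squared mass 1/4, so the net vector still
      has the 1/16 that \<open>row_anticoncentration\<close> needs.\<close>
    have "(\<Sum>i\<in>L. (u i)\<^sup>2) \<le> (\<Sum>i\<in>L. (u' i)\<^sup>2 + 2 / D)"
    proof (rule sum_mono)
      fix i assume i: "i \<in> L"
      have "(u i)\<^sup>2 - (u' i)\<^sup>2 = (u i - u' i) * (u i + u' i)" by (simp add: power2_eq_square algebra_simps)
      also have "\<dots> \<le> \<bar>u i - u' i\<bar> * \<bar>u i + u' i\<bar>" by (simp add: abs_mult[symmetric])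
      also have "\<dots> \<le> 1 / D * 2" using u'(2,3)[OF i] u(2) i by (intro mult_mono) fastforce+
      finally show "(u i)\<^sup>2 \<le> (u' i)\<^sup>2 + 2 / D" by simp
    qed
    also have "\<dots> = (\<Sum>i\<in>L. (u' i)\<^sup>2) + card L * (2 / D)" by (simp add: sum.distrib)
    also have "card L * (2 / D) \<le> 1 / 8"
    proof -
      have "16 * real (card L) \<le> D" using L(2) D(3) by linarith
      then show ?thesis using Dpos by (simp add: field_simps)
    qed
    finally have "u' \<in> G L" using u(1) u'(1) by (simp add: G_def)
    moreover have "E L u' \<beta>' B" unfolding E_def
    proof -
      have close: "\<bar>(row_sum B L u' r - - \<beta>') - (row_sum B L u r + \<beta>)\<bar> \<le> c0 / 2" for r
      proof -
        have "\<bar>row_sum B L u r - row_sum B L u' r\<bar> \<le> card L * (1 / D)"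
          using u'(2) by (intro row_sum_diff_le) auto
        then have "\<bar>(row_sum B L u' r - - \<beta>') - (row_sum B L u r + \<beta>)\<bar> \<le> card L * (1 / D) + 1 / D"
          using \<beta>'(2) by linarith
        also have "\<dots> = (card L + 1) / D" by (simp add: add_divide_distrib)
        also have "\<dots> \<le> (real K + 1) / D" using L(2) by (intro divide_right_mono) auto
        also have "\<dots> \<le> c0 / 2"
        proof -
          have "(real K + 1) * 2 \<le> 4 * (real K + 1)" by simp
          also have "\<dots> \<le> c0 * D" by (rule D(2))
          finally have "(real K + 1) * 2 \<le> c0 * D" .
          then show ?thesis using Dpos by (simp add: divide_le_eq mult.commute)
        qed
        finally show ?thesis .
      qed
      have "card {r\<in>{..<n} - L. c0 < \<bar>row_sum B L u' r - - \<beta>'\<bar>} \<le> card {r\<in>{..<n} - L. c0 / 2 < \<bar>row_sum B L u r + \<beta>\<bar>}"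
      proof (rule card_mono)
        show "{r\<in>{..<n} - L. c0 < \<bar>row_sum B L u' r - - \<beta>'\<bar>} \<subseteq> {r\<in>{..<n} - L. c0 / 2 < \<bar>row_sum B L u r + \<beta>\<bar>}"
        proof
          fix r assume r: "r \<in> {r\<in>{..<n} - L. c0 < \<bar>row_sum B L u' r - - \<beta>'\<bar>}"
          then have "c0 / 2 < \<bar>row_sum B L u r + \<beta>\<bar>" by (intro abs_gt_half[OF close]) simp
          then show "r \<in> {r\<in>{..<n} - L. c0 / 2 < \<bar>row_sum B L u r + \<beta>\<bar>}" using r by simp
        qed
      qed simp
      also have "real \<dots> \<le> h / (c0 / 2)\<^sup>2" using small c0_pos by (intro card_large_le) auto
      also have "\<dots> = 4 * h / c0\<^sup>2" by (simp add: power_divide)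
      also have "\<dots> \<le> real k" by (rule k)
      finally show "card {r\<in>{..<n} - L. c0 < \<bar>row_sum B L u' r - - \<beta>'\<bar>} \<le> k" by (simp only: of_nat_le_iff)
    qed
    ultimately show "\<exists>L\<in>X. \<exists>u\<in>G L. \<exists>\<beta>\<in>grid1 D n. E L u \<beta> B" using LX \<beta>'(1) by blast
  qed
  also have "\<dots> \<le> real (card X) * ((2 * real D + 1) ^ K * ((2 * real n * real D + 1) * \<rho>))"
  proof (rule Pr_Bex_le_card[OF finX])
    fix L assume L: "L \<in> X"
    have "Pr (all_edges n) (\<lambda>B. \<exists>u\<in>G L. \<exists>\<beta>\<in>grid1 D n. E L u \<beta> B) \<le> real (card (G L)) * ((2 * real n * real D + 1) * \<rho>)"
    proof (rule Pr_Bex_le_card[OF finG[OF L]])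
      fix u assume u: "u \<in> G L"
      have "Pr (all_edges n) (\<lambda>B. \<exists>\<beta>\<in>grid1 D n. E L u \<beta> B) \<le> real (card (grid1 D n)) * \<rho>"
      proof (rule Pr_Bex_le_card)
        fix \<beta> assume "\<beta> \<in> grid1 D n"
        have Lsub: "L \<subseteq> {..<n}" "card L \<le> K" using L by (auto simp: X_def)
        have cR: "real (card ({..<n} - L)) = real n - real (card L)"
          using Lsub(1) finL[OF L] card_mono[OF _ Lsub(1)] by (simp add: card_Diff_subset of_nat_diff)
        have R: "real (card ({..<n} - L)) \<le> real n" "real n - real K \<le> real (card ({..<n} - L))"
          unfolding cR using Lsub(2) by auto
        have "Pr (all_edges n) (E L u \<beta>)
          \<le> (real (card ({..<n} - L)) + 1) ^ k * q0 powr (real (card ({..<n} - L)) - real k)"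
          unfolding E_def
        proof (rule rows_most)
          show "(\<Union>r\<in>{..<n} - L. star r L) \<subseteq> all_edges n" using Lsub(1) by (rule stars_in_all_edges)
          show "Pr (star r L) (\<lambda>C. \<bar>row_sum C L u r - a\<bar> \<le> c0) \<le> q0" if "r \<in> {..<n} - L" for r a
            using that u finL[OF L] by (intro row_anticoncentration) (auto simp: G_def)
        qed (use q0_bounds finite_all_edges in auto)
        also have "\<dots> \<le> \<rho>" unfolding \<rho>_def
          using R q0_bounds by (intro mult_mono power_mono powr_mono') auto
        finally show "Pr (all_edges n) (E L u \<beta>) \<le> \<rho>" .
      qed simp
      also have "\<dots> \<le> (2 * real n * real D + 1) * \<rho>"
        using of_nat_mono[OF card_grid1[of D n], where 'a = real] \<rho>0 by (intro mult_right_mono) (auto simp: add.commute)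
      finally show "Pr (all_edges n) (\<lambda>B. \<exists>\<beta>\<in>grid1 D n. E L u \<beta> B) \<le> (2 * real n * real D + 1) * \<rho>" .
    qed
    also have "\<dots> \<le> (2 * real D + 1) ^ K * ((2 * real n * real D + 1) * \<rho>)"
    proof (rule mult_right_mono)
      have "card (G L) \<le> card (grid L D 1)" unfolding G_def using finite_grid[OF finL[OF L]] by (intro card_mono) auto
      also have "\<dots> \<le> (2 * D + 1) ^ card L" using card_grid[OF finL[OF L], of D 1] by simp
      also have "\<dots> \<le> (2 * D + 1) ^ K" using L by (intro power_increasing) (auto simp: X_def)
      finally have "real (card (G L)) \<le> real ((2 * D + 1) ^ K)" by (rule of_nat_mono)
      then show "real (card (G L)) \<le> (2 * real D + 1) ^ K" by (simp add: add.commute)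
    qed (use \<rho>0 in auto)
    finally show "Pr (all_edges n) (\<lambda>B. \<exists>u\<in>G L. \<exists>\<beta>\<in>grid1 D n. E L u \<beta> B) \<le> (2 * real D + 1) ^ K * ((2 * real n * real D + 1) * \<rho>)" .
  qed
  also have "\<dots> \<le> (real n + 1) ^ K * ((2 * real D + 1) ^ K * ((2 * real n * real D + 1) * \<rho>))"
  proof (rule mult_right_mono)
    have "real (card X) \<le> real ((card {..<n} + 1) ^ K)"
      unfolding X_def by (intro of_nat_mono card_small_subsets) simp
    then show "real (card X) \<le> (real n + 1) ^ K" by (simp add: add.commute)
  qed (use \<rho>0 in auto)
  also have "\<dots> = ?rhs" by (simp add: \<rho>_def mult.assoc)
  finally show ?thesis .
qed

end

definition eig :: "nat \<Rightarrow> nat set set \<Rightarrow> real \<Rightarrow> (nat \<Rightarrow> real) \<Rightarrow> bool" where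
  "eig n B lam x \<longleftrightarrow> (\<forall>r<n. (\<Sum>i<n. adj B r i * x i) = lam * x r)"

definition unit_norm :: "nat \<Rightarrow> (nat \<Rightarrow> real) \<Rightarrow> bool" where
  "unit_norm n x \<longleftrightarrow> (\<Sum>i<n. (x i)\<^sup>2) = 1"

lemma unit_norm_le1: "unit_norm n x \<Longrightarrow> i < n \<Longrightarrow> \<bar>x i\<bar> \<le> 1"
  using member_le_sum[of i "{..<n}" "\<lambda>i. (x i)\<^sup>2"] by (auto simp: unit_norm_def abs_square_le_1)

lemma sum_sq_add_le:
  fixes f g :: "'a \<Rightarrow> real"
  shows "(\<Sum>r\<in>R. (f r + g r)\<^sup>2) \<le> 2 * (\<Sum>r\<in>R. (f r)\<^sup>2) + 2 * (\<Sum>r\<in>R. (g r)\<^sup>2)"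
proof -
  have "(f r + g r)\<^sup>2 \<le> 2 * (f r)\<^sup>2 + 2 * (g r)\<^sup>2" for r
  proof -
    have "0 \<le> (f r - g r)\<^sup>2" by simp
    then show ?thesis by (simp add: power2_eq_square algebra_simps)
  qed
  then have "(\<Sum>r\<in>R. (f r + g r)\<^sup>2) \<le> (\<Sum>r\<in>R. 2 * (f r)\<^sup>2 + 2 * (g r)\<^sup>2)" by (intro sum_mono)
  then show ?thesis by (simp add: sum.distrib sum_distrib_left)
qed

context bernoulli_sets begin

text \<open>In the eigenvalue equation the columns in \<open>J\<close> are split into centred part
  and mean. The mean gives the constant \<beta>, up to the missing diagonal, and the centred part is
  bounded through \<open>norm_ok\<close>. The constant is 10 = 2 * 4 + 2 because
  \<open>(lam + p)\<^sup>2\<close> is at most \<open>4 * \<Lambda>\<^sup>2\<close>.\<close>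

lemma eigenvector_split:
  assumes B: "B \<subseteq> all_edges n" and nrm: "norm_ok n \<Lambda> B" and e: "eig n B lam x" and lam: "\<bar>lam\<bar> \<le> \<Lambda>" "1 \<le> \<Lambda>"
    and J: "J \<subseteq> {..<n}"
  defines "I \<equiv> {..<n} - J" and "\<beta> \<equiv> p * (\<Sum>j\<in>J. x j)"
  shows "(\<Sum>r<n. (row_sum B I x r + \<beta> - of_bool (r \<in> I) * (lam * x r))\<^sup>2) \<le> 10 * \<Lambda>\<^sup>2 * (\<Sum>j\<in>J. (x j)\<^sup>2)"
proof -
  define y where "y i = of_bool (i \<in> J) * x i" for i
  define z where "z r = (\<Sum>i<n. centered B r i * y i)" for r
  have finJ: "finite J" using J finite_subset by blast
  have sumJ: "(\<Sum>i<n. f i * y i) = (\<Sum>j\<in>J. f j * x j)" for f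
    unfolding y_def using J by (intro sum.mono_neutral_cong_right) auto
  have y2: "(\<Sum>i<n. (y i)\<^sup>2) = (\<Sum>j\<in>J. (x j)\<^sup>2)"
    unfolding y_def using J by (intro sum.mono_neutral_cong_right) auto
  have no_loop: "adj B r r = 0" for r using B by (auto simp: adj_def all_edges_def)
  have eq: "row_sum B I x r + \<beta> - of_bool (r \<in> I) * (lam * x r) = (lam + p) * y r + - z r" if r: "r < n" for r
  proof -
    have "(\<Sum>i<n. adj B r i * x i) = row_sum B I x r + (\<Sum>j\<in>J. adj B r j * x j)"
      unfolding row_sum_def I_def using J by (subst sum.subset_diff[of J]) auto
    then have 1: "row_sum B I x r = lam * x r - (\<Sum>j\<in>J. adj B r j * x j)"
      using e r by (simp add: eig_def)
    have "z r = (\<Sum>j\<in>J. centered B r j * x j)" unfolding z_def by (rule sumJ)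
    also have "\<dots> = (\<Sum>j\<in>J. adj B r j * x j) - p * (\<Sum>j\<in>J. of_bool (r \<noteq> j) * x j)"
      by (simp add: centered_def left_diff_distrib sum_subtractf sum_distrib_left mult.assoc)
    also have "(\<Sum>j\<in>J. of_bool (r \<noteq> j) * x j) = (\<Sum>j\<in>J. x j - (if j = r then x j else 0))"
      by (intro sum.cong) auto
    also have "\<dots> = (\<Sum>j\<in>J. x j) - y r"
      using finJ by (simp add: sum_subtractf y_def)
    finally have 2: "(\<Sum>j\<in>J. adj B r j * x j) = z r + \<beta> - p * y r"
      by (simp add: \<beta>_def algebra_simps)
    show ?thesis unfolding 1 2 using r by (auto simp: I_def y_def algebra_simps)
  qed
  have "(\<Sum>r<n. (row_sum B I x r + \<beta> - of_bool (r \<in> I) * (lam * x r))\<^sup>2)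
      = (\<Sum>r<n. ((lam + p) * y r + - z r)\<^sup>2)" using eq by (intro sum.cong) auto
  also have "\<dots> \<le> 2 * (\<Sum>r<n. ((lam + p) * y r)\<^sup>2) + 2 * (\<Sum>r<n. (- z r)\<^sup>2)" by (rule sum_sq_add_le)
  also have "(\<Sum>r<n. ((lam + p) * y r)\<^sup>2) = (lam + p)\<^sup>2 * (\<Sum>j\<in>J. (x j)\<^sup>2)"
    by (simp add: power_mult_distrib y2[symmetric] sum_distrib_left)
  also have "(lam + p)\<^sup>2 * (\<Sum>j\<in>J. (x j)\<^sup>2) \<le> (2 * \<Lambda>)\<^sup>2 * (\<Sum>j\<in>J. (x j)\<^sup>2)"
  proof (intro mult_right_mono sum_nonneg)
    have "\<bar>lam + p\<bar> \<le> \<bar>2 * \<Lambda>\<bar>" using lam p_pos p_less_1 by linarith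
    then show "(lam + p)\<^sup>2 \<le> (2 * \<Lambda>)\<^sup>2" by (simp only: abs_le_square_iff)
  qed simp
  also have "(\<Sum>r<n. (- z r)\<^sup>2) \<le> \<Lambda>\<^sup>2 * (\<Sum>j\<in>J. (x j)\<^sup>2)"
    using nrm unfolding norm_ok_def z_def y2[symmetric] by simp
  finally show ?thesis by (simp add: power_mult_distrib)
qed

text \<open>This is the form of spreading that \<open>small_ball\<close> consumes: enough squared
  mass on coefficients bounded by \<open>t\<close>.\<close>

definition incompressible :: "nat \<Rightarrow> real \<Rightarrow> real \<Rightarrow> (nat \<Rightarrow> real) \<Rightarrow> bool" where
  "incompressible n t \<tau> x \<longleftrightarrow> \<tau> \<le> (\<Sum>i\<in>{i. i < n \<and> \<bar>x i\<bar> \<le> t}. (x i)\<^sup>2)"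

lemma abs_sum_le_card:
  assumes "finite J" "\<And>j. j \<in> J \<Longrightarrow> \<bar>x j\<bar> \<le> (1::real)"
  shows "\<bar>\<Sum>j\<in>J. x j\<bar> \<le> card J"
proof -
  have "\<bar>\<Sum>j\<in>J. x j\<bar> \<le> (\<Sum>j\<in>J. \<bar>x j\<bar>)" by (rule sum_abs)
  also have "\<dots> \<le> (\<Sum>j\<in>J. 1)" using assms by (intro sum_mono) auto
  finally show ?thesis by simp
qed

text \<open>At most 1/t^2 coordinates of a unit vector exceed \<open>t\<close>. If the others had
  squared mass below \<tau>, these few would carry at least 1/4, and
  \<open>eigenvector_split\<close> would make their row sums nearly constant on all other
  rows.\<close>

lemma incompressible_if_not_sparse:
  assumes B: "B \<subseteq> all_edges n" and nrm: "norm_ok n \<Lambda> B" and e: "eig n B lam x" and x: "unit_norm n x"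
    and lam: "\<bar>lam\<bar> \<le> \<Lambda>" "1 \<le> \<Lambda>" and t: "0 < t" "1 / t\<^sup>2 \<le> real K" and \<tau>: "\<tau> \<le> 3 / 4"
    and good: "\<not> sparse_bad n K (10 * \<Lambda>\<^sup>2 * \<tau>) B"
  shows "incompressible n t \<tau> x"
proof (rule ccontr)
  define J where "J = {i. i < n \<and> \<bar>x i\<bar> \<le> t}"
  define L where "L = {..<n} - J"
  define \<beta> where "\<beta> = p * (\<Sum>j\<in>J. x j)"
  assume "\<not> incompressible n t \<tau> x"
  then have small: "(\<Sum>i\<in>J. (x i)\<^sup>2) < \<tau>" by (simp add: incompressible_def J_def)
  have J: "J \<subseteq> {..<n}" "finite J" by (auto simp: J_def)
  have JL: "{..<n} - L = J" using J by (auto simp: L_def)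
  have "(\<Sum>r\<in>J. (row_sum B L x r + \<beta>)\<^sup>2) = (\<Sum>r\<in>J. (row_sum B L x r + \<beta> - of_bool (r \<in> L) * (lam * x r))\<^sup>2)"
    by (intro sum.cong) (auto simp: L_def)
  also have "\<dots> \<le> (\<Sum>r<n. (row_sum B L x r + \<beta> - of_bool (r \<in> L) * (lam * x r))\<^sup>2)"
    using J by (intro sum_mono2) auto
  also have "\<dots> \<le> 10 * \<Lambda>\<^sup>2 * (\<Sum>j\<in>J. (x j)\<^sup>2)"
    unfolding L_def \<beta>_def by (rule eigenvector_split[OF B nrm e lam J(1)])
  also have "\<dots> \<le> 10 * \<Lambda>\<^sup>2 * \<tau>" using small by (intro mult_left_mono) auto
  finally have rows: "(\<Sum>r\<in>{..<n} - L. (row_sum B L x r + \<beta>)\<^sup>2) \<le> 10 * \<Lambda>\<^sup>2 * \<tau>" unfolding JL .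
  have x1: "\<bar>x i\<bar> \<le> 1" if "i < n" for i using unit_norm_le1[OF x that] .
  have tot: "(\<Sum>i\<in>L. (x i)\<^sup>2) + (\<Sum>i\<in>J. (x i)\<^sup>2) = 1"
    using x J unfolding unit_norm_def L_def by (subst (asm) sum.subset_diff[of J]) auto
  have "real (card {i\<in>{..<n}. t < \<bar>x i\<bar>}) \<le> 1 / t\<^sup>2"
    using x t by (intro card_large_le) (auto simp: unit_norm_def)
  moreover have "{i\<in>{..<n}. t < \<bar>x i\<bar>} = L" by (auto simp: L_def J_def)
  ultimately have "real (card L) \<le> real K" using t(2) by simp
  then have cL: "card L \<le> K" by simp
  have "\<bar>\<Sum>j\<in>J. x j\<bar> \<le> card J" using J x1 by (intro abs_sum_le_card) auto
  also have "card J \<le> card {..<n}" using J by (intro card_mono) auto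
  finally have "\<bar>\<Sum>j\<in>J. x j\<bar> \<le> real n" by simp
  then have "p * \<bar>\<Sum>j\<in>J. x j\<bar> \<le> 1 * real n" using p_pos p_less_1 by (intro mult_mono) auto
  then have \<beta>: "\<bar>\<beta>\<bar> \<le> real n" using p_pos by (simp add: \<beta>_def abs_mult)
  have "sparse_bad n K (10 * \<Lambda>\<^sup>2 * \<tau>) B"
    unfolding sparse_bad_def
  proof (intro exI conjI)
    show "L \<subseteq> {..<n}" by (auto simp: L_def)
    show "1 / 4 \<le> (\<Sum>i\<in>L. (x i)\<^sup>2)" using tot small \<tau> by linarith
    show "\<forall>i\<in>L. \<bar>x i\<bar> \<le> 1" using x1 by (auto simp: L_def)
  qed (use cL \<beta> rows in auto)
  then show False using good by simp
qed

section \<open>Eigenvectors with many small coordinates\<close>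

text \<open>The extra column of \<open>bordered\<close> absorbs the unknown multiple of the all-ones vector that stems
  from the nonzero mean of the entries.\<close>

definition bordered :: "nat \<Rightarrow> real \<Rightarrow> nat set set \<Rightarrow> nat \<Rightarrow> nat \<Rightarrow> real" where
  "bordered n lam B r a = (if a = n then sqrt n else shifted lam B r a)"

definition rich :: "nat \<Rightarrow> real \<Rightarrow> nat \<Rightarrow> nat set \<Rightarrow> real \<Rightarrow> nat set set \<Rightarrow> bool" where
  "rich n \<theta> d J lam B \<longleftrightarrow> (let I = {..<n} - J in \<exists>Q. is_proj I Q \<and> real d \<le> tr I Q \<and>
      (\<forall>x. range_of I Q x \<longrightarrow> qf I I (shifted lam B) x \<le> \<theta> * (\<Sum>a\<in>I. (x a)\<^sup>2)))"

text \<open>Written with net points so that a union bound applies. The window, hence the finite set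
  of candidates \<open>u\<close>, depends only on entries inside \<open>I\<close>; the final
  condition depends on the edges between \<open>J\<close> and \<open>I\<close>.\<close>

definition few :: "nat \<Rightarrow> nat \<Rightarrow> real \<Rightarrow> nat \<Rightarrow> nat \<Rightarrow> real \<Rightarrow> real \<Rightarrow> nat set \<Rightarrow> real \<Rightarrow> nat set set \<Rightarrow> bool" where
  "few n D \<theta> d k t \<tau> J lam B \<longleftrightarrow> (let I = {..<n} - J; (D0, v) = window_of I (insert n I) (bordered n lam B) \<theta> in
     card D0 \<le> d \<and> (\<exists>c\<in>grid D0 D 2. \<exists>\<gamma>\<in>grid1 D (2 * n). let u = comb D0 v c in
        \<tau> / 4 \<le> (\<Sum>i\<in>{i\<in>I. \<bar>u i\<bar> \<le> 2 * t}. (u i)\<^sup>2) \<and> card {j\<in>J. 2 * t < \<bar>row_sum B I u j - (- \<gamma>)\<bar>} \<le> k))"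

lemma bordered_restrict:
  assumes "I \<subseteq> {..<n}" "finite I"
  shows "(\<Sum>a\<in>insert n I. bordered n lam B r a * X a) = (\<Sum>a\<in>I. shifted lam B r a * X a) + sqrt n * X n"
proof -
  have "n \<notin> I" using assms by auto
  moreover from this have "(\<Sum>a\<in>I. bordered n lam B r a * X a) = (\<Sum>a\<in>I. shifted lam B r a * X a)"
    by (intro sum.cong) (auto simp: bordered_def)
  ultimately show ?thesis using assms by (simp add: bordered_def)
qed

lemma shifted_row:
  assumes "finite I"
  shows "(\<Sum>a\<in>I. shifted lam B r a * x a) = row_sum B I x r - of_bool (r \<in> I) * (lam * x r)"
proof -
  have "(\<Sum>a\<in>I. shifted lam B r a * x a) = row_sum B I x r - (\<Sum>a\<in>I. if a = r then lam * x a else 0)"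
    unfolding shifted_def row_sum_def left_diff_distrib sum_subtractf by (intro arg_cong2[of _ _ _ _ "(-)"] sum.cong) auto
  then show ?thesis using assms by simp
qed

text \<open>Window vectors that vanish at the border index \<open>n\<close> form a space with at
  most one dimension less, and on it the bordered matrix acts as the shifted one.\<close>

lemma rich_if_large_window:
  assumes win: "window (insert n I) I (bordered n lam B) \<theta> D0 v" and I: "I = {..<n} - J"
    and d: "d < card D0"
  shows "rich n \<theta> d J lam B"
proof -
  have fin: "finite I" and nI: "n \<notin> I" and Isub: "I \<subseteq> {..<n}" using I by auto
  have D0: "finite D0" and orth: "\<And>i j. i \<in> D0 \<Longrightarrow> j \<in> D0 \<Longrightarrow> (\<Sum>a\<in>insert n I. v i a * v j a) = of_bool (i = j)"
    using win by (auto simp: window_def)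
  note K = kernel_of_proj[OF D0 orth]
  have del: "insert n I - {n} = I" using nI by auto
  obtain Q where Q: "is_proj (insert n I - {n}) Q" "tr (insert n I) (kernel_of D0 v) - card {n} \<le> tr (insert n I - {n}) Q"
    "\<And>x. range_of (insert n I - {n}) Q x \<Longrightarrow> range_of (insert n I) (kernel_of D0 v) (\<lambda>a. if a \<in> {n} then 0 else x a)"
    using proj_vanishing[OF K(1), of "{n}"] fin by auto
  note Q = Q[unfolded del]
  have "qf I I (shifted lam B) x \<le> \<theta> * (\<Sum>a\<in>I. (x a)\<^sup>2)" if x: "range_of I Q x" for x
  proof -
    define y where "y = (\<lambda>a. if a \<in> {n} then 0 else x a)"
    define c where "c i = (\<Sum>a\<in>insert n I. y a * v i a)" for i
    have ry: "range_of (insert n I) (kernel_of D0 v) y" unfolding y_def by (rule Q(3)[OF x])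
    have cc: "c = (\<lambda>i. \<Sum>a\<in>insert n I. y a * v i a)" by (simp add: c_def[abs_def])
    have yc: "y a = comb D0 v c a" if "a \<in> insert n I" for a
    proof -
      have "app (insert n I) (kernel_of D0 v) y a = y a" using ry that unfolding range_of_def by blast
      then show ?thesis using K(3)[of y a] unfolding cc by simp
    qed
    have "(\<Sum>a\<in>insert n I. y a * y a) = (\<Sum>a\<in>insert n I. y a * comb D0 v c a)"
      using yc by (intro sum.cong) auto
    also have "\<dots> = (\<Sum>i\<in>D0. c i * c i)"
      by (simp only: comb_def c_def sum_distrib_left sum_distrib_right sum.swap[of _ _ D0] mult_ac)
    finally have yy: "(\<Sum>i\<in>D0. (c i)\<^sup>2) = (\<Sum>a\<in>insert n I. (y a)\<^sup>2)" by (simp add: power2_eq_square)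
    have "qf I (insert n I) (bordered n lam B) (comb D0 v c) \<le> \<theta> * (\<Sum>i\<in>D0. (c i)\<^sup>2)"
      using win by (simp add: window_def)
    moreover have "qf I (insert n I) (bordered n lam B) (comb D0 v c) = qf I I (shifted lam B) x"
    proof -
      have "qf I (insert n I) (bordered n lam B) (comb D0 v c) = qf I (insert n I) (bordered n lam B) y"
        unfolding qf_def using yc by (intro sum.cong arg_cong[of _ _ "\<lambda>x. x\<^sup>2"]) auto
      also have "\<dots> = qf I I (shifted lam B) y"
        unfolding qf_def bordered_restrict[OF Isub fin] by (simp add: y_def)
      also have "\<dots> = qf I I (shifted lam B) x"
        unfolding qf_def using nI by (intro sum.cong arg_cong[of _ _ "\<lambda>x. x\<^sup>2"]) (auto simp: y_def)
      finally show ?thesis .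
    qed
    moreover have "(\<Sum>a\<in>insert n I. (y a)\<^sup>2) = (\<Sum>a\<in>I. (x a)\<^sup>2)"
      using fin nI by (auto simp: y_def intro!: sum.cong)
    ultimately show ?thesis using yy by simp
  qed
  moreover have "real d \<le> tr I Q" using Q(2) K(2) d by simp
  ultimately show ?thesis using Q(1) unfolding rich_def Let_def I[symmetric] by blast
qed

end

lemma comb_norm:
  assumes "finite D" and orth: "\<And>i j. i \<in> D \<Longrightarrow> j \<in> D \<Longrightarrow> (\<Sum>a\<in>U. v i a * v j a) = of_bool (i = j)"
  shows "(\<Sum>a\<in>U. (comb D v k a)\<^sup>2) = (\<Sum>i\<in>D. (k i)\<^sup>2)"
proof -
  have "(\<Sum>a\<in>U. (comb D v k a)\<^sup>2) = (\<Sum>a\<in>U. \<Sum>i\<in>D. \<Sum>j\<in>D. (k i * k j) * (v i a * v j a))"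
    by (simp add: comb_def power2_eq_square sum_product mult_ac)
  also have "\<dots> = (\<Sum>i\<in>D. \<Sum>a\<in>U. \<Sum>j\<in>D. (k i * k j) * (v i a * v j a))" by (rule sum.swap)
  also have "\<dots> = (\<Sum>i\<in>D. \<Sum>j\<in>D. \<Sum>a\<in>U. (k i * k j) * (v i a * v j a))" by (intro sum.cong refl sum.swap)
  also have "\<dots> = (\<Sum>i\<in>D. \<Sum>j\<in>D. if i = j then k i * k j else 0)"
  proof (intro sum.cong refl)
    fix i j assume "i \<in> D" "j \<in> D"
    then show "(\<Sum>a\<in>U. (k i * k j) * (v i a * v j a)) = (if i = j then k i * k j else 0)"
      using orth[of i j] by (simp flip: sum_distrib_left)
  qed
  also have "\<dots> = (\<Sum>i\<in>D. (k i)\<^sup>2)" using assms(1) by (simp add: power2_eq_square)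
  finally show ?thesis .
qed

context bernoulli_sets begin

text \<open>The coordinates in \<open>J\<close> take \<tau>/8 away. Of the remaining 7/8, passing
  from \<open>x\<close> to \<open>u\<close> costs another \<tau>/4 and a factor 2, which leaves 5/16
  of \<tau>.\<close>

lemma incompressible_transfer:
  fixes x u :: "nat \<Rightarrow> real"
  assumes I: "I = {..<n} - J" "J \<subseteq> {..<n}" and inc: "incompressible n t \<tau> x"
    and s2: "(\<Sum>j\<in>J. (x j)\<^sup>2) \<le> \<tau> / 8" and \<kappa>: "(\<Sum>i\<in>I. (x i - u i)\<^sup>2) \<le> \<tau> / 8"
    and t: "\<And>i. i \<in> I \<Longrightarrow> \<bar>x i - u i\<bar> \<le> t"
  shows "\<tau> / 4 \<le> (\<Sum>i\<in>{i\<in>I. \<bar>u i\<bar> \<le> 2 * t}. (u i)\<^sup>2)"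
proof -
  define G where "G = {i\<in>I. \<bar>x i\<bar> \<le> t}"
  have fin: "finite I" "finite J" "finite G" using I finite_subset by (auto simp: G_def)
  have "\<tau> \<le> (\<Sum>i\<in>{i. i < n \<and> \<bar>x i\<bar> \<le> t}. (x i)\<^sup>2)" using inc by (simp add: incompressible_def)
  also have "\<dots> \<le> (\<Sum>i\<in>G \<union> J. (x i)\<^sup>2)" using fin I by (intro sum_mono2) (auto simp: G_def)
  also have "\<dots> = (\<Sum>i\<in>G. (x i)\<^sup>2) + (\<Sum>i\<in>J. (x i)\<^sup>2)"
    using fin I by (intro sum.union_disjoint) (auto simp: G_def)
  finally have 1: "\<tau> * (7 / 8) \<le> (\<Sum>i\<in>G. (x i)\<^sup>2)" using s2 by simp
  have "(\<Sum>i\<in>G. (x i)\<^sup>2) = (\<Sum>i\<in>G. (u i + (x i - u i))\<^sup>2)" by simp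
  also have "\<dots> \<le> 2 * (\<Sum>i\<in>G. (u i)\<^sup>2) + 2 * (\<Sum>i\<in>G. (x i - u i)\<^sup>2)" by (rule sum_sq_add_le)
  also have "(\<Sum>i\<in>G. (x i - u i)\<^sup>2) \<le> (\<Sum>i\<in>I. (x i - u i)\<^sup>2)"
    using fin by (intro sum_mono2) (auto simp: G_def)
  finally have 2: "(\<Sum>i\<in>G. (x i)\<^sup>2) \<le> 2 * (\<Sum>i\<in>G. (u i)\<^sup>2) + \<tau> / 4" using \<kappa> by simp
  have "(\<Sum>i\<in>G. (u i)\<^sup>2) \<le> (\<Sum>i\<in>{i\<in>I. \<bar>u i\<bar> \<le> 2 * t}. (u i)\<^sup>2)"
  proof (intro sum_mono2)
    show "G \<subseteq> {i\<in>I. \<bar>u i\<bar> \<le> 2 * t}"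
    proof
      fix i assume "i \<in> G"
      then have "i \<in> I" "\<bar>x i\<bar> \<le> t" by (auto simp: G_def)
      then show "i \<in> {i\<in>I. \<bar>u i\<bar> \<le> 2 * t}" using t[of i] by auto
    qed
  qed (use fin in auto)
  moreover have "0 \<le> \<tau>"
  proof -
    have "0 \<le> (\<Sum>j\<in>J. (x j)\<^sup>2)" by (intro sum_nonneg) auto
    then show ?thesis using s2 by simp
  qed
  ultimately show ?thesis using 1 2 by linarith
qed

text \<open>After rounding the eigenvalue, \<open>x\<close> on \<open>I\<close> extended by a
  multiple of the border coordinate is almost annihilated by the bordered matrix, so it is close to
  the window. If the window is not large, its coefficients are rounded, and \<kappa> bounds the
  total squared error of these two approximations.\<close>

lemma nogap_reduce:
  assumes V: "eigenvector_choice V" and B: "B \<subseteq> all_edges n" and nrm: "norm_ok n \<Lambda> B"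
    and e: "eig n B lam x" and x: "unit_norm n x" and lam: "\<bar>lam\<bar> \<le> \<Lambda>" "1 \<le> \<Lambda>" "\<Lambda> \<le> real n"
    and J: "J \<subseteq> {..<n}" and s2: "(\<Sum>j\<in>J. (x j)\<^sup>2) \<le> s2" and inc: "incompressible n t \<tau> x"
    and D: "1 \<le> D" and \<theta>: "0 < \<theta>" and t: "0 < t"
  defines "\<kappa> \<equiv> 2 * ((20 * \<Lambda>\<^sup>2 * s2 + 2 / D\<^sup>2) / \<theta>) + 2 * (real n + 1) / D\<^sup>2"
  assumes small: "s2 \<le> \<tau> / 8" "\<kappa> \<le> \<tau> / 8" "\<kappa> \<le> t\<^sup>2" "1 / D \<le> t" "\<tau> \<le> 1"
    and k: "(20 * \<Lambda>\<^sup>2 * s2 + 2 * \<Lambda>\<^sup>2 * \<kappa>) / t\<^sup>2 \<le> real k"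
  shows "\<exists>lam'\<in>grid1 D n. rich n \<theta> d J lam' B \<or> few n D \<theta> d k t \<tau> J lam' B"
proof -
  define I where "I = {..<n} - J"
  define \<beta> where "\<beta> = p * (\<Sum>j\<in>J. x j)"
  \<comment> \<open>The border column has entries \<open>sqrt n\<close>, so this coordinate
    reproduces the constant \<beta>; as \<beta>^2 is at most \<open>n\<close>, it is itself at most
    1 in absolute value.\<close>
  define X where "X a = (if a = n then \<beta> / sqrt n else x a)" for a
  let ?U = "insert n I"
  have Dpos: "0 < D" using D by simp
  have npos: "0 < real n" using lam by linarith
  have fin: "finite I" "finite J" and Isub: "I \<subseteq> {..<n}" and nI: "n \<notin> I" using J finite_subset by (auto simp: I_def)
  have x1: "\<bar>x i\<bar> \<le> 1" if "i < n" for i using unit_norm_le1[OF x that] .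
  have cI: "card I \<le> n" using card_mono[OF _ Isub] by simp
  have cJ: "card J \<le> n" using card_mono[OF _ J] by simp
  have xI: "(\<Sum>i\<in>I. (x i)\<^sup>2) \<le> 1" "(\<Sum>i\<in>J. (x i)\<^sup>2) \<le> 1"
  proof -
    have "(\<Sum>i\<in>I. (x i)\<^sup>2) \<le> (\<Sum>i<n. (x i)\<^sup>2)" using Isub by (intro sum_mono2) auto
    then show "(\<Sum>i\<in>I. (x i)\<^sup>2) \<le> 1" using x by (simp add: unit_norm_def)
    have "(\<Sum>i\<in>J. (x i)\<^sup>2) \<le> (\<Sum>i<n. (x i)\<^sup>2)" using J by (intro sum_mono2) auto
    then show "(\<Sum>i\<in>J. (x i)\<^sup>2) \<le> 1" using x by (simp add: unit_norm_def)
  qed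
  obtain lam' where lam': "lam' \<in> grid1 D n" "\<bar>lam - lam'\<bar> \<le> 1 / D"
    using grid1_round[OF Dpos, of lam n] lam by auto
  have split: "(\<Sum>r<n. (row_sum B I x r + \<beta> - of_bool (r \<in> I) * (lam * x r))\<^sup>2) \<le> 10 * \<Lambda>\<^sup>2 * s2"
  proof -
    have "(\<Sum>r<n. (row_sum B I x r + \<beta> - of_bool (r \<in> I) * (lam * x r))\<^sup>2) \<le> 10 * \<Lambda>\<^sup>2 * (\<Sum>j\<in>J. (x j)\<^sup>2)"
      unfolding I_def \<beta>_def by (rule eigenvector_split[OF B nrm e lam(1,2) J])
    also have "\<dots> \<le> 10 * \<Lambda>\<^sup>2 * s2" using s2 by (intro mult_left_mono) auto
    finally show ?thesis .
  qed
  have \<beta>n: "\<bar>\<beta>\<bar> \<le> real n"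
  proof -
    have "\<bar>\<Sum>j\<in>J. x j\<bar> \<le> card J" using J x1 fin by (intro abs_sum_le_card) auto
    then have "p * \<bar>\<Sum>j\<in>J. x j\<bar> \<le> 1 * real n" using p_pos p_less_1 cJ by (intro mult_mono) auto
    then show ?thesis using p_pos by (simp add: \<beta>_def abs_mult)
  qed
  have \<beta>2: "\<beta>\<^sup>2 \<le> real n"
  proof -
    have "(\<Sum>j\<in>J. x j)\<^sup>2 \<le> (\<Sum>j\<in>J. 1\<^sup>2) * (\<Sum>j\<in>J. (x j)\<^sup>2)"
      using Cauchy_Schwarz_ineq_sum[of "\<lambda>_. 1" x J] by simp
    also have "\<dots> \<le> real n * 1" using xI cJ by (intro mult_mono sum_nonneg) auto
    finally have "p\<^sup>2 * (\<Sum>j\<in>J. x j)\<^sup>2 \<le> 1 * real n"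
      using p_pos p_less_1 by (intro mult_mono) (auto simp: abs_square_le_1)
    then show ?thesis by (simp add: \<beta>_def power_mult_distrib)
  qed
  have X2: "(\<Sum>a\<in>?U. (X a)\<^sup>2) \<le> 2"
  proof -
    have "(\<Sum>a\<in>I. (X a)\<^sup>2) = (\<Sum>a\<in>I. (x a)\<^sup>2)" using nI by (intro sum.cong) (auto simp: X_def)
    moreover have "(X n)\<^sup>2 \<le> 1" using \<beta>2 npos by (simp add: X_def power_divide)
    ultimately show ?thesis using xI(1) fin nI by simp
  qed
  have qX: "qf I ?U (bordered n lam' B) X \<le> 20 * \<Lambda>\<^sup>2 * s2 + 2 / D\<^sup>2"
  proof -
    have row: "(\<Sum>a\<in>?U. bordered n lam' B r a * X a) = (row_sum B I x r + \<beta> - of_bool (r \<in> I) * (lam * x r)) + (lam - lam') * x r"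
      if r: "r \<in> I" for r
    proof -
      have "(\<Sum>a\<in>I. shifted lam' B r a * X a) = (\<Sum>a\<in>I. shifted lam' B r a * x a)"
        using nI by (intro sum.cong) (auto simp: X_def)
      also have "\<dots> = row_sum B I x r - lam' * x r" using r by (simp add: shifted_row[OF fin(1)])
      finally have 1: "(\<Sum>a\<in>I. shifted lam' B r a * X a) = row_sum B I x r - lam' * x r" .
      have 2: "sqrt n * X n = \<beta>" using npos by (simp add: X_def)
      show ?thesis unfolding bordered_restrict[OF Isub fin(1)] 1 2 using r by (simp add: left_diff_distrib)
    qed
    have "qf I ?U (bordered n lam' B) X = (\<Sum>r\<in>I. ((row_sum B I x r + \<beta> - of_bool (r \<in> I) * (lam * x r)) + (lam - lam') * x r)\<^sup>2)"
      unfolding qf_def using row by (intro sum.cong) auto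
    also have "\<dots> \<le> 2 * (\<Sum>r\<in>I. (row_sum B I x r + \<beta> - of_bool (r \<in> I) * (lam * x r))\<^sup>2) + 2 * (\<Sum>r\<in>I. ((lam - lam') * x r)\<^sup>2)"
      by (rule sum_sq_add_le)
    also have "(\<Sum>r\<in>I. (row_sum B I x r + \<beta> - of_bool (r \<in> I) * (lam * x r))\<^sup>2) \<le> 10 * \<Lambda>\<^sup>2 * s2"
      using Isub by (intro order_trans[OF sum_mono2 split]) auto
    also have "(\<Sum>r\<in>I. ((lam - lam') * x r)\<^sup>2) = (lam - lam')\<^sup>2 * (\<Sum>r\<in>I. (x r)\<^sup>2)"
      by (simp add: power_mult_distrib sum_distrib_left)
    also have "\<dots> \<le> (1 / D)\<^sup>2 * 1"
    proof (intro mult_mono sum_nonneg)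
      show "(lam - lam')\<^sup>2 \<le> (1 / D)\<^sup>2" using lam'(2) power_mono[of "\<bar>lam - lam'\<bar>" "1 / D" 2] by simp
    qed (use xI in auto)
    finally show ?thesis by (simp add: power_divide)
  qed
  obtain D0 v where Dv: "window_of I ?U (bordered n lam' B) \<theta> = (D0, v)" by fastforce
  have win: "window ?U I (bordered n lam' B) \<theta> D0 v"
    using window_of[OF V, of ?U \<theta> I "bordered n lam' B"] fin \<theta> Dv by simp
  show ?thesis
  proof (cases "d < card D0")
    case True
    then show ?thesis using rich_if_large_window[OF win I_def] lam'(1) by blast
  next
    case False
    have D0: "finite D0" and cD0: "card D0 \<le> n + 1" and orth: "\<And>i j. i \<in> D0 \<Longrightarrow> j \<in> D0 \<Longrightarrow> (\<Sum>a\<in>?U. v i a * v j a) = of_bool (i = j)"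
      using win cI fin nI by (auto simp: window_def)
    define c where "c i = (\<Sum>a\<in>?U. X a * v i a)" for i
    have c2: "\<bar>c i\<bar> \<le> real 2" if "i \<in> D0" for i
    proof -
      have "(c i)\<^sup>2 \<le> (\<Sum>a\<in>?U. (X a)\<^sup>2) * (\<Sum>a\<in>?U. (v i a)\<^sup>2)" unfolding c_def by (rule Cauchy_Schwarz_ineq_sum)
      also have "(\<Sum>a\<in>?U. (v i a)\<^sup>2) = 1" using orth[OF that that] by (simp add: power2_eq_square)
      finally have "(c i)\<^sup>2 \<le> 2\<^sup>2" using X2 by simp
      then show ?thesis using abs_le_square_iff[of "c i" 2] by simp
    qed
    obtain c' where c': "c' \<in> grid D0 D 2" "\<And>i. i \<in> D0 \<Longrightarrow> \<bar>c i - c' i\<bar> \<le> 1 / D"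
      "\<And>i. i \<in> D0 \<Longrightarrow> \<bar>c' i\<bar> \<le> \<bar>c i\<bar>"
      by (rule grid_round[of D D0 c 2, OF Dpos c2]) (assumption, rule that)
    define u where "u = comb D0 v c'"
    have close: "(\<Sum>a\<in>?U. (X a - u a)\<^sup>2) \<le> \<kappa>"
    proof -
      have "(\<Sum>a\<in>?U. (X a - u a)\<^sup>2) = (\<Sum>a\<in>?U. ((X a - comb D0 v c a) + comb D0 v (\<lambda>i. c i - c' i) a)\<^sup>2)"
      proof -
        have "X a - u a = (X a - comb D0 v c a) + comb D0 v (\<lambda>i. c i - c' i) a" for a
          unfolding u_def comb_def left_diff_distrib sum_subtractf by linarith
        then show ?thesis by (simp only:)
      qed
      also have "\<dots> \<le> 2 * (\<Sum>a\<in>?U. (X a - comb D0 v c a)\<^sup>2) + 2 * (\<Sum>a\<in>?U. (comb D0 v (\<lambda>i. c i - c' i) a)\<^sup>2)"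
        by (rule sum_sq_add_le)
      also have "(\<Sum>a\<in>?U. (X a - comb D0 v c a)\<^sup>2) \<le> (20 * \<Lambda>\<^sup>2 * s2 + 2 / D\<^sup>2) / \<theta>"
      proof -
        have "(\<Sum>a\<in>?U. (X a - comb D0 v (\<lambda>i. \<Sum>a\<in>?U. X a * v i a) a)\<^sup>2) * \<theta> \<le> qf I ?U (bordered n lam' B) X"
          using win unfolding window_def by blast
        then have "(\<Sum>a\<in>?U. (X a - comb D0 v c a)\<^sup>2) * \<theta> \<le> 20 * \<Lambda>\<^sup>2 * s2 + 2 / D\<^sup>2"
          using qX by (simp add: c_def[abs_def])
        then show ?thesis using \<theta> by (simp add: pos_le_divide_eq)
      qed
      also have "(\<Sum>a\<in>?U. (comb D0 v (\<lambda>i. c i - c' i) a)\<^sup>2) \<le> (real n + 1) / D\<^sup>2"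
      proof -
        have "(\<Sum>a\<in>?U. (comb D0 v (\<lambda>i. c i - c' i) a)\<^sup>2) = (\<Sum>i\<in>D0. (c i - c' i)\<^sup>2)" by (rule comb_norm[OF D0 orth])
        also have "\<dots> \<le> (\<Sum>i\<in>D0. (1 / D)\<^sup>2)"
        proof (rule sum_mono)
          fix i assume "i \<in> D0"
          then show "(c i - c' i)\<^sup>2 \<le> (1 / D)\<^sup>2" using c'(2) power_mono[of "\<bar>c i - c' i\<bar>" "1 / D" 2] by simp
        qed
        also have "\<dots> = card D0 * (1 / D\<^sup>2)" by (simp add: power_divide)
        also have "\<dots> \<le> (real n + 1) * (1 / D\<^sup>2)" using cD0 by (intro mult_right_mono) auto
        finally show ?thesis by simp
      qed
      finally show ?thesis by (simp add: \<kappa>_def)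
    qed
    have closeI: "(\<Sum>i\<in>I. (x i - u i)\<^sup>2) \<le> \<kappa>"
    proof -
      have "(\<Sum>i\<in>I. (x i - u i)\<^sup>2) = (\<Sum>i\<in>I. (X i - u i)\<^sup>2)" using nI by (intro sum.cong) (auto simp: X_def)
      also have "\<dots> \<le> (\<Sum>a\<in>?U. (X a - u a)\<^sup>2)" using fin by (intro sum_mono2) auto
      finally show ?thesis using close by simp
    qed
    have coord: "(x i - u i)\<^sup>2 \<le> \<kappa>" if "i \<in> I" for i
      using member_le_sum[of i I "\<lambda>i. (x i - u i)\<^sup>2"] that fin closeI by simp
    have coord_t: "\<bar>x i - u i\<bar> \<le> t" if "i \<in> I" for i
    proof -
      have "(x i - u i)\<^sup>2 \<le> t\<^sup>2" using coord[OF that] small(3) by linarith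
      then show ?thesis using abs_le_square_iff[of "x i - u i" t] t by simp
    qed
    have coord_1: "\<bar>u i - x i\<bar> \<le> 1" if "i \<in> I" for i
    proof -
      have "(u i - x i)\<^sup>2 \<le> 1" using coord[OF that] small(2,5) by (simp add: power2_commute)
      then show ?thesis by (simp add: abs_square_le_1)
    qed
    have inc': "\<tau> / 4 \<le> (\<Sum>i\<in>{i\<in>I. \<bar>u i\<bar> \<le> 2 * t}. (u i)\<^sup>2)"
      by (rule incompressible_transfer[OF I_def J inc]) (use s2 small closeI coord_t in auto)
    \<comment> \<open>Replacing \<open>x\<close> by \<open>u\<close> changes the rows in
      \<open>J\<close> by a centred part, controlled by the operator norm, and by a mean part that
      is the same in every row and is absorbed here.\<close>
    define \<gamma> where "\<gamma> = \<beta> - p * (\<Sum>i\<in>I. u i - x i)"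
    have "\<bar>\<gamma>\<bar> \<le> real (2 * n)"
    proof -
      have "\<bar>\<Sum>i\<in>I. u i - x i\<bar> \<le> card I" using fin coord_1 by (intro abs_sum_le_card) auto
      then have "p * \<bar>\<Sum>i\<in>I. u i - x i\<bar> \<le> 1 * real n" using p_pos p_less_1 cI by (intro mult_mono) auto
      then have "\<bar>p * (\<Sum>i\<in>I. u i - x i)\<bar> \<le> real n" using p_pos by (simp add: abs_mult)
      then show ?thesis using \<beta>n unfolding \<gamma>_def by simp
    qed
    then obtain \<gamma>' where \<gamma>': "\<gamma>' \<in> grid1 D (2 * n)" "\<bar>\<gamma> - \<gamma>'\<bar> \<le> 1 / D"
      using grid1_round[OF Dpos] by blast
    have rows: "(\<Sum>j\<in>J. (row_sum B I u j + \<gamma>)\<^sup>2) \<le> 20 * \<Lambda>\<^sup>2 * s2 + 2 * \<Lambda>\<^sup>2 * \<kappa>"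
    proof -
      define y where "y i = of_bool (i \<in> I) * (u i - x i)" for i
      have yI: "(\<Sum>i<n. f i * y i) = (\<Sum>i\<in>I. f i * (u i - x i))" for f
        unfolding y_def using Isub by (intro sum.mono_neutral_cong_right) auto
      have row: "row_sum B I u j + \<gamma> = (row_sum B I x j + \<beta> - of_bool (j \<in> I) * (lam * x j)) + (\<Sum>i<n. centered B j i * y i)"
        if j: "j \<in> J" for j
      proof -
        have jI: "j \<notin> I" using j by (auto simp: I_def)
        have "(\<Sum>i<n. centered B j i * y i) = (\<Sum>i\<in>I. centered B j i * (u i - x i))" by (rule yI)
        also have "\<dots> = (\<Sum>i\<in>I. (adj B j i - p) * (u i - x i))"
          using jI by (intro sum.cong) (auto simp: centered_def)
        also have "\<dots> = row_sum B I u j - row_sum B I x j - p * (\<Sum>i\<in>I. u i - x i)"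
          by (simp add: row_sum_def left_diff_distrib right_diff_distrib sum_subtractf sum_distrib_left)
        finally show ?thesis using jI by (simp add: \<gamma>_def)
      qed
      have "(\<Sum>j\<in>J. (row_sum B I u j + \<gamma>)\<^sup>2)
        = (\<Sum>j\<in>J. ((row_sum B I x j + \<beta> - of_bool (j \<in> I) * (lam * x j)) + (\<Sum>i<n. centered B j i * y i))\<^sup>2)"
        using row by (intro sum.cong) auto
      also have "\<dots> \<le> 2 * (\<Sum>j\<in>J. (row_sum B I x j + \<beta> - of_bool (j \<in> I) * (lam * x j))\<^sup>2) + 2 * (\<Sum>j\<in>J. (\<Sum>i<n. centered B j i * y i)\<^sup>2)"
        by (rule sum_sq_add_le)
      also have "(\<Sum>j\<in>J. (row_sum B I x j + \<beta> - of_bool (j \<in> I) * (lam * x j))\<^sup>2) \<le> 10 * \<Lambda>\<^sup>2 * s2"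
        using J by (intro order_trans[OF sum_mono2 split]) auto
      also have "(\<Sum>j\<in>J. (\<Sum>i<n. centered B j i * y i)\<^sup>2) \<le> (\<Sum>r<n. (\<Sum>i<n. centered B r i * y i)\<^sup>2)"
        using J by (intro sum_mono2) auto
      also have "\<dots> \<le> \<Lambda>\<^sup>2 * (\<Sum>i<n. (y i)\<^sup>2)" using nrm by (simp add: norm_ok_def)
      also have "(\<Sum>i<n. (y i)\<^sup>2) = (\<Sum>i\<in>I. (u i - x i)\<^sup>2)"
        unfolding y_def using Isub by (intro sum.mono_neutral_cong_right) auto
      also have "\<Lambda>\<^sup>2 * (\<Sum>i\<in>I. (u i - x i)\<^sup>2) \<le> \<Lambda>\<^sup>2 * \<kappa>"
        using closeI by (intro mult_left_mono) (auto simp: power2_commute)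
      finally show ?thesis by simp
    qed
    have "card {j\<in>J. 2 * t < \<bar>row_sum B I u j - (- \<gamma>')\<bar>} \<le> k"
    proof -
      have "card {j\<in>J. 2 * t < \<bar>row_sum B I u j - (- \<gamma>')\<bar>} \<le> card {j\<in>J. t < \<bar>row_sum B I u j + \<gamma>\<bar>}"
      proof (rule card_mono)
        have "t < \<bar>row_sum B I u j + \<gamma>\<bar>" if "2 * t < \<bar>row_sum B I u j - (- \<gamma>')\<bar>" for j
          using that \<gamma>'(2) small(4) by linarith
        then show "{j\<in>J. 2 * t < \<bar>row_sum B I u j - (- \<gamma>')\<bar>} \<subseteq> {j\<in>J. t < \<bar>row_sum B I u j + \<gamma>\<bar>}" by blast
      qed (use fin in auto)
      also have "real \<dots> \<le> (20 * \<Lambda>\<^sup>2 * s2 + 2 * \<Lambda>\<^sup>2 * \<kappa>) / t\<^sup>2"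
        by (rule card_large_le[OF fin(2) rows t])
      also have "\<dots> \<le> real k" by (rule k)
      finally show ?thesis by (simp only: of_nat_le_iff)
    qed
    then have "few n D \<theta> d k t \<tau> J lam' B"
      using False c'(1) \<gamma>'(1) inc'
      unfolding few_def Let_def I_def[symmetric] Dv prod.case u_def not_less by blast
    then show ?thesis using lam'(1) by blast
  qed
qed

text \<open>The edges between \<open>J\<close> and \<open>I\<close> are revealed last: the window
  and its net are then fixed, and the rows in \<open>J\<close> are independent. Threshold
  \<open>2 * t\<close> and mass \<open>\<tau> / 4\<close> turn the bound of
  \<open>small_ball_row\<close> into the stated \<open>\<rho>\<close>.\<close>

lemma few_prob:
  assumes V: "eigenvector_choice V" and J: "J \<subseteq> {..<n}" and t: "0 < t" and \<tau>: "0 < \<tau>" and \<theta>: "0 \<le> \<theta>"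
  defines "\<rho> \<equiv> 8 * t / sqrt (p * (1 - p) * \<tau>)"
  assumes \<rho>: "\<rho> \<le> 1"
  shows "Pr (all_edges n) (few n D \<theta> d k t \<tau> J lam)
    \<le> (4 * real D + 1) ^ d * ((4 * real n * real D + 1) * ((real n + 1) ^ k * \<rho> powr (real (card J) - real k)))"
    (is "_ \<le> ?rhs")
proof -
  define I where "I = {..<n} - J"
  define T where "T = (\<Union>j\<in>J. star j I)"
  define R where "R = (real n + 1) ^ k * \<rho> powr (real (card J) - real k)"
  have pq: "0 < p * (1 - p)" using p_pos p_less_1 by simp
  have fin: "finite I" "finite J" and Isub: "I \<subseteq> {..<n}" and IJ: "J \<inter> I = {}"
    using J finite_subset by (auto simp: I_def)
  have finT: "finite T" using fin by (auto simp: T_def)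
  have JI: "{..<n} - I = J" using J by (auto simp: I_def)
  have TS: "T \<subseteq> all_edges n" using stars_in_all_edges[OF Isub] unfolding JI T_def .
  have \<rho>0: "0 < \<rho>" unfolding \<rho>_def using t pq \<tau> by simp
  have R0: "0 \<le> R" by (simp add: R_def)
  have rhs: "?rhs = (4 * real D + 1) ^ d * ((4 * real n * real D + 1) * R)" by (simp add: R_def)
  have rhs0: "0 \<le> ?rhs" unfolding rhs using R0 by simp
  show ?thesis
  proof (rule Pr_cond_le[OF finite_all_edges TS])
    fix B assume B: "B \<subseteq> all_edges n - T"
    obtain D0 v where Dv: "window_of I (insert n I) (bordered n lam B) \<theta> = (D0, v)" by fastforce
    have win: "window (insert n I) I (bordered n lam B) \<theta> D0 v"
      using window_of[OF V, of "insert n I" \<theta> I "bordered n lam B"] fin \<theta> Dv by simp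
    then have finD0: "finite D0" by (simp add: window_def)
    define ok where "ok u \<longleftrightarrow> \<tau> / 4 \<le> (\<Sum>i\<in>{i\<in>I. \<bar>u i\<bar> \<le> 2 * t}. (u i)\<^sup>2)" for u :: "nat \<Rightarrow> real"
    define E where "E u \<gamma> C \<longleftrightarrow> card {j\<in>J. 2 * t < \<bar>row_sum C I u j - (- \<gamma>)\<bar>} \<le> k" for u \<gamma> C
    have jT: "j \<in> J \<Longrightarrow> i \<in> I \<Longrightarrow> {j, i} \<in> T" for i j by (auto simp: T_def star_def)
    have few: "few n D \<theta> d k t \<tau> J lam (B \<union> C) \<longleftrightarrow> card D0 \<le> d \<and>
       (\<exists>c\<in>grid D0 D 2. \<exists>\<gamma>\<in>grid1 D (2 * n). ok (comb D0 v c) \<and> E (comb D0 v c) \<gamma> C)" if C: "C \<subseteq> T" for C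
    proof -
      have "adj (B \<union> C) r a = adj B r a" if "r \<in> I" "a \<in> I" for r a
      proof -
        have "{r, a} \<notin> C"
        proof
          assume "{r, a} \<in> C"
          then have "{r, a} \<in> T" using C by blast
          then obtain j i where "j \<in> J" "{r, a} = {j, i}" by (auto simp: T_def star_def)
          then have "j \<in> {r, a}" by simp
          then show False using that IJ \<open>j \<in> J\<close> by auto
        qed
        then show ?thesis by (simp add: adj_def)
      qed
      then have w: "window_of I (insert n I) (bordered n lam (B \<union> C)) \<theta> = (D0, v)"
        unfolding Dv[symmetric] by (intro window_of_cong) (auto simp: bordered_def shifted_def)
      have "row_sum (B \<union> C) I u j = row_sum C I u j" if "j \<in> J" for j u
        unfolding row_sum_def adj_def using B jT[OF that] by (intro sum.cong) auto
      then have "{j\<in>J. 2 * t < \<bar>row_sum (B \<union> C) I u j - (- \<gamma>)\<bar>} = {j\<in>J. 2 * t < \<bar>row_sum C I u j - (- \<gamma>)\<bar>}" for u \<gamma>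
        by auto
      then show ?thesis unfolding few_def Let_def I_def[symmetric] w prod.case ok_def E_def by simp
    qed
    show "Pr T (\<lambda>C. few n D \<theta> d k t \<tau> J lam (B \<union> C)) \<le> ?rhs"
    proof (cases "card D0 \<le> d")
      case False
      have "Pr T (\<lambda>C. few n D \<theta> d k t \<tau> J lam (B \<union> C)) = Pr T (\<lambda>C. False)"
        using few False by (intro Pr_cong) auto
      also have "\<dots> = 0" by (simp add: Pr_def EV_def)
      finally show ?thesis using rhs0 by simp
    next
      case True
      have "Pr T (\<lambda>C. few n D \<theta> d k t \<tau> J lam (B \<union> C))
        = Pr T (\<lambda>C. \<exists>c\<in>grid D0 D 2. \<exists>\<gamma>\<in>grid1 D (2 * n). ok (comb D0 v c) \<and> E (comb D0 v c) \<gamma> C)"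
        using few True by (intro Pr_cong) auto
      also have "\<dots> \<le> real (card (grid D0 D 2)) * ((4 * real n * real D + 1) * R)"
      proof (rule Pr_Bex_le_card[OF finite_grid[OF finD0]])
        fix c
        define u where "u = comb D0 v c"
        have "Pr T (\<lambda>C. \<exists>\<gamma>\<in>grid1 D (2 * n). ok u \<and> E u \<gamma> C) \<le> real (card (grid1 D (2 * n))) * R"
        proof (rule Pr_Bex_le_card[OF finite_grid1])
          fix \<gamma>
          show "Pr T (\<lambda>C. ok u \<and> E u \<gamma> C) \<le> R"
          proof (cases "ok u")
            case False
            then show ?thesis using R0 by (simp add: Pr_def EV_def)
          next
            case True
            have row: "Pr (star j I) (\<lambda>C. \<bar>row_sum C I u j - a\<bar> \<le> 2 * t) \<le> \<rho>" if "j \<in> J" for j a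
            proof -
              let ?G = "{i\<in>I. \<bar>u i\<bar> \<le> 2 * t}"
              have pos: "0 < (\<Sum>i\<in>?G. (u i)\<^sup>2)" using True \<tau> by (simp add: ok_def)
              have "Pr (star j I) (\<lambda>C. \<bar>row_sum C I u j - a\<bar> \<le> 2 * t) \<le> 2 * (2 * t) / sqrt (p * (1 - p) * (\<Sum>i\<in>?G. (u i)\<^sup>2))"
                using that IJ fin t pos by (intro small_ball_row) auto
              also have "\<dots> \<le> 2 * (2 * t) / sqrt (p * (1 - p) * (\<tau> / 4))"
                using True pq \<tau> t pos unfolding ok_def
                by (intro divide_left_mono real_sqrt_le_mono mult_left_mono mult_pos_pos) auto
              also have "\<dots> = \<rho>" by (simp add: \<rho>_def real_sqrt_divide)
              finally show ?thesis .
            qed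
            have "Pr T (\<lambda>C. ok u \<and> E u \<gamma> C) = Pr T (E u \<gamma>)" using True by (intro Pr_cong) auto
            also have "\<dots> \<le> (real (card J) + 1) ^ k * \<rho> powr (real (card J) - real k)"
              unfolding E_def by (rule rows_most) (use fin finT IJ \<rho>0 \<rho> row in \<open>auto simp: T_def\<close>)
            also have "\<dots> \<le> R"
            proof -
              have "card J \<le> n" using card_mono[OF _ J] by simp
              then show ?thesis unfolding R_def by (intro mult_right_mono power_mono) auto
            qed
            finally show ?thesis .
          qed
        qed
        also have "\<dots> \<le> (4 * real n * real D + 1) * R"
        proof (rule mult_right_mono[OF _ R0])
          have "real (card (grid1 D (2 * n))) \<le> real (2 * (2 * n) * D + 1)" by (intro of_nat_mono card_grid1)
          then show "real (card (grid1 D (2 * n))) \<le> 4 * real n * real D + 1" by simp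
        qed
        finally show "Pr T (\<lambda>C. \<exists>\<gamma>\<in>grid1 D (2 * n). ok (comb D0 v c) \<and> E (comb D0 v c) \<gamma> C) \<le> (4 * real n * real D + 1) * R"
          by (simp only: u_def)
      qed
      also have "\<dots> \<le> (4 * real D + 1) ^ d * ((4 * real n * real D + 1) * R)"
      proof (rule mult_right_mono)
        have "card (grid D0 D 2) \<le> (2 * 2 * D + 1) ^ card D0" by (rule card_grid[OF finD0])
        also have "\<dots> \<le> (2 * 2 * D + 1) ^ d" using True by (intro power_increasing) auto
        finally have "real (card (grid D0 D 2)) \<le> real ((2 * 2 * D + 1) ^ d)" by (rule of_nat_mono)
        then show "real (card (grid D0 D 2)) \<le> (4 * real D + 1) ^ d" by (simp add: add.commute)
      qed (use R0 in auto)
      finally show ?thesis unfolding rhs .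
    qed
  qed
qed

end

section \<open>Interlacing, multiplicity and exchangeability\<close>

lemma adjacency_mat_eq: "adjacency_mat n B = sym_mat n (adj B)"
  by (simp add: adjacency_mat_def sym_mat_def adj_def of_bool_def)

definition ev :: "nat \<Rightarrow> nat set set \<Rightarrow> nat \<Rightarrow> real" where
  "ev n B i = ordered_eigenvalues (adjacency_mat n B) ! i"

definition eigvec :: "(real mat \<Rightarrow> nat \<Rightarrow> real Matrix.vec) \<Rightarrow> nat \<Rightarrow> nat set set \<Rightarrow> nat \<Rightarrow> nat \<Rightarrow> real" where
  "eigvec V n B i a = vec_index (V (adjacency_mat n B) i) a"

lemma eigvec_spectral:
  assumes V: "eigenvector_choice V"
  shows "spectral {..<n} (adj B) (eigvec V n B) (ev n B)"
    and "\<And>i j. i \<le> j \<Longrightarrow> j < n \<Longrightarrow> ev n B i \<le> ev n B j"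
proof -
  note S = spectral_sorted[OF V, of n "adj B", OF adj_commute, folded adjacency_mat_eq]
  show "spectral {..<n} (adj B) (eigvec V n B) (ev n B)"
    using S(1) by (simp add: eigvec_def[abs_def] ev_def[abs_def])
  show "ev n B i \<le> ev n B j" if "i \<le> j" "j < n" for i j
    unfolding ev_def using sorted_nth_mono[OF S(3) that(1)] S(2) that by simp
qed

lemma eigvec_eig:
  assumes V: "eigenvector_choice V" and i: "i < n"
  shows "eig n B (ev n B i) (eigvec V n B i)" "unit_norm n (eigvec V n B i)"
  using eigvec_spectral(1)[OF V, of n B] i
  by (auto simp: spectral_def eig_def unit_norm_def power2_eq_square)

lemma rayleigh:
  assumes sp: "spectral {..<n} S v \<mu>" and mono: "\<And>i j. i \<le> j \<Longrightarrow> j < n \<Longrightarrow> \<mu> i \<le> \<mu> j" and k: "k < n"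
  shows "(\<And>l. l < k \<Longrightarrow> (\<Sum>a<n. x a * v l a) = 0) \<Longrightarrow> \<mu> k * (\<Sum>a<n. (x a)\<^sup>2) \<le> (\<Sum>a<n. x a * (\<Sum>b<n. S a b * x b))"
    and "(\<And>l. k < l \<Longrightarrow> l < n \<Longrightarrow> (\<Sum>a<n. x a * v l a) = 0) \<Longrightarrow> (\<Sum>a<n. x a * (\<Sum>b<n. S a b * x b)) \<le> \<mu> k * (\<Sum>a<n. (x a)\<^sup>2)"
proof -
  define c where "c l = (\<Sum>a<n. x a * v l a)" for l
  have E2: "(\<Sum>a<n. (x a)\<^sup>2) = (\<Sum>l<n. (c l)\<^sup>2)"
    using spectral_expand(2)[OF sp finite_lessThan, of x x] by (simp add: c_def power2_eq_square)
  have E3: "(\<Sum>a<n. x a * (\<Sum>b<n. S a b * x b)) = (\<Sum>l<n. \<mu> l * (c l)\<^sup>2)"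
    using spectral_expand(3)[OF sp finite_lessThan, of x] by (simp add: c_def)
  show "\<mu> k * (\<Sum>a<n. (x a)\<^sup>2) \<le> (\<Sum>a<n. x a * (\<Sum>b<n. S a b * x b))" if z: "\<And>l. l < k \<Longrightarrow> (\<Sum>a<n. x a * v l a) = 0"
    unfolding E2 E3 unfolding sum_distrib_left
  proof (rule sum_mono)
    fix l assume "l \<in> {..<n}"
    show "\<mu> k * (c l)\<^sup>2 \<le> \<mu> l * (c l)\<^sup>2"
    proof (cases "l < k")
      case True then show ?thesis using z[of l] by (simp add: c_def)
    next
      case False then show ?thesis using mono[of k l] \<open>l \<in> {..<n}\<close> by (intro mult_right_mono) auto
    qed
  qed
  show "(\<Sum>a<n. x a * (\<Sum>b<n. S a b * x b)) \<le> \<mu> k * (\<Sum>a<n. (x a)\<^sup>2)" if z: "\<And>l. k < l \<Longrightarrow> l < n \<Longrightarrow> (\<Sum>a<n. x a * v l a) = 0"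
    unfolding E2 E3 unfolding sum_distrib_left
  proof (rule sum_mono)
    fix l assume "l \<in> {..<n}"
    show "\<mu> l * (c l)\<^sup>2 \<le> \<mu> k * (c l)\<^sup>2"
    proof (cases "k < l")
      case True then show ?thesis using z[of l] \<open>l \<in> {..<n}\<close> by (simp add: c_def)
    next
      case False then show ?thesis using mono[of l k] k by (intro mult_right_mono) auto
    qed
  qed
qed

lemma sum_pos_if_nonzero:
  fixes x :: "nat \<Rightarrow> real"
  assumes "finite I" "\<exists>a\<in>I. x a \<noteq> 0"
  shows "0 < (\<Sum>a\<in>I. (x a)\<^sup>2)"
  using assms by (auto intro: sum_pos2)

text \<open>In both cases the two eigenbases impose \<open>n - 1\<close> orthogonality conditions in
  total on the first \<open>n\<close> coordinates. A nonzero vector satisfying all of them, extended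
  by zero, has the same quadratic form in both graphs, and \<open>rayleigh\<close> bounds it from
  the two sides.\<close>

lemma interlacing:
  assumes V: "eigenvector_choice V" and k: "k < n"
  shows "ev (Suc n) B k \<le> ev n B k" "ev n B k \<le> ev (Suc n) B (Suc k)"
proof -
  define v where "v = eigvec V (Suc n) B"
  define w where "w = eigvec V n B"
  have nz: "ev (Suc n) B a \<le> ev n B b" if "m + m' < n"
    and v: "\<And>x. (\<And>l. l < m \<Longrightarrow> (\<Sum>i<Suc n. x i * v l i) = 0) \<Longrightarrow> ev (Suc n) B a * (\<Sum>i<Suc n. (x i)\<^sup>2) \<le> (\<Sum>i<Suc n. x i * (\<Sum>j<Suc n. adj B i j * x j))"
    and w: "\<And>x. (\<And>l. n - m' \<le> l \<Longrightarrow> l < n \<Longrightarrow> (\<Sum>i<n. x i * w l i) = 0) \<Longrightarrow> (\<Sum>i<n. x i * (\<Sum>j<n. adj B i j * x j)) \<le> ev n B b * (\<Sum>i<n. (x i)\<^sup>2)" for a b m m'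
  proof -
    define \<phi> where "\<phi> z = (case z of Inl l \<Rightarrow> v l | Inr l \<Rightarrow> w l)" for z :: "nat + nat"
    let ?Z = "{..<m} <+> {n - m'..<n}"
    have "finite ?Z" "card ?Z < card {..<n}" using that(1) by (auto simp: card_Plus)
    then obtain x where x: "\<exists>i\<in>{..<n}. x i \<noteq> 0" "\<And>z. z \<in> ?Z \<Longrightarrow> (\<Sum>i<n. \<phi> z i * x i) = 0"
      using nontrivial_solution[of "{..<n}" ?Z \<phi>] by blast
    define y where "y i = (if i < n then x i else 0)" for i
    have yw: "(\<Sum>i<Suc n. f i * y i) = (\<Sum>i<n. f i * x i)" for f
      by (simp add: y_def)
    have c1: "(\<Sum>i<Suc n. y i * v l i) = 0" if "l < m" for l
    proof -
      have "Inl l \<in> ?Z" using that by auto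
      then have "(\<Sum>i<n. v l i * x i) = 0" using x(2) by (fastforce simp: \<phi>_def)
      then show ?thesis using yw[of "v l"] by (simp add: mult.commute)
    qed
    have c2: "(\<Sum>i<n. x i * w l i) = 0" if "n - m' \<le> l" "l < n" for l
    proof -
      have "Inr l \<in> ?Z" using that by auto
      then have "(\<Sum>i<n. w l i * x i) = 0" using x(2) by (fastforce simp: \<phi>_def)
      then show ?thesis by (simp add: mult.commute)
    qed
    have nrm: "(\<Sum>i<Suc n. (y i)\<^sup>2) = (\<Sum>i<n. (x i)\<^sup>2)" by (simp add: y_def)
    have qf: "(\<Sum>i<Suc n. y i * (\<Sum>j<Suc n. adj B i j * y j)) = (\<Sum>i<n. x i * (\<Sum>j<n. adj B i j * x j))"
      unfolding yw by (simp add: y_def)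
    have "ev (Suc n) B a * (\<Sum>i<n. (x i)\<^sup>2) \<le> ev n B b * (\<Sum>i<n. (x i)\<^sup>2)"
      using v[of y, OF c1] w[of x, OF c2] unfolding nrm qf by linarith
    then show ?thesis using sum_pos_if_nonzero[OF _ x(1)] by simp
  qed
  show "ev (Suc n) B k \<le> ev n B k"
  proof (rule nz[of k "n - 1 - k"])
    show "ev (Suc n) B k * (\<Sum>i<Suc n. (x i)\<^sup>2) \<le> (\<Sum>i<Suc n. x i * (\<Sum>j<Suc n. adj B i j * x j))"
      if "\<And>l. l < k \<Longrightarrow> (\<Sum>i<Suc n. x i * v l i) = 0" for x
      using that k unfolding v_def by (intro rayleigh(1)[OF eigvec_spectral[OF V]]) auto
    show "(\<Sum>i<n. x i * (\<Sum>j<n. adj B i j * x j)) \<le> ev n B k * (\<Sum>i<n. (x i)\<^sup>2)"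
      if "\<And>l. n - (n - 1 - k) \<le> l \<Longrightarrow> l < n \<Longrightarrow> (\<Sum>i<n. x i * w l i) = 0" for x
      using that k unfolding w_def by (intro rayleigh(2)[OF eigvec_spectral[OF V]]) auto
  qed (use k in auto)
  show "ev n B k \<le> ev (Suc n) B (Suc k)"
  proof -
    define \<phi> where "\<phi> z = (case z of Inl l \<Rightarrow> v l | Inr l \<Rightarrow> w l)" for z :: "nat + nat"
    let ?Z = "{k + 2..<Suc n} <+> {..<k}"
    have "finite ?Z" "card ?Z < card {..<n}" using k by (auto simp: card_Plus)
    then obtain x where x: "\<exists>i\<in>{..<n}. x i \<noteq> 0" "\<And>z. z \<in> ?Z \<Longrightarrow> (\<Sum>i<n. \<phi> z i * x i) = 0"
      using nontrivial_solution[of "{..<n}" ?Z \<phi>] by blast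
    define y where "y i = (if i < n then x i else 0)" for i
    have yw: "(\<Sum>i<Suc n. f i * y i) = (\<Sum>i<n. f i * x i)" for f
      by (simp add: y_def)
    have c1: "(\<Sum>i<Suc n. y i * v l i) = 0" if "Suc k < l" "l < Suc n" for l
    proof -
      have "Inl l \<in> ?Z" using that by auto
      then have "(\<Sum>i<n. v l i * x i) = 0" using x(2) by (fastforce simp: \<phi>_def)
      then show ?thesis using yw[of "v l"] by (simp add: mult.commute)
    qed
    have c2: "(\<Sum>i<n. x i * w l i) = 0" if "l < k" for l
    proof -
      have "Inr l \<in> ?Z" using that by auto
      then have "(\<Sum>i<n. w l i * x i) = 0" using x(2) by (fastforce simp: \<phi>_def)
      then show ?thesis by (simp add: mult.commute)
    qed
    have nrm: "(\<Sum>i<Suc n. (y i)\<^sup>2) = (\<Sum>i<n. (x i)\<^sup>2)" by (simp add: y_def)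
    have qf: "(\<Sum>i<Suc n. y i * (\<Sum>j<Suc n. adj B i j * y j)) = (\<Sum>i<n. x i * (\<Sum>j<n. adj B i j * x j))"
      unfolding yw by (simp add: y_def)
    have "(\<Sum>i<Suc n. y i * (\<Sum>j<Suc n. adj B i j * y j)) \<le> ev (Suc n) B (Suc k) * (\<Sum>i<Suc n. (y i)\<^sup>2)"
      using c1 k unfolding v_def by (intro rayleigh(2)[OF eigvec_spectral[OF V]]) auto
    moreover have "ev n B k * (\<Sum>i<n. (x i)\<^sup>2) \<le> (\<Sum>i<n. x i * (\<Sum>j<n. adj B i j * x j))"
      using c2 k unfolding w_def by (intro rayleigh(1)[OF eigvec_spectral[OF V]]) auto
    ultimately have "ev n B k * (\<Sum>i<n. (x i)\<^sup>2) \<le> ev (Suc n) B (Suc k) * (\<Sum>i<n. (x i)\<^sup>2)"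
      unfolding nrm qf by linarith
    then show ?thesis using sum_pos_if_nonzero[OF _ x(1)] by simp
  qed
qed

section \<open>Multiple eigenvalues and the size of the eigenvalues\<close>

definition mult_ev :: "nat \<Rightarrow> nat set set \<Rightarrow> nat \<Rightarrow> bool" where
  "mult_ev n B i \<longleftrightarrow> (\<exists>k<n. k \<noteq> i \<and> ev n B k = ev n B i)"

lemma mult_ev_neighbour:
  assumes V: "eigenvector_choice V" and i: "i < n" and m: "mult_ev n B i"
  obtains k where "k = i \<or> Suc k = i" "Suc k < n" "ev n B k = ev n B i" "ev n B (Suc k) = ev n B i"
proof -
  note mono = eigvec_spectral(2)[OF V, of _ _ n B]
  obtain l where l: "l < n" "l \<noteq> i" "ev n B l = ev n B i" using m by (auto simp: mult_ev_def)
  show ?thesis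
  proof (cases "i < l")
    case True
    then have "ev n B i \<le> ev n B (Suc i)" "ev n B (Suc i) \<le> ev n B l" using mono[of i "Suc i"] mono[of "Suc i" l] l(1) by auto
    then show ?thesis using l True by (intro that[of i]) auto
  next
    case False
    then have li: "l < i" using l by simp
    then obtain k where k: "i = Suc k" by (cases i) auto
    have "ev n B l \<le> ev n B k" "ev n B k \<le> ev n B i" using mono[of l k] mono[of k i] li k i by auto
    then show ?thesis using l k i by (intro that[of k]) auto
  qed
qed

lemma simple_eigenvector_unique:
  assumes V: "eigenvector_choice V" and i: "i < n" and m: "\<not> mult_ev n B i"
    and e: "eig n B (ev n B i) x" and x: "unit_norm n x" and j: "j < n"
  shows "\<bar>x j\<bar> = \<bar>eigvec V n B i j\<bar>"
proof -
  define v where "v = eigvec V n B"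
  define c where "c l = (\<Sum>a<n. x a * v l a)" for l
  note sp = eigvec_spectral(1)[OF V, of n B, folded v_def]
  have c0: "c l = 0" if "l < n" "l \<noteq> i" for l
  proof -
    have "ev n B l * c l = (\<Sum>a<n. x a * (\<Sum>b<n. adj B a b * v l b))"
      using eigvec_eig(1)[OF V that(1), of B] unfolding c_def v_def
      by (simp add: eig_def sum_distrib_left mult_ac)
    also have "\<dots> = (\<Sum>b<n. (\<Sum>a<n. adj B b a * x a) * v l b)"
      unfolding sum_distrib_left sum_distrib_right
      by (subst sum.swap) (simp add: mult_ac adj_commute)
    also have "\<dots> = ev n B i * c l"
      using e by (simp add: eig_def c_def sum_distrib_left mult.assoc)
    finally have "(ev n B l - ev n B i) * c l = 0" by (simp add: left_diff_distrib)
    moreover have "ev n B l \<noteq> ev n B i" using m that by (auto simp: mult_ev_def)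
    ultimately show ?thesis by simp
  qed
  have pick: "(\<Sum>l<n. f (c l) l) = f (c i) i" if "\<And>l. f 0 l = 0" for f :: "real \<Rightarrow> nat \<Rightarrow> real"
  proof -
    have "(\<Sum>l<n. f (c l) l) = (\<Sum>l<n. if l = i then f (c l) l else 0)"
      using c0 that by (intro sum.cong) auto
    then show ?thesis using i by simp
  qed
  have "1 = (\<Sum>l<n. c l * c l)"
    using spectral_expand(2)[OF sp finite_lessThan, of x x] x by (simp add: c_def unit_norm_def power2_eq_square)
  then have "c i * c i = 1" using pick[of "\<lambda>t l. t * t"] by simp
  then have "\<bar>c i\<bar> = 1" by (metis abs_mult_self_eq abs_1 power2_eq_square power2_eq_1_iff abs_minus_cancel)
  moreover have "x j = c i * v i j"
    using spectral_expand(1)[OF sp finite_lessThan, of j x] j pick[of "\<lambda>t l. t * v l j"] by (simp add: c_def)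
  ultimately show ?thesis by (simp add: abs_mult v_def)
qed

context bernoulli_sets begin

text \<open>For the upper bound the test vector is orthogonal to the first \<open>i\<close>
  eigenvectors and to the all-ones vector, which kills the mean. These are \<open>i + 1\<close>
  conditions, and they need \<open>Suc i < n\<close>: the largest eigenvalue is out of reach. The
  lower bound holds because the mean part is nonnegative up to its diagonal correction.\<close>

lemma ev_bounded:
  assumes V: "eigenvector_choice V" and B: "B \<subseteq> all_edges n" and nrm: "norm_ok n \<Lambda> B" and \<Lambda>: "0 \<le> \<Lambda>" and i: "Suc i < n"
  shows "\<bar>ev n B i\<bar> \<le> \<Lambda> + 1"
proof -
  have no_loop: "adj B r r = 0" for r using B by (auto simp: adj_def all_edges_def)
  have Ax: "(\<Sum>a<n. x a * (\<Sum>b<n. adj B a b * x b)) = (\<Sum>a<n. x a * (\<Sum>b<n. centered B a b * x b)) + p * (\<Sum>a<n. x a)\<^sup>2 - p * (\<Sum>a<n. (x a)\<^sup>2)" for x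
  proof -
    have row: "(\<Sum>b<n. adj B a b * x b) = (\<Sum>b<n. centered B a b * x b) + p * (\<Sum>b<n. x b) - p * x a" if "a < n" for a
    proof -
      have "(\<Sum>b<n. centered B a b * x b) = (\<Sum>b<n. adj B a b * x b - (p * x b - (if b = a then p * x b else 0)))"
        by (intro sum.cong) (auto simp: centered_def left_diff_distrib)
      also have "\<dots> = (\<Sum>b<n. adj B a b * x b) - (p * (\<Sum>b<n. x b) - p * x a)"
        using that by (simp add: sum_subtractf sum_distrib_left)
      finally show ?thesis by simp
    qed
    have "(\<Sum>a<n. x a * (\<Sum>b<n. adj B a b * x b))
       = (\<Sum>a<n. x a * ((\<Sum>b<n. centered B a b * x b) + p * (\<Sum>b<n. x b) - p * x a))"
      using row by (intro sum.cong) auto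
    also have "\<dots> = (\<Sum>a<n. x a * (\<Sum>b<n. centered B a b * x b)) + (\<Sum>a<n. x a) * (p * (\<Sum>b<n. x b)) - p * (\<Sum>a<n. (x a)\<^sup>2)"
      unfolding sum_distrib_right[of _ "{..<n}" "p * (\<Sum>b<n. x b)"] sum_distrib_left[of p "\<lambda>a. (x a)\<^sup>2"] sum.distrib[symmetric] sum_subtractf[symmetric]
      by (intro sum.cong) (auto simp: algebra_simps power2_eq_square)
    finally show ?thesis by (simp add: power2_eq_square mult_ac)
  qed
  have cen: "\<bar>\<Sum>a<n. x a * (\<Sum>b<n. centered B a b * x b)\<bar> \<le> \<Lambda> * (\<Sum>a<n. (x a)\<^sup>2)" for x
  proof -
    let ?s = "\<Sum>a<n. (x a)\<^sup>2"
    have s0: "0 \<le> ?s" by (intro sum_nonneg) auto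
    have "(\<Sum>a<n. x a * (\<Sum>b<n. centered B a b * x b))\<^sup>2 \<le> ?s * (\<Sum>a<n. (\<Sum>b<n. centered B a b * x b)\<^sup>2)"
      by (rule Cauchy_Schwarz_ineq_sum)
    also have "\<dots> \<le> ?s * (\<Lambda>\<^sup>2 * ?s)" using nrm s0 unfolding norm_ok_def by (intro mult_left_mono) auto
    also have "\<dots> = (\<Lambda> * ?s)\<^sup>2" by (simp add: power2_eq_square)
    finally show ?thesis using \<Lambda> s0 abs_le_square_iff[of _ "\<Lambda> * ?s"] by (simp add: abs_mult)
  qed
  define v where "v = eigvec V n B"
  have i': "i < n" using i by simp
  have lower: "- (\<Lambda> + 1) \<le> ev n B i"
  proof -
    have u: "(\<Sum>a<n. (v i a)\<^sup>2) = 1" and e: "eig n B (ev n B i) (v i)"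
      using eigvec_eig[OF V i', of B] by (auto simp: v_def unit_norm_def)
    have "(\<Sum>a<n. v i a * (\<Sum>b<n. adj B a b * v i b)) = ev n B i * (\<Sum>a<n. (v i a)\<^sup>2)"
      using e by (simp add: eig_def sum_distrib_left power2_eq_square mult_ac)
    moreover have "0 \<le> p * (\<Sum>a<n. v i a)\<^sup>2" using p_pos by simp
    ultimately show ?thesis using Ax[of "v i"] cen[of "v i"] u p_less_1 by simp
  qed
  moreover have "ev n B i \<le> \<Lambda> + 1"
  proof -
    define \<phi> where "\<phi> z = (case z of None \<Rightarrow> (\<lambda>_. 1) | Some l \<Rightarrow> v l)" for z
    let ?Z = "insert None (Some ` {..<i})"
    have "finite ?Z" "card ?Z < card {..<n}" using i by (auto simp: card_image card_insert_if)
    then obtain x where x: "\<exists>i\<in>{..<n}. x i \<noteq> 0" "\<And>z. z \<in> ?Z \<Longrightarrow> (\<Sum>i<n. \<phi> z i * x i) = 0"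
      using nontrivial_solution[of "{..<n}" ?Z \<phi>] by blast
    have x0: "(\<Sum>a<n. x a) = 0" using x(2)[of None] by (simp add: \<phi>_def)
    have xl: "(\<Sum>a<n. x a * v l a) = 0" if "l < i" for l
      using x(2)[of "Some l"] that by (simp add: \<phi>_def mult.commute)
    have s: "0 < (\<Sum>a<n. (x a)\<^sup>2)" by (rule sum_pos_if_nonzero[OF _ x(1)]) simp
    have "ev n B i * (\<Sum>a<n. (x a)\<^sup>2) \<le> (\<Sum>a<n. x a * (\<Sum>b<n. adj B a b * x b))"
      using xl i' unfolding v_def by (intro rayleigh(1)[OF eigvec_spectral[OF V]]) auto
    also have "\<dots> = (\<Sum>a<n. x a * (\<Sum>b<n. centered B a b * x b)) - p * (\<Sum>a<n. (x a)\<^sup>2)" using Ax[of x] x0 by simp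
    also have "\<dots> \<le> \<Lambda> * (\<Sum>a<n. (x a)\<^sup>2)"
    proof -
      have "0 \<le> p * (\<Sum>a<n. (x a)\<^sup>2)" using p_pos s by simp
      then show ?thesis using abs_le_D1[OF cen[of x]] by linarith
    qed
    finally have "ev n B i \<le> \<Lambda>" using s by simp
    then show ?thesis by simp
  qed
  ultimately show ?thesis by simp
qed

end

text \<open>The relabelled eigenvectors diagonalise the relabelled matrix with the same eigenvalues,
  and the sorted spectrum is determined by any orthonormal eigenbasis.\<close>

lemma ev_relabel:
  assumes V: "eigenvector_choice V" and \<tau>: "bij_betw \<tau> {..<n} {..<n}" "inj \<tau>"
  shows "ev n ((`) \<tau> ` B) i = ev n B i"
proof -
  let ?B' = "(`) \<tau> ` B"
  have adj': "adj ?B' (\<tau> a) (\<tau> b) = adj B a b" for a b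
  proof -
    have "{\<tau> a, \<tau> b} = \<tau> ` {a, b}" by simp
    moreover have "\<tau> ` {a, b} \<in> (`) \<tau> ` B \<longleftrightarrow> {a, b} \<in> B"
      using inj_image_mem_iff[OF inj_image_eq_iff[OF \<tau>(2), THEN iffD1, THEN injI]] by blast
    ultimately show ?thesis by (simp add: adj_def)
  qed
  define \<sigma> where "\<sigma> = the_inv_into {..<n} \<tau>"
  have \<sigma>: "bij_betw \<sigma> {..<n} {..<n}" unfolding \<sigma>_def by (rule bij_betw_the_inv_into[OF \<tau>(1)])
  have \<tau>\<sigma>: "\<tau> (\<sigma> a) = a" if "a < n" for a
    unfolding \<sigma>_def using \<tau>(1) that by (intro f_the_inv_into_f_bij_betw) auto
  have \<sigma>n: "\<sigma> a < n" if "a < n" for a using \<sigma> that by (auto simp: bij_betw_def)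
  have adj'': "adj ?B' a b = adj B (\<sigma> a) (\<sigma> b)" if "a < n" "b < n" for a b
    using adj'[of "\<sigma> a" "\<sigma> b"] \<tau>\<sigma> that by simp
  define v where "v = eigvec V n B"
  have reidx: "(\<Sum>a<n. f (\<sigma> a)) = (\<Sum>a<n. f a)" for f :: "nat \<Rightarrow> real"
    by (rule sum.reindex_bij_betw[OF \<sigma>])
  note sp = eigvec_spectral(1)[OF V, of n B, folded v_def]
  have M: "adjacency_mat n ?B' \<in> carrier_mat n n" "adjacency_mat n B \<in> carrier_mat n n" by (auto simp: adjacency_mat_def)
  have "mset (ordered_eigenvalues (adjacency_mat n ?B')) = mset (map (ev n B) [0..<n])"
  proof (rule ordered_eigenvalues_unique(1)[OF M(1), of "\<lambda>i a. v i (\<sigma> a)"])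
    show "(\<Sum>a<n. v i (\<sigma> a) * v j (\<sigma> a)) = of_bool (i = j)" if "i < n" "j < n" for i j
      using reidx[of "\<lambda>a. v i a * v j a"] sp that by (simp add: spectral_def)
    show "(\<Sum>b<n. adjacency_mat n ?B' $$ (a, b) * v i (\<sigma> b)) = ev n B i * v i (\<sigma> a)" if "i < n" "a < n" for i a
    proof -
      have "(\<Sum>b<n. adjacency_mat n ?B' $$ (a, b) * v i (\<sigma> b)) = (\<Sum>b<n. adj B (\<sigma> a) (\<sigma> b) * v i (\<sigma> b))"
        using that by (intro sum.cong) (auto simp: adjacency_mat_eq sym_mat_def adj'')
      also have "\<dots> = (\<Sum>b<n. adj B (\<sigma> a) b * v i b)" by (rule reidx[of "\<lambda>b. adj B (\<sigma> a) b * v i b"])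
      also have "\<dots> = ev n B i * v i (\<sigma> a)" using sp that \<sigma>n by (simp add: spectral_def)
      finally show ?thesis .
    qed
  qed
  also have "\<dots> = mset (ordered_eigenvalues (adjacency_mat n B))"
  proof (rule ordered_eigenvalues_unique(1)[OF M(2), of v, symmetric])
    show "(\<Sum>b<n. adjacency_mat n B $$ (a, b) * v i b) = ev n B i * v i a" if "i < n" "a < n" for i a
      using sp that by (simp add: spectral_def adjacency_mat_eq sym_mat_def)
  qed (use sp in \<open>auto simp: spectral_def\<close>)
  finally have "ordered_eigenvalues (adjacency_mat n ?B') = ordered_eigenvalues (adjacency_mat n B)"
    by (simp add: ordered_eigenvalues_def)
  then show ?thesis by (simp add: ev_def)
qed

text \<open>Quantifying over all unit eigenvectors of the \<open>i\<close>-th eigenvalue, rather than using the chosen one, makes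
  the events invariant under relabelling of the vertices.\<close>

definition small_at :: "nat \<Rightarrow> nat \<Rightarrow> real \<Rightarrow> nat \<Rightarrow> nat set set \<Rightarrow> bool" where
  "small_at n i s j B \<longleftrightarrow> (\<exists>x. unit_norm n x \<and> eig n B (ev n B i) x \<and> \<bar>x j\<bar> \<le> s)"

definition mult_at :: "nat \<Rightarrow> nat \<Rightarrow> nat \<Rightarrow> nat set set \<Rightarrow> bool" where
  "mult_at n i j B \<longleftrightarrow> mult_ev n B i \<and> (\<exists>x. unit_norm n x \<and> eig n B (ev n B i) x \<and> x j \<noteq> 0)"

lemma eig_relabel:
  assumes \<tau>: "bij_betw \<tau> {..<n} {..<n}" "inj \<tau>" and e: "eig n ((`) \<tau> ` B) lam x"
  shows "eig n B lam (\<lambda>a. x (\<tau> a))" 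
  unfolding eig_def
proof (intro allI impI)
  fix r assume r: "r < n"
  have adj': "adj ((`) \<tau> ` B) (\<tau> a) (\<tau> b) = adj B a b" for a b
  proof -
    have "{\<tau> a, \<tau> b} = \<tau> ` {a, b}" by simp
    moreover have "\<tau> ` {a, b} \<in> (`) \<tau> ` B \<longleftrightarrow> {a, b} \<in> B"
      using inj_image_mem_iff[OF inj_image_eq_iff[OF \<tau>(2), THEN iffD1, THEN injI]] by blast
    ultimately show ?thesis by (simp add: adj_def)
  qed
  have "\<tau> r < n" using \<tau>(1) r by (auto simp: bij_betw_def)
  then have "(\<Sum>i<n. adj ((`) \<tau> ` B) (\<tau> r) i * x i) = lam * x (\<tau> r)" using e by (simp add: eig_def)
  moreover have "(\<Sum>i<n. adj ((`) \<tau> ` B) (\<tau> r) i * x i) = (\<Sum>i<n. adj ((`) \<tau> ` B) (\<tau> r) (\<tau> i) * x (\<tau> i))"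
    by (rule sum.reindex_bij_betw[OF \<tau>(1), symmetric])
  ultimately show "(\<Sum>i<n. adj B r i * x (\<tau> i)) = lam * x (\<tau> r)" by (simp add: adj')
qed

lemma relabel_transfer:
  assumes V: "eigenvector_choice V" and jn: "j < n" "k < n"
  defines "\<tau> \<equiv> Transposition.transpose j k"
  shows "small_at n i s k ((`) \<tau> ` B) \<Longrightarrow> small_at n i s j B" "mult_at n i k ((`) \<tau> ` B) \<Longrightarrow> mult_at n i j B"
proof -
  have b: "bij_betw \<tau> {..<n} {..<n}"
    unfolding \<tau>_def using jn by (auto simp: bij_betw_def image_def inj_on_def Transposition.transpose_def split: if_splits)
  have inj: "inj \<tau>" unfolding \<tau>_def by (rule inj_transpose)
  have \<tau>j: "\<tau> j = k" by (simp add: \<tau>_def)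
  have unit: "unit_norm n (\<lambda>a. x (\<tau> a))" if "unit_norm n x" for x
    using that sum.reindex_bij_betw[OF b, of "\<lambda>a. (x a)\<^sup>2"] by (simp add: unit_norm_def)
  note ev = ev_relabel[OF V b inj]
  show "small_at n i s j B" if h: "small_at n i s k ((`) \<tau> ` B)"
  proof -
    obtain x where x: "unit_norm n x" "eig n ((`) \<tau> ` B) (ev n B i) x" "\<bar>x k\<bar> \<le> s"
      using h unfolding small_at_def ev by blast
    show ?thesis unfolding small_at_def
      by (rule exI[of _ "\<lambda>a. x (\<tau> a)"]) (use x unit eig_relabel[OF b inj] \<tau>j in auto)
  qed
  show "mult_at n i j B" if h: "mult_at n i k ((`) \<tau> ` B)"
  proof -
    obtain x where x: "unit_norm n x" "eig n ((`) \<tau> ` B) (ev n B i) x" "x k \<noteq> 0" and m: "mult_ev n B i"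
      using h unfolding mult_at_def mult_ev_def ev by blast
    show ?thesis unfolding mult_at_def
      by (intro conjI m exI[of _ "\<lambda>a. x (\<tau> a)"]) (use x unit eig_relabel[OF b inj] \<tau>j in auto)
  qed
qed

section \<open>Exchangeability and the probability of a small coordinate\<close>

context bernoulli_sets begin

text \<open>A transposition of vertices permutes the edges, and the weights in \<open>EV\<close>
  depend only on cardinalities.\<close>

lemma Pr_exchange_le:
  assumes jn: "j < n" "k < n" and PQ: "\<And>B. P ((`) (Transposition.transpose j k) ` B) \<Longrightarrow> Q B"
  shows "Pr (all_edges n) P \<le> Pr (all_edges n) Q"
proof -
  let ?\<tau> = "Transposition.transpose j k"
  have inj: "inj ((`) ?\<tau>)" by (rule injI) (simp only: inj_image_eq_iff[OF inj_transpose])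
  have sub: "(`) ?\<tau> ` all_edges n \<subseteq> all_edges n"
  proof
    fix e assume "e \<in> (`) ?\<tau> ` all_edges n"
    then obtain e' where e: "e = ?\<tau> ` e'" "e' \<subseteq> {..<n}" "card e' = 2" by (auto simp: all_edges_def)
    have "e \<subseteq> {..<n}" using e(1,2) jn by (auto simp: Transposition.transpose_def)
    moreover have "card e = 2" unfolding e(1) using e(3) card_image[OF inj_on_subset[OF inj_transpose[of j k] subset_UNIV], of e'] by simp
    ultimately show "e \<in> all_edges n" by (simp add: all_edges_def)
  qed
  have "bij_betw ((`) ?\<tau>) (all_edges n) (all_edges n)"
    using inj sub finite_all_edges[of n] by (intro bij_betw_imageI endo_inj_surj) (auto intro: inj_on_subset)
  then have "Pr (all_edges n) P = Pr (all_edges n) (\<lambda>B. P ((`) ?\<tau> ` B))"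
    unfolding Pr_def by (rule EV_reindex)
  also have "\<dots> \<le> Pr (all_edges n) Q" by (rule Pr_mono) (rule PQ)
  finally show ?thesis .
qed

text \<open>The norm bound is \<open>\<Lambda> - 1\<close> because \<open>ev_bounded\<close> adds 1:
  all eigenvalues except the largest then lie in the range covered by the second clause.\<close>

definition good :: "nat \<Rightarrow> real \<Rightarrow> real \<Rightarrow> real \<Rightarrow> real \<Rightarrow> nat \<Rightarrow> nat set set \<Rightarrow> bool" where
  "good n \<Lambda> t \<tau> s m B \<longleftrightarrow> norm_ok n (\<Lambda> - 1) B \<and>
     (\<forall>lam x. \<bar>lam\<bar> \<le> \<Lambda> \<longrightarrow> unit_norm n x \<longrightarrow> eig n B lam x \<longrightarrow>
        incompressible n t \<tau> x \<and> card {j. j < n \<and> \<bar>x j\<bar> \<le> s} \<le> m)"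

lemma mult_at_last_le:
  fixes s :: real and m :: nat
  assumes V: "eigenvector_choice V" and \<Lambda>: "1 \<le> \<Lambda>" and t: "0 < t" and \<tau>: "0 < \<tau>" and i: "i < n"
  defines "bad \<equiv> Pr (all_edges (Suc n)) (\<lambda>B. \<not> good (Suc n) \<Lambda> t \<tau> s m B)"
  shows "Pr (all_edges (Suc n)) (mult_at (Suc n) i n) \<le> bad + 2 * (2 * t / sqrt (p * (1 - p) * \<tau>))"
proof -
  let ?S = "all_edges (Suc n)"
  define p0 where "p0 = 2 * t / sqrt (p * (1 - p) * \<tau>)"
  have pq: "0 < p * (1 - p)" using p_pos p_less_1 by simp
  have p00: "0 \<le> p0" using t pq \<tau> by (simp add: p0_def)
  define E where "E k B \<longleftrightarrow> \<tau> \<le> (\<Sum>a\<in>{a. a < n \<and> \<bar>eigvec V n B k a\<bar> \<le> t}. (eigvec V n B k a)\<^sup>2)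
     \<and> row_sum B {..<n} (eigvec V n B k) n = 0" for k B
  have "Pr ?S (mult_at (Suc n) i n) \<le> Pr ?S (\<lambda>B. \<not> good (Suc n) \<Lambda> t \<tau> s m B \<or> (E i B \<or> E (i - 1) B))"
  proof (rule Pr_mono)
    fix B assume B: "B \<subseteq> ?S" and H: "mult_at (Suc n) i n B"
    show "\<not> good (Suc n) \<Lambda> t \<tau> s m B \<or> (E i B \<or> E (i - 1) B)"
    proof (rule disjCI)
      assume "\<not> (E i B \<or> E (i - 1) B)"
      show "\<not> good (Suc n) \<Lambda> t \<tau> s m B"
      proof
        assume g: "good (Suc n) \<Lambda> t \<tau> s m B"
        define l where "l = ev (Suc n) B i"
        obtain x where m: "mult_ev (Suc n) B i" and x: "eig (Suc n) B l x" "x n \<noteq> 0"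
          using H by (auto simp: mult_at_def l_def)
        obtain k where k: "k = i \<or> Suc k = i" "Suc k < Suc n" "ev (Suc n) B k = l" "ev (Suc n) B (Suc k) = l"
          using mult_ev_neighbour[OF V _ m] i unfolding l_def by (metis less_SucI)
        have kn: "k < n" using k by simp
        have ek: "ev n B k = l" using interlacing[OF V kn, of B] k by simp
        define w where "w = eigvec V n B k"
        have w: "eig n B l w" "unit_norm n w" using eigvec_eig[OF V kn, of B] ek by (auto simp: w_def)
        have no_loop: "adj B n n = 0" using B by (auto simp: adj_def all_edges_def)
        have rowx: "(\<Sum>b<n. adj B a b * x b) = l * x a - adj B n a * x n" if "a < n" for a
        proof -
          have "(\<Sum>b<Suc n. adj B a b * x b) = l * x a" using x(1) that unfolding eig_def by auto
          then show ?thesis by (simp add: adj_commute[of B a n])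
        qed
        \<comment> \<open>The eigenvector equation of \<open>x\<close>, restricted to the first
          \<open>n\<close> rows, is paired with \<open>w\<close>. Both have the eigenvalue
          \<open>l\<close>, so everything cancels except \<open>x n\<close> times the product of the
          last column with \<open>w\<close>.\<close>
        have "(\<Sum>a<n. w a * (\<Sum>b<n. adj B a b * x b)) = (\<Sum>b<n. (\<Sum>a<n. adj B b a * w a) * x b)"
          unfolding sum_distrib_left sum_distrib_right
          by (subst sum.swap) (simp add: mult_ac adj_commute)
        also have "\<dots> = (\<Sum>b<n. l * w b * x b)" using w(1) by (simp add: eig_def)
        finally have 1: "(\<Sum>a<n. w a * (\<Sum>b<n. adj B a b * x b)) = (\<Sum>b<n. l * w b * x b)" .
        have "(\<Sum>a<n. w a * (\<Sum>b<n. adj B a b * x b)) = (\<Sum>a<n. w a * (l * x a - adj B n a * x n))"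
          using rowx by (intro sum.cong) auto
        also have "\<dots> = (\<Sum>b<n. l * w b * x b) - row_sum B {..<n} w n * x n"
          by (simp add: row_sum_def right_diff_distrib sum_subtractf sum_distrib_left sum_distrib_right mult_ac)
        finally have "row_sum B {..<n} w n * x n = 0" using 1 by simp
        then have row0: "row_sum B {..<n} w n = 0" using x(2) by simp
        \<comment> \<open>As the last row is orthogonal to \<open>w\<close>, extension by zero makes
          \<open>w\<close> an eigenvector of the larger graph. Its incompressibility thus comes from
          \<open>good\<close> for \<open>Suc n\<close> vertices, with no estimate on the smaller
          graph.\<close>
        define y where "y a = (if a < n then w a else 0)" for a
        have ysum: "(\<Sum>b<Suc n. f b * y b) = (\<Sum>b<n. f b * w b)" for f by (simp add: y_def)
        have "eig (Suc n) B l y" unfolding eig_def ysum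
        proof (intro allI impI)
          fix r assume "r < Suc n"
          then consider "r < n" | "r = n" by linarith
          then show "(\<Sum>b<n. adj B r b * w b) = l * y r"
          proof cases
            case 1 then show ?thesis using w(1) by (simp add: eig_def y_def)
          next
            case 2 then show ?thesis using row0 by (simp add: row_sum_def y_def)
          qed
        qed
        moreover have "unit_norm (Suc n) y" using w(2) by (simp add: unit_norm_def y_def)
        moreover have "\<bar>l\<bar> \<le> \<Lambda>"
          using ev_bounded[OF V B _ _ , of "\<Lambda> - 1" i] g i \<Lambda> by (simp add: l_def good_def)
        ultimately have "incompressible (Suc n) t \<tau> y" using g unfolding good_def by blast
        then have "\<tau> \<le> (\<Sum>a\<in>{a. a < Suc n \<and> \<bar>y a\<bar> \<le> t}. (y a)\<^sup>2)" by (simp add: incompressible_def)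
        also have "\<dots> = (\<Sum>a\<in>{a. a < n \<and> \<bar>w a\<bar> \<le> t}. (w a)\<^sup>2)"
          by (rule sum.mono_neutral_cong_right) (auto simp: y_def less_Suc_eq)
        finally have "E k B" using row0 by (simp add: E_def w_def)
        moreover have "k = i \<or> k = i - 1" using k(1) by auto
        ultimately show False using \<open>\<not> (E i B \<or> E (i - 1) B)\<close> by auto
      qed
    qed
  qed
  also have "\<dots> \<le> bad + Pr ?S (\<lambda>B. E i B \<or> E (i - 1) B)" unfolding bad_def by (rule Pr_disj_le)
  also have "\<dots> \<le> bad + (Pr ?S (E i) + Pr ?S (E (i - 1)))" by (intro add_left_mono Pr_disj_le)
  also have "\<dots> \<le> bad + (p0 + p0)"
  proof -
    \<comment> \<open>The vector in \<open>E k\<close> belongs to the graph on the first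
      \<open>n\<close> vertices and is unaffected by the star of \<open>n\<close>, so it is fixed
      while that star is random.\<close>
    have "Pr ?S (E k) \<le> p0" for k
    proof (rule Pr_cond_le[OF finite_all_edges, of "star n {..<n}"])
      show "star n {..<n} \<subseteq> ?S" by (auto simp: star_def all_edges_def card_insert_if)
      fix B assume B: "B \<subseteq> ?S - star n {..<n}"
      define w where "w = eigvec V n B k"
      have "adjacency_mat n (B \<union> C) = adjacency_mat n B" if "C \<subseteq> star n {..<n}" for C
        unfolding adjacency_mat_def using that
        by (intro eq_matI) (auto simp: star_def doubleton_eq_iff subset_iff)
      then have wC: "eigvec V n (B \<union> C) k = w" if "C \<subseteq> star n {..<n}" for C
        using that by (simp add: eigvec_def[abs_def] w_def)
      have rC: "row_sum (B \<union> C) {..<n} u n = row_sum C {..<n} u n" for C u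
        unfolding row_sum_def adj_def using B by (intro sum.cong) (auto simp: star_def)
      let ?G = "{a. a < n \<and> \<bar>w a\<bar> \<le> t}"
      show "Pr (star n {..<n}) (\<lambda>C. E k (B \<union> C)) \<le> p0"
      proof (cases "\<tau> \<le> (\<Sum>a\<in>?G. (w a)\<^sup>2)")
        case True
        have "Pr (star n {..<n}) (\<lambda>C. E k (B \<union> C)) \<le> Pr (star n {..<n}) (\<lambda>C. \<bar>row_sum C {..<n} w n - 0\<bar> \<le> t)"
          using t by (intro Pr_mono) (auto simp: E_def wC rC)
        also have "\<dots> \<le> 2 * t / sqrt (p * (1 - p) * (\<Sum>a\<in>?G. (w a)\<^sup>2))"
          using True \<tau> t by (intro small_ball_row) auto
        also have "\<dots> \<le> p0" unfolding p0_def
          using True pq \<tau> t by (intro divide_left_mono real_sqrt_le_mono mult_left_mono mult_pos_pos) auto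
        finally show ?thesis .
      next
        case False
        then have "Pr (star n {..<n}) (\<lambda>C. E k (B \<union> C)) = Pr (star n {..<n}) (\<lambda>C. False)"
          by (intro Pr_cong) (auto simp: E_def wC)
        also have "\<dots> = 0" by (simp add: Pr_def EV_def)
        finally show ?thesis using p00 by simp
      qed
    qed
    then show ?thesis by (intro add_left_mono add_mono)
  qed
  finally show ?thesis by (simp add: p0_def)
qed

text \<open>If the eigenvalue is multiple and the graph is good, at least half of the coordinates of
  its eigenvector are nonzero; averaging over vertices gives \<open>M \<le> bad + 2 * H\<close>. A
  second average over vertices yields \<open>m / n + bad + M\<close>, and inserting
  \<open>mult_at_last_le\<close> for \<open>H\<close> produces both factors 4.\<close>

lemma small_at_le:
  assumes V: "eigenvector_choice V" and \<Lambda>: "1 \<le> \<Lambda>" and t: "0 < t" and \<tau>: "0 < \<tau>" and i: "Suc i < n" and j: "j < n"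
    and m: "2 * m \<le> n"
    and s: "0 \<le> s"
  defines "bad \<equiv> Pr (all_edges n) (\<lambda>B. \<not> good n \<Lambda> t \<tau> s m B)"
  shows "Pr (all_edges n) (small_at n i s j) \<le> m / n + 4 * bad + 4 * (2 * t / sqrt (p * (1 - p) * \<tau>))"
proof -
  let ?S = "all_edges n"
  define M where "M = Pr ?S (\<lambda>B. mult_ev n B i)"
  define H where "H = Pr ?S (mult_at n i (n - 1))"
  have npos: "0 < real n" using i by simp
  have i': "i < n" using i by simp
  have gcard: "card {j. j < n \<and> \<bar>eigvec V n B i j\<bar> \<le> s} \<le> m" if B: "B \<subseteq> ?S" and g: "good n \<Lambda> t \<tau> s m B" for B
  proof -
    have "\<bar>ev n B i\<bar> \<le> \<Lambda>"
      using ev_bounded[OF V B, of "\<Lambda> - 1" i] g i \<Lambda> by (simp add: good_def)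
    then show ?thesis using g eigvec_eig[OF V i', of B] unfolding good_def by blast
  qed
  have "real n * (M - bad) \<le> 2 * (real n * H)"
  proof -
    have "(\<Sum>j<n. Pr ?S (mult_at n i j)) \<le> (\<Sum>j<n. H)"
      unfolding H_def
    proof (rule sum_mono)
      fix j assume "j \<in> {..<n}"
      then show "Pr ?S (mult_at n i j) \<le> Pr ?S (mult_at n i (n - 1))"
        using i by (intro Pr_exchange_le[of "n - 1" n j] relabel_transfer(2)[OF V, of "n - 1" n j]) auto
    qed
    also have "\<dots> = real n * H" by simp
    finally have up: "(\<Sum>j<n. Pr ?S (mult_at n i j)) \<le> real n * H" .
    have "real n / 2 * (M - bad) \<le> EV ?S (\<lambda>B. \<Sum>j<n. of_bool (mult_at n i j B))"
    proof -
      have "real n / 2 * (M - bad) = EV ?S (\<lambda>B. real n / 2 * (of_bool (mult_ev n B i) - of_bool (\<not> good n \<Lambda> t \<tau> s m B)))"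
        by (simp only: EV_cmult EV_diff M_def bad_def Pr_def)
      also have "\<dots> \<le> EV ?S (\<lambda>B. \<Sum>j<n. of_bool (mult_at n i j B))"
      proof (rule EV_mono)
        fix B assume B: "B \<subseteq> ?S"
        have nn: "0 \<le> (\<Sum>j<n. of_bool (mult_at n i j B) :: real)" by (intro sum_nonneg) auto
        show "real n / 2 * (of_bool (mult_ev n B i) - of_bool (\<not> good n \<Lambda> t \<tau> s m B)) \<le> (\<Sum>j<n. of_bool (mult_at n i j B))"
        proof (cases "mult_ev n B i \<and> good n \<Lambda> t \<tau> s m B")
          case True
          define J where "J = {j. j < n \<and> \<bar>eigvec V n B i j\<bar> \<le> s}"
          have J: "J \<subseteq> {..<n}" "card J \<le> m" using gcard[OF B] True by (auto simp: J_def)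
          have at: "mult_at n i j B" if "j \<in> {..<n} - J" for j
          proof -
            have "eigvec V n B i j \<noteq> 0" using that s by (auto simp: J_def)
            then show ?thesis unfolding mult_at_def using True eigvec_eig[OF V i', of B] by blast
          qed
          have "real n / 2 \<le> real n - real (card J)" using J(2) m by linarith
          also have "\<dots> = real (card ({..<n} - J))"
            using J card_mono[OF _ J(1)] finite_subset[OF J(1)] by (simp add: card_Diff_subset of_nat_diff)
          also have "\<dots> = (\<Sum>j\<in>{..<n} - J. of_bool (mult_at n i j B))" using at by simp
          also have "\<dots> \<le> (\<Sum>j<n. of_bool (mult_at n i j B))" by (intro sum_mono2) auto
          finally show ?thesis using True by simp
        next
          case False
          then have "real n / 2 * (of_bool (mult_ev n B i) - of_bool (\<not> good n \<Lambda> t \<tau> s m B)) \<le> 0"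
            by (intro mult_nonneg_nonpos) auto
          then show ?thesis using nn by linarith
        qed
      qed
      finally show ?thesis .
    qed
    also have "\<dots> = (\<Sum>j<n. Pr ?S (mult_at n i j))" by (simp only: EV_sum Pr_def)
    finally show ?thesis using up by simp
  qed
  then have "real n * (M - bad) \<le> real n * (2 * H)" by simp
  then have M: "M \<le> bad + 2 * H" using npos by simp
  have H: "H \<le> bad + 2 * (2 * t / sqrt (p * (1 - p) * \<tau>))"
  proof -
    obtain n' where n': "n = Suc n'" using i by (cases n) auto
    show ?thesis unfolding H_def bad_def n'
      using mult_at_last_le[OF V \<Lambda> t \<tau>, of i n' s m] i n' by simp
  qed
  have "real n * Pr ?S (small_at n i s j) \<le> (\<Sum>j<n. Pr ?S (small_at n i s j))"
  proof -
    have "(\<Sum>k<n. Pr ?S (small_at n i s j)) \<le> (\<Sum>k<n. Pr ?S (small_at n i s k))"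
    proof (rule sum_mono)
      fix k assume "k \<in> {..<n}"
      then show "Pr ?S (small_at n i s j) \<le> Pr ?S (small_at n i s k)"
        using j by (intro Pr_exchange_le[of k n j] relabel_transfer(1)[OF V, of k n j]) auto
    qed
    then show ?thesis by simp
  qed
  also have "\<dots> = EV ?S (\<lambda>B. \<Sum>j<n. of_bool (small_at n i s j B))" by (simp only: EV_sum Pr_def)
  also have "\<dots> \<le> EV ?S (\<lambda>B. real m + real n * (of_bool (\<not> good n \<Lambda> t \<tau> s m B) + of_bool (mult_ev n B i)))"
  proof (rule EV_mono)
    fix B assume B: "B \<subseteq> ?S"
    have le: "(\<Sum>j<n. of_bool (small_at n i s j B) :: real) \<le> real n"
      using sum_bounded_above[of "{..<n}" "\<lambda>j. of_bool (small_at n i s j B) :: real" 1] by simp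
    show "(\<Sum>j<n. of_bool (small_at n i s j B)) \<le> real m + real n * (of_bool (\<not> good n \<Lambda> t \<tau> s m B) + of_bool (mult_ev n B i))"
    proof (cases "good n \<Lambda> t \<tau> s m B \<and> \<not> mult_ev n B i")
      case True
      have "(\<Sum>j<n. of_bool (small_at n i s j B) :: real) = real (card {j. j < n \<and> small_at n i s j B})"
        by (simp add: of_bool_def sum.If_cases Int_def)
      also have "card {j. j < n \<and> small_at n i s j B} \<le> card {j. j < n \<and> \<bar>eigvec V n B i j\<bar> \<le> s}"
      proof (rule card_mono)
        show "{j. j < n \<and> small_at n i s j B} \<subseteq> {j. j < n \<and> \<bar>eigvec V n B i j\<bar> \<le> s}"
        proof
          fix j assume "j \<in> {j. j < n \<and> small_at n i s j B}"
          then obtain x where j: "j < n" and x: "unit_norm n x" "eig n B (ev n B i) x" "\<bar>x j\<bar> \<le> s"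
            by (auto simp: small_at_def)
          have "\<bar>x j\<bar> = \<bar>eigvec V n B i j\<bar>"
            using True by (intro simple_eigenvector_unique[OF V i' _ x(2,1) j]) simp
          then show "j \<in> {j. j < n \<and> \<bar>eigvec V n B i j\<bar> \<le> s}" using x(3) j by simp
        qed
      qed simp
      also have "\<dots> \<le> m" using gcard[OF B] True by blast
      finally show ?thesis using True by simp
    next
      case False
      then have "real n * 1 \<le> real n * (of_bool (\<not> good n \<Lambda> t \<tau> s m B) + of_bool (mult_ev n B i))"
        by (intro mult_left_mono) auto
      then show ?thesis using le by linarith
    qed
  qed
  also have "\<dots> = real m + real n * (bad + M)"
    using finite_all_edges[of n] by (simp only: EV_add EV_cmult EV_const bad_def M_def Pr_def)
  finally have "real n * Pr ?S (small_at n i s j) \<le> real m + real n * (bad + M)" .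
  then have "Pr ?S (small_at n i s j) \<le> (real m + real n * (bad + M)) / real n"
    using npos by (simp add: pos_le_divide_eq mult.commute)
  also have "\<dots> = m / n + (bad + M)" using npos by (simp add: add_divide_distrib)
  finally show ?thesis using M H by linarith
qed

section \<open>Union bound over all bad events\<close>

lemma rich_prob:
  assumes V: "eigenvector_choice V" and \<theta>: "0 < \<theta>" and k1: "1 < k1"
    and \<rho>: "\<rho> = 4 / ((p * (1 - p))\<^sup>2 * (real k1 - 1))" "\<rho> \<le> 1"
    and z: "12 * \<theta> * real n / real k1 \<le> p * (1 - p) * (real k1 - 1) / 2"
  shows "Pr (all_edges n) (rich n \<theta> (4 * k1) J lam) \<le> 2 ^ n * \<rho> powr (real k1 / 2)"
proof -
  define I where "I = {..<n} - J"
  have I: "finite I" "card I \<le> n" "I \<subseteq> {..<n}" using card_mono[of "{..<n}" I] by (auto simp: I_def)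
  have "Pr (all_edges n) (rich n \<theta> (4 * k1) J lam) \<le> 2 ^ card I * \<rho> powr (real k1 / 2)"
    unfolding rich_def Let_def I_def[symmetric]
  proof (rule rich_window_improbable[OF V I(1) finite_all_edges _ _ \<theta>, where N = "real k1"])
    show "(\<Union>a\<in>I. star a (I - {a})) \<subseteq> all_edges n"
      using I(3) by (auto simp: star_def all_edges_def card_insert_if)
    have "12 * \<theta> * real (card I) / real k1 \<le> 12 * \<theta> * real n / real k1"
      using I(2) \<theta> by (intro divide_right_mono mult_left_mono) auto
    then show "12 * \<theta> * real (card I) / real k1 \<le> p * (1 - p) * (real k1 - 1) / 2" using z by linarith
  qed (use k1 \<rho> in \<open>auto simp: all_edges_def\<close>)
  also have "\<dots> \<le> 2 ^ n * \<rho> powr (real k1 / 2)"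
    using I(2) by (intro mult_right_mono power_increasing) auto
  finally show ?thesis .
qed

lemma norm_ok_mono: "norm_ok n \<Lambda> B \<Longrightarrow> 0 \<le> \<Lambda> \<Longrightarrow> \<Lambda> \<le> \<Lambda>' \<Longrightarrow> norm_ok n \<Lambda>' B"
  unfolding norm_ok_def
  by (meson mult_right_mono order_trans power_mono sum_nonneg zero_le_power2)

text \<open>The summands belong to the failures of the norm bound, of incompressibility, and of the
  bound on the number of small coordinates. In the last one the factors before the bracket count the
  sets \<open>J\<close> and the net for the eigenvalue, and the bracket adds the cases
  \<open>rich\<close> and \<open>few\<close>. The mass on \<open>J\<close> is at most
  \<open>s2\<close>, as its coordinates are at most \<open>s\<close>.\<close>

lemma bad_le:
  assumes V: "eigenvector_choice V" and n: "1 \<le> n" and \<Lambda>: "5 \<le> \<Lambda>" "\<Lambda> \<le> real n"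
    and t: "0 < t" "1 / t\<^sup>2 \<le> real K" and \<tau>: "0 < \<tau>" "\<tau> \<le> 3 / 4"
    and D: "4 * (real K + 1) \<le> c0 * D" "16 * real K \<le> D" "1 \<le> D" "1 / D \<le> t"
    and k: "4 * (10 * \<Lambda>\<^sup>2 * \<tau>) / c0\<^sup>2 \<le> real k" and \<theta>: "0 < \<theta>" and s: "0 \<le> s"
    and s2: "s2 = real n * s\<^sup>2" "s2 \<le> \<tau> / 8"
    and \<kappa>: "\<kappa> = 2 * ((20 * \<Lambda>\<^sup>2 * s2 + 2 / D\<^sup>2) / \<theta>) + 2 * (real n + 1) / D\<^sup>2" "\<kappa> \<le> \<tau> / 8" "\<kappa> \<le> t\<^sup>2"
    and k': "(20 * \<Lambda>\<^sup>2 * s2 + 2 * \<Lambda>\<^sup>2 * \<kappa>) / t\<^sup>2 \<le> real k"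
    and k1: "1 < k1"
    and \<rho>: "\<rho> = 4 / ((p * (1 - p))\<^sup>2 * (real k1 - 1))" "\<rho> \<le> 1"
    and z: "12 * \<theta> * real n / real k1 \<le> p * (1 - p) * (real k1 - 1) / 2"
    and p0: "p0 = 8 * t / sqrt (p * (1 - p) * \<tau>)" "p0 \<le> 1"
  shows "Pr (all_edges n) (\<lambda>B. \<not> good n \<Lambda> t \<tau> s m B)
    \<le> (2 * real n ^ 2 + 1) ^ (2 * n) * exp (- ((\<Lambda> - 1)\<^sup>2 / 32))
    + (real n + 1) ^ K * (2 * real D + 1) ^ K * (2 * real n * real D + 1) * (real n + 1) ^ k * q0 powr (real n - real K - real k)
    + 2 ^ n * ((2 * real n * real D + 1) * (2 ^ n * \<rho> powr (real k1 / 2)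
        + (4 * real D + 1) ^ (4 * k1) * ((4 * real n * real D + 1) * ((real n + 1) ^ k * p0 powr (real m - real k)))))"
    (is "_ \<le> ?N + ?S + ?R")
proof -
  let ?S' = "all_edges n"
  let ?X = "{J. J \<subseteq> {..<n} \<and> m \<le> card J}"
  define E where "E J lam B \<longleftrightarrow> rich n \<theta> (4 * k1) J lam B \<or> few n D \<theta> (4 * k1) k t \<tau> J lam B" for J lam B
  have "Pr ?S' (\<lambda>B. \<not> good n \<Lambda> t \<tau> s m B) \<le> Pr ?S' (\<lambda>B. (\<not> norm_ok n (\<Lambda> - 1) B \<or> sparse_bad n K (10 * \<Lambda>\<^sup>2 * \<tau>) B)
     \<or> (\<exists>J\<in>?X. \<exists>lam\<in>grid1 D n. E J lam B))"
  proof (rule Pr_mono)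
    fix B assume B: "B \<subseteq> ?S'" and bad: "\<not> good n \<Lambda> t \<tau> s m B"
    show "(\<not> norm_ok n (\<Lambda> - 1) B \<or> sparse_bad n K (10 * \<Lambda>\<^sup>2 * \<tau>) B) \<or> (\<exists>J\<in>?X. \<exists>lam\<in>grid1 D n. E J lam B)"
    proof (cases "\<not> norm_ok n (\<Lambda> - 1) B \<or> sparse_bad n K (10 * \<Lambda>\<^sup>2 * \<tau>) B")
      case False
      then have nrm1: "norm_ok n (\<Lambda> - 1) B" and sp: "\<not> sparse_bad n K (10 * \<Lambda>\<^sup>2 * \<tau>) B" by auto
      have nrm: "norm_ok n \<Lambda> B" using norm_ok_mono[OF nrm1, of \<Lambda>] \<Lambda> by simp
      have \<Lambda>1: "1 \<le> \<Lambda>" using \<Lambda> by simp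
      obtain lam x where lam: "\<bar>lam\<bar> \<le> \<Lambda>" and x: "unit_norm n x" and e: "eig n B lam x"
        and f: "\<not> (incompressible n t \<tau> x \<and> card {j. j < n \<and> \<bar>x j\<bar> \<le> s} \<le> m)"
        using bad nrm1 unfolding good_def by blast
      have inc: "incompressible n t \<tau> x"
        by (rule incompressible_if_not_sparse[OF B nrm e x lam \<Lambda>1 t \<tau>(2) sp])
      define J where "J = {j. j < n \<and> \<bar>x j\<bar> \<le> s}"
      have J: "J \<subseteq> {..<n}" by (auto simp: J_def)
      have cJ: "card J \<le> n" using card_mono[OF _ J] by simp
      have "m \<le> card J" using f inc by (simp add: J_def)
      then have JX: "J \<in> ?X" using J by simp
      have "(\<Sum>j\<in>J. (x j)\<^sup>2) \<le> (\<Sum>j\<in>J. s\<^sup>2)"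
      proof (rule sum_mono)
        fix j assume "j \<in> J"
        then show "(x j)\<^sup>2 \<le> s\<^sup>2" using power_mono[of "\<bar>x j\<bar>" s 2] by (simp add: J_def)
      qed
      also have "\<dots> = real (card J) * s\<^sup>2" by simp
      also have "\<dots> \<le> s2" unfolding s2(1) using cJ by (intro mult_right_mono) auto
      finally have sJ: "(\<Sum>j\<in>J. (x j)\<^sup>2) \<le> s2" .
      have "\<exists>lam'\<in>grid1 D n. rich n \<theta> (4 * k1) J lam' B \<or> few n D \<theta> (4 * k1) k t \<tau> J lam' B"
        by (rule nogap_reduce[OF V B nrm e x lam \<Lambda>1 \<Lambda>(2) J sJ inc D(3) \<theta> t(1)])
          (use s2 \<kappa> D \<tau> k' in auto)
      then show ?thesis using JX unfolding E_def by blast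
    qed simp
  qed
  also have "\<dots> \<le> (Pr ?S' (\<lambda>B. \<not> norm_ok n (\<Lambda> - 1) B) + Pr ?S' (sparse_bad n K (10 * \<Lambda>\<^sup>2 * \<tau>)))
     + Pr ?S' (\<lambda>B. \<exists>J\<in>?X. \<exists>lam\<in>grid1 D n. E J lam B)"
    by (intro order_trans[OF Pr_disj_le] add_right_mono Pr_disj_le)
  also have "\<dots> \<le> (?N + ?S) + ?R"
  proof (intro add_mono)
    show "Pr ?S' (\<lambda>B. \<not> norm_ok n (\<Lambda> - 1) B) \<le> ?N"
      using \<Lambda> by (intro norm_ok_probable n) auto
    show "Pr ?S' (sparse_bad n K (10 * \<Lambda>\<^sup>2 * \<tau>)) \<le> ?S"
      by (rule sparse_improbable[OF n D(1,2) k])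
    define R1 where "R1 = 2 ^ n * \<rho> powr (real k1 / 2)"
    define F1 where "F1 = (4 * real D + 1) ^ (4 * k1) * ((4 * real n * real D + 1) * ((real n + 1) ^ k * p0 powr (real m - real k)))"
    have nonneg: "0 \<le> R1" "0 \<le> F1" by (auto simp: R1_def F1_def)
    have pq: "0 < p * (1 - p)" using p_pos p_less_1 by simp
    have p00: "0 < p0" using t(1) pq \<tau>(1) by (simp add: p0(1))
    have "Pr ?S' (\<lambda>B. \<exists>J\<in>?X. \<exists>lam\<in>grid1 D n. E J lam B) \<le> real (card ?X) * ((2 * real n * real D + 1) * (R1 + F1))"
    proof (rule Pr_Bex_le_card)
      fix J assume J: "J \<in> ?X"
      have "Pr ?S' (\<lambda>B. \<exists>lam\<in>grid1 D n. E J lam B) \<le> real (card (grid1 D n)) * (R1 + F1)"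
      proof (rule Pr_Bex_le_card[OF finite_grid1])
        fix lam
        have "Pr ?S' (E J lam) \<le> Pr ?S' (rich n \<theta> (4 * k1) J lam) + Pr ?S' (few n D \<theta> (4 * k1) k t \<tau> J lam)"
          unfolding E_def by (rule Pr_disj_le)
        also have "\<dots> \<le> R1 + F1"
        proof (rule add_mono)
          show "Pr ?S' (rich n \<theta> (4 * k1) J lam) \<le> R1" unfolding R1_def by (rule rich_prob[OF V \<theta> k1 \<rho> z])
          have "Pr ?S' (few n D \<theta> (4 * k1) k t \<tau> J lam)
             \<le> (4 * real D + 1) ^ (4 * k1) * ((4 * real n * real D + 1) * ((real n + 1) ^ k * p0 powr (real (card J) - real k)))"
            unfolding p0(1) using J t \<tau> \<theta> p0 by (intro few_prob[OF V]) auto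
          also have "\<dots> \<le> F1" unfolding F1_def
            using J p00 p0(2) by (intro mult_left_mono powr_mono') auto
          finally show "Pr ?S' (few n D \<theta> (4 * k1) k t \<tau> J lam) \<le> F1" .
        qed
        finally show "Pr ?S' (E J lam) \<le> R1 + F1" .
      qed
      also have "\<dots> \<le> (2 * real n * real D + 1) * (R1 + F1)"
        using of_nat_mono[OF card_grid1[of D n], where 'a = real] nonneg by (intro mult_right_mono) (auto simp: add.commute)
      finally show "Pr ?S' (\<lambda>B. \<exists>lam\<in>grid1 D n. E J lam B) \<le> (2 * real n * real D + 1) * (R1 + F1)" .
    qed simp
    also have "\<dots> \<le> 2 ^ n * ((2 * real n * real D + 1) * (R1 + F1))"
    proof (rule mult_right_mono)
      have "card ?X \<le> card (Pow {..<n})" by (intro card_mono) auto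
      then have "real (card ?X) \<le> real (2 ^ n)" by (simp only: card_Pow finite_lessThan card_lessThan of_nat_le_iff)
      then show "real (card ?X) \<le> 2 ^ n" by simp
    qed (use nonneg in auto)
    finally show "Pr ?S' (\<lambda>B. \<exists>J\<in>?X. \<exists>lam\<in>grid1 D n. E J lam B) \<le> ?R" by (simp only: R1_def F1_def)
  qed
  finally show ?thesis .
qed

end

section \<open>Choice of the parameters\<close>

lemma power_le_exp: "0 \<le> x \<Longrightarrow> x \<le> exp y \<Longrightarrow> x ^ K \<le> exp (real K * y)"
  by (simp add: exp_of_nat_mult power_mono)

text \<open>These are the factors of the union bounds for nets of mesh n^(-2), as exponentials of
  multiples of ln n.\<close>

lemma poly_exp_bounds:
  fixes n :: nat
  assumes "3 \<le> n"
  defines "l \<equiv> ln (real n)"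
  shows "real n + 1 \<le> exp (2 * l)" "2 * real n ^ 2 + 1 \<le> exp (4 * l)" "4 * real n ^ 2 + 1 \<le> exp (4 * l)"
    "2 * real n * real n ^ 2 + 1 \<le> exp (5 * l)" "4 * real n * real n ^ 2 + 1 \<le> exp (5 * l)"
proof -
  have n: "3 \<le> real n" using assms by simp
  have e: "exp (real a * l) = real n ^ a" for a using n by (simp add: l_def exp_of_nat_mult)
  have n2: "9 \<le> real n ^ 2" using power_mono[OF n, of 2] by simp
  have n1: "1 \<le> real n * real n ^ 2" using mult_mono[of 1 "real n" 1 "real n ^ 2"] n n2 by simp
  have n4: "9 * real n ^ 2 \<le> real n ^ 4"
    using mult_right_mono[OF n2, of "real n ^ 2"] by (simp flip: power_add)
  have n5: "9 * (real n * real n ^ 2) \<le> real n ^ 5"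
    using mult_left_mono[OF n4, of "real n"] by (simp add: power_numeral_reduce mult_ac)
  have "3 * real n \<le> real n * real n" using n by (intro mult_right_mono) auto
  then have n3: "real n + 1 \<le> real n ^ 2" using n by (simp only: power2_eq_square)
  show "real n + 1 \<le> exp (2 * l)" using n3 e[of 2] by simp
  show "2 * real n ^ 2 + 1 \<le> exp (4 * l)" "4 * real n ^ 2 + 1 \<le> exp (4 * l)" using n2 n4 e[of 4] by simp_all
  show "2 * real n * real n ^ 2 + 1 \<le> exp (5 * l)" "4 * real n * real n ^ 2 + 1 \<le> exp (5 * l)"
    using n1 n5 e[of 5] by simp_all
qed

context bernoulli_sets begin

context
  fixes \<epsilon> \<eta> :: real
  assumes \<epsilon>: "0 < \<epsilon>" "\<epsilon> \<le> 1" and \<eta>: "0 < \<eta>" "\<eta> \<le> 1 / 2"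
begin

text \<open>With \<open>z = n^(\<epsilon>/64)\<close> all thresholds are powers of \<open>z\<close>: the norm bound is \<open>z n^(1/2)\<close>, the levels \<open>t\<close> and
  \<open>\<tau>\<close> of incompressibility are \<open>z^-8\<close>, the window width is \<open>n z^-64\<close>, the net has mesh \<open>n^-2\<close>. The constant
  \<open>4096\<close> lets the small ball gain over \<open>\<eta> n\<close> rows beat the entropy of a net of dimension \<open>4 rich_dim n\<close>.\<close>

definition scale :: "nat \<Rightarrow> real" where "scale n = real n powr (\<epsilon> / 64)"
definition frac :: real where "frac = \<eta> * \<epsilon> / 4096"
text \<open>Collects the constants in the two lower bounds that \<open>bad_le\<close> puts on
  \<open>k\<close>: \<open>40 / c0\<^sup>2\<close> from sparse vectors, and 116 = 20 + 96 from the
  rows in \<open>J\<close>.\<close>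

definition c_count :: real where "c_count = 40 / c0\<^sup>2 + 116"
definition c_rich :: real where "c_rich = 8 / ((p * (1 - p))\<^sup>2 * frac)"
definition c_ball :: real where "c_ball = 8 / sqrt (p * (1 - p))"
definition excess :: "nat \<Rightarrow> nat" where "excess n = nat \<lceil>c_count * real n / scale n ^ 6\<rceil>"
definition support :: "nat \<Rightarrow> nat" where "support n = nat \<lceil>scale n ^ 16\<rceil>"
definition rich_dim :: "nat \<Rightarrow> nat" where "rich_dim n = nat \<lfloor>frac * real n\<rfloor> + 1"
definition few_coords :: "nat \<Rightarrow> nat" where "few_coords n = nat \<lfloor>\<eta> * real n\<rfloor>"
text \<open>Since \<open>scale n ^ 64\<close> is n^\<epsilon> for positive n, this is
  n^(-1/2-\<epsilon>).\<close>

definition coord_size :: "nat \<Rightarrow> real" where "coord_size n = 1 / (scale n ^ 64 * sqrt (real n))"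

lemma pq_pos: "0 < p * (1 - p)" using p_pos p_less_1 by simp
lemma frac_pos: "0 < frac" using \<epsilon> \<eta> by (simp add: frac_def)
lemma c_count_pos: "116 \<le> c_count" "40 / c0\<^sup>2 \<le> c_count" by (auto simp: c_count_def)
lemma c_rich_pos: "0 < c_rich" unfolding c_rich_def using p_pos p_less_1 frac_pos by (intro divide_pos_pos mult_pos_pos zero_less_power) auto
lemma c_ball_pos: "0 < c_ball" using pq_pos by (simp add: c_ball_def)

lemma scale_64: "1 \<le> n \<Longrightarrow> scale n ^ 64 \<le> real n"
proof -
  assume n: "1 \<le> n"
  have "scale n ^ 64 = real n powr \<epsilon>" using n by (simp add: scale_def powr_powr flip: powr_realpow)
  also have "\<dots> \<le> real n powr 1" using n \<epsilon> by (intro powr_mono) auto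
  finally show ?thesis using n by simp
qed

text \<open>The clauses are side conditions of \<open>bad_le\<close>. In particular
  \<open>c_rich\<close> is for \<open>\<rho> \<le> 1\<close>, the constant 48 for the condition on
  the window width, and \<open>c_ball\<close> for \<open>p0 \<le> 1\<close>.\<close>

definition large :: "nat \<Rightarrow> bool" where
  "large n \<longleftrightarrow> 3 \<le> n \<and> 10 \<le> scale n \<and> 12 \<le> c0 * real n \<and> 2 \<le> frac * real n \<and> c_rich \<le> real n
    \<and> 48 / (p * (1 - p) * frac\<^sup>2) \<le> scale n ^ 64 \<and> c_ball \<le> scale n ^ 4"

lemma eventually_large: "eventually large sequentially"
proof -
  have 1: "eventually (\<lambda>n. c \<le> scale n) sequentially" for c unfolding scale_def using \<epsilon> by real_asymp
  have 2: "eventually (\<lambda>n. c \<le> scale n ^ 64) sequentially" for c unfolding scale_def using \<epsilon> by real_asymp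
  have 3: "eventually (\<lambda>n. c \<le> scale n ^ 4) sequentially" for c unfolding scale_def using \<epsilon> by real_asymp
  have 4: "eventually (\<lambda>n. b \<le> c * real n) sequentially" if "0 < c" for b c :: real using that by real_asymp
  show ?thesis unfolding large_def
    using 1[of 10] 2 3 4[OF c0_pos] 4[OF frac_pos] 4[of 1 c_rich] eventually_ge_at_top[of 3]
    by (auto intro!: eventually_conj)
qed

lemma large_rounding:
  assumes "large n"
  shows "scale n ^ 16 \<le> real (support n)" "real (support n) \<le> 2 * (real n / scale n ^ 6)" "real (support n) \<le> 2 * real n"
    "c_count * real n / scale n ^ 6 \<le> real (excess n)" "real (excess n) \<le> (c_count + 1) * (real n / scale n ^ 6)"
    "frac * real n \<le> real (rich_dim n)" "frac * real n / 2 \<le> real (rich_dim n) - 1" "real (rich_dim n) \<le> 2 * frac * real n"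
    "real (few_coords n) \<le> \<eta> * real n" "\<eta> * real n - 1 \<le> real (few_coords n)"
proof -
  have n: "3 \<le> n" "10 \<le> scale n" "2 \<le> frac * real n" using assms by (auto simp: large_def)
  have z1: "1 \<le> scale n" using n by simp
  have zn: "scale n ^ 64 \<le> real n" using scale_64 n by simp
  have z22: "scale n ^ 16 * scale n ^ 6 \<le> real n"
    using power_increasing[of 22 64 "scale n"] z1 zn by (simp flip: power_add)
  have z6: "scale n ^ 16 \<le> real n / scale n ^ 6" using z22 z1 by (simp add: pos_le_divide_eq)
  have z16: "1 \<le> scale n ^ 16" using z1 by simp
  have z16n: "scale n ^ 16 \<le> real n" using power_increasing[of 16 64 "scale n"] z1 zn by simp
  have q1: "1 \<le> real n / scale n ^ 6" using z6 z16 by linarith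
  show "scale n ^ 16 \<le> real (support n)" unfolding support_def using z16 by linarith
  show "real (support n) \<le> 2 * (real n / scale n ^ 6)" unfolding support_def using z6 z16 by linarith
  show "real (support n) \<le> 2 * real n" unfolding support_def using z16 z16n by linarith
  have c: "0 \<le> c_count * (real n / scale n ^ 6)" using c_count_pos(1) q1 by (intro mult_nonneg_nonneg) auto
  have excess: "excess n = nat \<lceil>c_count * (real n / scale n ^ 6)\<rceil>" by (simp add: excess_def)
  show "c_count * real n / scale n ^ 6 \<le> real (excess n)" unfolding excess using c by simp
  have "real (excess n) \<le> c_count * (real n / scale n ^ 6) + 1" unfolding excess using c by linarith
  also have "\<dots> \<le> (c_count + 1) * (real n / scale n ^ 6)" using q1 by (simp only: distrib_right mult_1_left)
  finally show "real (excess n) \<le> (c_count + 1) * (real n / scale n ^ 6)" .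
  show "frac * real n \<le> real (rich_dim n)" "frac * real n / 2 \<le> real (rich_dim n) - 1" "real (rich_dim n) \<le> 2 * frac * real n"
    unfolding rich_dim_def using n(3) by linarith+
  have "0 \<le> \<eta> * real n" using \<eta> by simp
  then show "real (few_coords n) \<le> \<eta> * real n" "\<eta> * real n - 1 \<le> real (few_coords n)" unfolding few_coords_def by linarith+
qed

lemma bad_large:
  assumes V: "eigenvector_choice V" and L: "large n"
  shows "Pr (all_edges n) (\<lambda>B. \<not> good n (sqrt (real n) * scale n) (1 / scale n ^ 8) (1 / scale n ^ 8) (coord_size n) (few_coords n) B)
    \<le> (2 * real n ^ 2 + 1) ^ (2 * n) * exp (- ((sqrt (real n) * scale n - 1)\<^sup>2 / 32))
    + (real n + 1) ^ support n * (2 * real n ^ 2 + 1) ^ support n * (2 * real n * real n ^ 2 + 1) * (real n + 1) ^ excess n * q0 powr (real n - real (support n) - real (excess n))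
    + 2 ^ n * ((2 * real n * real n ^ 2 + 1) * (2 ^ n * (4 / ((p * (1 - p))\<^sup>2 * (real (rich_dim n) - 1))) powr (real (rich_dim n) / 2)
        + (4 * real n ^ 2 + 1) ^ (4 * rich_dim n) * ((4 * real n * real n ^ 2 + 1) * ((real n + 1) ^ excess n * (c_ball / scale n ^ 4) powr (real (few_coords n) - real (excess n))))))"
proof -
  define z where "z = scale n"
  define N where "N = real n"
  have n: "3 \<le> n" "10 \<le> z" "12 \<le> c0 * N" "2 \<le> frac * N" "c_rich \<le> N" "48 / (p * (1 - p) * frac\<^sup>2) \<le> z ^ 64" "c_ball \<le> z ^ 4"
    using L by (auto simp: large_def z_def N_def)
  note r = large_rounding[OF L, folded z_def N_def]
  have z0: "0 < z" "1 \<le> z" using n by auto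
  have zn: "z ^ 64 \<le> N" using scale_64 n(1) by (simp add: z_def N_def)
  have N: "3 \<le> N" "0 < N" using n(1) by (auto simp: N_def)
  have zp: "z ^ a \<le> z ^ b" if "a \<le> b" for a b using that z0 by (intro power_increasing) auto
  have zpN: "z ^ a \<le> N" if "a \<le> 64" for a using zp[OF that] zn by simp
  have z2: "(2::real) ^ a \<le> z ^ a" for a using n by (intro power_mono) auto
  have \<Lambda>2: "(sqrt N * z)\<^sup>2 = N * z\<^sup>2" using N by (simp add: power_mult_distrib)
  have s2: "N * (coord_size n)\<^sup>2 = 1 / z ^ 128"
    using N by (simp add: coord_size_def z_def[symmetric] N_def[symmetric] power_divide power_mult_distrib flip: power_mult)
  define \<kappa> where "\<kappa> = 2 * ((20 * (sqrt N * z)\<^sup>2 * (1 / z ^ 128) + 2 / real (n\<^sup>2) ^ 2) / (N / z ^ 64)) + 2 * (N + 1) / real (n\<^sup>2) ^ 2"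
  \<comment> \<open>The main term 40 z^(-62) is the residual
    \<open>20 * \<Lambda>\<^sup>2 * s2\<close> over the window width; all contributions of the mesh
    n^(-2) together stay below 8 z^(-62).\<close>
  have \<kappa>: "\<kappa> \<le> 48 / z ^ 62"
  proof -
    have a: "20 * (N * z\<^sup>2) * (1 / z ^ 128) / (N / z ^ 64) = 20 / z ^ 62"
      using z0 N by (simp add: divide_simps)
    have N3: "z ^ 62 \<le> N ^ 3" using zpN[of 62] power_increasing[of 1 3 N] N by simp
    have b: "2 / N ^ 4 / (N / z ^ 64) \<le> 2 / N ^ 4"
    proof -
      have "2 / N ^ 4 / (N / z ^ 64) = (2 / N ^ 4) * (z ^ 64 / N)" by simp
      also have "\<dots> \<le> (2 / N ^ 4) * 1" using zn N by (intro mult_left_mono) auto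
      finally show ?thesis by simp
    qed
    have c: "2 / N ^ 4 \<le> 2 / N ^ 3" using N by (intro divide_left_mono power_increasing) auto
    have d: "2 * (N + 1) / N ^ 4 \<le> 4 / N ^ 3"
    proof -
      have "2 * (N + 1) / N ^ 4 \<le> 4 * N / N ^ 4" using N by (intro divide_right_mono) auto
      also have "\<dots> = 4 / N ^ 3" using N by (simp add: power_numeral_reduce)
      finally show ?thesis .
    qed
    have e: "1 / N ^ 3 \<le> 1 / z ^ 62" using N3 z0 N by (intro divide_left_mono mult_pos_pos) auto
    have nn: "real (n\<^sup>2) ^ 2 = N ^ 4" by (simp add: N_def flip: power_mult)
    have "\<kappa> = 2 * (20 / z ^ 62 + 2 / N ^ 4 / (N / z ^ 64)) + 2 * (N + 1) / N ^ 4"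
      unfolding \<kappa>_def nn \<Lambda>2 add_divide_distrib a ..
    also have "\<dots> \<le> 40 / z ^ 62 + 8 * (1 / N ^ 3)" using b c d by simp
    also have "\<dots> \<le> 40 / z ^ 62 + 8 * (1 / z ^ 62)" using e by (intro add_left_mono mult_left_mono) auto
    finally show ?thesis by simp
  qed
  have \<kappa>1: "\<kappa> \<le> (1 / z ^ 8) / 8"
  proof -
    have "48 * 8 \<le> z ^ 54" using z2[of 54] by simp
    then have "48 * 8 * z ^ 8 \<le> z ^ 54 * z ^ 8" using z0 by (intro mult_right_mono) auto
    then have "48 / z ^ 62 \<le> 1 / z ^ 8 / 8" using z0 by (simp add: field_simps flip: power_add)
    then show ?thesis using \<kappa> by linarith
  qed
  have \<kappa>2: "\<kappa> \<le> (1 / z ^ 8)\<^sup>2"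
  proof -
    have "48 \<le> z ^ 46" using z2[of 46] by simp
    then have "48 * z ^ 16 \<le> z ^ 46 * z ^ 16" using z0 by (intro mult_right_mono) auto
    then have "48 / z ^ 62 \<le> 1 / z ^ 16" using z0 by (simp add: field_simps flip: power_add)
    then show ?thesis using \<kappa> by (simp add: power_divide flip: power_mult)
  qed
  have k1pos: "1 < rich_dim n" using r(7) n(4) by linarith
  have \<rho>': "4 / ((p * (1 - p))\<^sup>2 * (real (rich_dim n) - 1)) \<le> c_rich / N"
  proof -
    have "4 / ((p * (1 - p))\<^sup>2 * (real (rich_dim n) - 1)) \<le> 4 / ((p * (1 - p))\<^sup>2 * (frac * N / 2))"
      using r(7) p_pos p_less_1 frac_pos N k1pos by (intro divide_left_mono mult_left_mono mult_pos_pos) auto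
    also have "\<dots> = c_rich / N" by (simp add: c_rich_def)
    finally show ?thesis .
  qed
  have p0: "8 * (1 / z ^ 8) / sqrt (p * (1 - p) * (1 / z ^ 8)) = c_ball / z ^ 4"
  proof -
    have "sqrt (z ^ 8) = z ^ 4" using z0 by (intro real_sqrt_unique) (auto simp flip: power_mult)
    then have "sqrt (p * (1 - p) * (1 / z ^ 8)) = sqrt (p * (1 - p)) / z ^ 4" by (simp add: real_sqrt_divide)
    then have "8 * (1 / z ^ 8) / sqrt (p * (1 - p) * (1 / z ^ 8)) = (8 / sqrt (p * (1 - p))) * (z ^ 4 / z ^ 8)" by simp
    also have "z ^ 4 / z ^ 8 = 1 / z ^ 4" using z0 by (simp add: field_simps flip: power_add)
    finally show ?thesis by (simp add: c_ball_def)
  qed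
  have Dr: "real (n\<^sup>2) = N ^ 2" by (simp add: N_def)
  have "Pr (all_edges n) (\<lambda>B. \<not> good n (sqrt N * z) (1 / z ^ 8) (1 / z ^ 8) (coord_size n) (few_coords n) B)
    \<le> (2 * N ^ 2 + 1) ^ (2 * n) * exp (- ((sqrt N * z - 1)\<^sup>2 / 32))
    + (N + 1) ^ support n * (2 * real (n\<^sup>2) + 1) ^ support n * (2 * N * real (n\<^sup>2) + 1) * (N + 1) ^ excess n * q0 powr (N - real (support n) - real (excess n))
    + 2 ^ n * ((2 * N * real (n\<^sup>2) + 1) * (2 ^ n * (4 / ((p * (1 - p))\<^sup>2 * (real (rich_dim n) - 1))) powr (real (rich_dim n) / 2)
        + (4 * real (n\<^sup>2) + 1) ^ (4 * rich_dim n) * ((4 * N * real (n\<^sup>2) + 1) * ((N + 1) ^ excess n * (c_ball / z ^ 4) powr (real (few_coords n) - real (excess n))))))"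
  proof (rule bad_le[where n = n and \<Lambda> = "sqrt N * z" and t = "1 / z ^ 8" and K = "support n" and \<tau> = "1 / z ^ 8" and D = "n\<^sup>2"
      and k = "excess n" and \<theta> = "N / z ^ 64" and s = "coord_size n" and ?s2.0 = "1 / z ^ 128" and \<kappa> = \<kappa> and ?k1.0 = "rich_dim n"
      and \<rho> = "4 / ((p * (1 - p))\<^sup>2 * (real (rich_dim n) - 1))" and ?p0.0 = "c_ball / z ^ 4" and m = "few_coords n", OF V, folded N_def])
    show "1 \<le> n" using n by simp
    have "1 \<le> sqrt N" using N by simp
    then have "1 * 10 \<le> sqrt N * z" using n by (intro mult_mono) auto
    then show "5 \<le> sqrt N * z" by simp
    have "z\<^sup>2 \<le> N" by (rule zpN) simp
    then have "z \<le> sqrt N" by (rule real_le_rsqrt)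
    then have "sqrt N * z \<le> sqrt N * sqrt N" using N by (intro mult_left_mono) auto
    then show "sqrt N * z \<le> N" using N by simp
    show "0 < 1 / z ^ 8" using z0 by simp
    then show "0 < 1 / z ^ 8" .
    show "1 / (1 / z ^ 8)\<^sup>2 \<le> real (support n)" using r(1) by (simp add: power_divide flip: power_mult)
    have "2 \<le> z ^ 8" using z2[of 8] by simp
    then show "1 / z ^ 8 \<le> 3 / 4" using z0 by (simp add: divide_simps)
    show "4 * (real (support n) + 1) \<le> c0 * real (n\<^sup>2)"
    proof -
      have "4 * (real (support n) + 1) \<le> 12 * N" using r(3) N by simp
      also have "\<dots> \<le> c0 * N * N" using n(3) N by (intro mult_right_mono) auto
      finally show ?thesis unfolding Dr by (simp add: power2_eq_square)
    qed
    show "16 * real (support n) \<le> real (n\<^sup>2)"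
    proof -
      have "(32::real) \<le> 2 ^ 64" by simp
      also have "\<dots> \<le> N" using z2[of 64] zn by linarith
      finally have "32 * N \<le> N * N" using N by (intro mult_right_mono) auto
      then show ?thesis unfolding Dr using r(3) by (simp add: power2_eq_square)
    qed
    show "1 \<le> n\<^sup>2" using n by simp
    have "z ^ 8 \<le> N\<^sup>2" using zpN[of 8] power_increasing[of 1 2 N] N by simp
    then show "1 / real (n\<^sup>2) \<le> 1 / z ^ 8" unfolding Dr using z0 N by (intro divide_left_mono mult_pos_pos) auto
    show "4 * (10 * (sqrt N * z)\<^sup>2 * (1 / z ^ 8)) / c0\<^sup>2 \<le> real (excess n)"
    proof -
      have "4 * (10 * (sqrt N * z)\<^sup>2 * (1 / z ^ 8)) / c0\<^sup>2 = 40 / c0\<^sup>2 * (N * (z\<^sup>2 / z ^ 8))" unfolding \<Lambda>2 by simp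
      also have "z\<^sup>2 / z ^ 8 = 1 / z ^ 6" using z0 by (simp add: field_simps flip: power_add)
      also have "40 / c0\<^sup>2 * (N * (1 / z ^ 6)) \<le> c_count * (N * (1 / z ^ 6))"
        using c_count_pos(2) N z0 by (intro mult_right_mono) auto
      also have "\<dots> \<le> real (excess n)" using r(4) by simp
      finally show ?thesis .
    qed
    show "0 < N / z ^ 64" using N z0 by simp
    show "0 \<le> coord_size n" by (simp add: coord_size_def)
    show "1 / z ^ 128 = N * (coord_size n)\<^sup>2" by (rule s2[symmetric])
    show "1 / z ^ 128 \<le> 1 / z ^ 8 / 8"
    proof -
      have "8 \<le> z ^ 120" using z2[of 120] by simp
      then have "8 * z ^ 8 \<le> z ^ 120 * z ^ 8" using z0 by (intro mult_right_mono) auto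
      then show ?thesis using z0 by (simp add: field_simps flip: power_add)
    qed
    show "\<kappa> = 2 * ((20 * (sqrt N * z)\<^sup>2 * (1 / z ^ 128) + 2 / real (n\<^sup>2) ^ 2) / (N / z ^ 64)) + 2 * (N + 1) / real (n\<^sup>2) ^ 2"
      by (rule \<kappa>_def)
    show "(20 * (sqrt N * z)\<^sup>2 * (1 / z ^ 128) + 2 * (sqrt N * z)\<^sup>2 * \<kappa>) / (1 / z ^ 8)\<^sup>2 \<le> real (excess n)"
    proof -
      have "2 * (N * z\<^sup>2) * \<kappa> \<le> 2 * (N * z\<^sup>2) * (48 / z ^ 62)" using \<kappa> N z0 by (intro mult_left_mono) auto
      then have "(20 * (sqrt N * z)\<^sup>2 * (1 / z ^ 128) + 2 * (sqrt N * z)\<^sup>2 * \<kappa>) / (1 / z ^ 8)\<^sup>2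
         \<le> (20 * (N * z\<^sup>2) * (1 / z ^ 128) + 2 * (N * z\<^sup>2) * (48 / z ^ 62)) / (1 / z ^ 8)\<^sup>2"
        unfolding \<Lambda>2 by (intro divide_right_mono add_left_mono) auto
      also have "\<dots> = 20 * (N * (z\<^sup>2 * z ^ 16 / z ^ 128)) + 96 * (N * (z\<^sup>2 * z ^ 16 / z ^ 62))"
      proof -
        define w where "w = z ^ 16"
        have "(1 / z ^ 8)\<^sup>2 = 1 / w" by (simp add: w_def power_divide flip: power_mult)
        then show ?thesis unfolding w_def[symmetric] by (simp add: algebra_simps)
      qed
      also have "z\<^sup>2 * z ^ 16 / z ^ 128 = 1 / z ^ 110" using z0 by (simp add: field_simps flip: power_add)
      also have "z\<^sup>2 * z ^ 16 / z ^ 62 = 1 / z ^ 44" using z0 by (simp add: field_simps flip: power_add)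
      also have "20 * (N * (1 / z ^ 110)) + 96 * (N * (1 / z ^ 44)) \<le> 20 * (N * (1 / z ^ 6)) + 96 * (N * (1 / z ^ 6))"
        using N z0 by (intro add_mono mult_left_mono divide_left_mono zp) auto
      also have "\<dots> = 116 * (N / z ^ 6)" by simp
      also have "\<dots> \<le> c_count * (N / z ^ 6)" using c_count_pos(1) N z0 by (intro mult_right_mono) auto
      also have "\<dots> \<le> real (excess n)" using r(4) by simp
      finally show ?thesis .
    qed
    show "1 < rich_dim n" by (rule k1pos)
    show "4 / ((p * (1 - p))\<^sup>2 * (real (rich_dim n) - 1)) \<le> 1"
      using \<rho>' n(5) N by (intro order_trans[OF \<rho>']) simp
    show "12 * (N / z ^ 64) * N / real (rich_dim n) \<le> p * (1 - p) * (real (rich_dim n) - 1) / 2"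
    proof -
      have "12 * (N / z ^ 64) * N / real (rich_dim n) \<le> 12 * (N / z ^ 64) * N / (frac * N)"
        using r(6) frac_pos N z0 n(4) by (intro divide_left_mono mult_pos_pos) auto
      also have "\<dots> = (48 / (p * (1 - p) * frac\<^sup>2)) / z ^ 64 * (p * (1 - p) * (frac * N / 2) / 2)"
      proof -
        have "12 * (N / w) * N / (d * N) = (48 / (P * d\<^sup>2)) / w * (P * (d * N / 2) / 2)"
          if "0 < P" "0 < d" "0 < w" for P d w :: real
          using that N by (simp add: field_simps power2_eq_square)
        from this[OF pq_pos frac_pos, of "z ^ 64"] show ?thesis using z0 by simp
      qed
      also have "\<dots> \<le> 1 * (p * (1 - p) * (frac * N / 2) / 2)"
      proof (rule mult_right_mono)
        have "0 < z ^ 64" using z0 by simp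
        then show "48 / (p * (1 - p) * frac\<^sup>2) / z ^ 64 \<le> 1" using n(6) by (simp only: divide_le_eq_1_pos)
        show "0 \<le> p * (1 - p) * (frac * N / 2) / 2" using pq_pos frac_pos N by simp
      qed
      also have "\<dots> \<le> p * (1 - p) * (real (rich_dim n) - 1) / 2"
        using r(7) pq_pos by (simp only: mult_1_left) (intro divide_right_mono mult_left_mono, auto)
      finally show ?thesis .
    qed
    show "c_ball / z ^ 4 = 8 * (1 / z ^ 8) / sqrt (p * (1 - p) * (1 / z ^ 8))" by (rule p0[symmetric])
    show "c_ball / z ^ 4 \<le> 1" using n(7) z0 by simp
  qed (use \<kappa>1 \<kappa>2 in auto)
  then show ?thesis unfolding Dr by (simp only: N_def z_def)
qed

lemma eventually_scaled_le:
  fixes f :: "nat \<Rightarrow> real"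
  assumes "f \<longlonglongrightarrow> 0" "0 < d"
  shows "eventually (\<lambda>n. c * f n \<le> d) sequentially"
proof -
  have "(\<lambda>n. c * f n) \<longlonglongrightarrow> c * 0" by (intro tendsto_intros assms)
  then have "eventually (\<lambda>n. c * f n < d) sequentially" using assms(2) by (intro order_tendstoD(2)) auto
  then show ?thesis by eventually_elim simp
qed

text \<open>Beyond \<open>large\<close> and a rounding condition, the clauses compare exponents in
  \<open>bad_very_large\<close> after division by n, or solve such a comparison for ln n.\<close>

definition very_large :: "nat \<Rightarrow> bool" where
  "very_large n \<longleftrightarrow> large n \<and> 2 \<le> \<eta> * real n / 2
    \<and> 8 * ln (real n) - (scale n)\<^sup>2 / 128 \<le> - 1
    \<and> (12 + 2 * (c_count + 1)) * (ln (real n) / scale n ^ 6) \<le> - ln q0 / 8 \<and> 10 * (ln (real n) / real n) \<le> min 1 (- ln q0 / 8)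
    \<and> (2 + (c_count + 1)) * (- ln q0) * (1 / scale n ^ 6) \<le> - ln q0 / 8
    \<and> (c_count + 1) * (1 / scale n ^ 6) \<le> \<eta> / 4 \<and> 2 * (c_count + 1) * (ln (real n) / scale n ^ 6) \<le> 1
    \<and> (2 * ln 2 + 2 + frac / 2 * ln c_rich) / (frac / 2) \<le> ln (real n)
    \<and> (ln 2 + 3 + \<eta> / 4 * ln c_ball) / (\<eta> * \<epsilon> / 128) \<le> ln (real n)"

lemma lq_pos: "0 < - ln q0" using q0_bounds by (simp add: ln_less_zero)

lemma eventually_very_large: "eventually very_large sequentially"
proof -
  have 1: "(\<lambda>n. ln (real n) / scale n ^ 6) \<longlonglongrightarrow> 0" unfolding scale_def using \<epsilon> by real_asymp
  have 2: "(\<lambda>n. ln (real n) / real n) \<longlonglongrightarrow> 0" by real_asymp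
  have 3: "(\<lambda>n. 1 / scale n ^ 6) \<longlonglongrightarrow> 0" unfolding scale_def using \<epsilon> by real_asymp
  have 4: "eventually (\<lambda>n. c \<le> ln (real n)) sequentially" for c by real_asymp
  have 5: "eventually (\<lambda>n. 8 * ln (real n) - (scale n)\<^sup>2 / 128 \<le> - 1) sequentially" unfolding scale_def using \<epsilon> by real_asymp
  have 6: "eventually (\<lambda>n. 2 \<le> \<eta> * real n / 2) sequentially" using \<eta> by real_asymp
  show ?thesis unfolding very_large_def
    by (intro eventually_conj eventually_large eventually_scaled_le 1 2 3 4 5 6)
      (use lq_pos \<eta> in auto)
qed

lemma bad_very_large:
  assumes V: "eigenvector_choice V" and L: "very_large n"
  shows "Pr (all_edges n) (\<lambda>B. \<not> good n (sqrt (real n) * scale n) (1 / scale n ^ 8) (1 / scale n ^ 8) (coord_size n) (few_coords n) B)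
    \<le> 3 * exp (- real n) + exp (- (- ln q0 / 2) * real n)"
proof -
  define l where "l = ln (real n)"
  define z where "z = scale n"
  define C2 where "C2 = c_count + 1"
  define lq where "lq = - ln q0"
  have L1: "large n" using L by (simp add: very_large_def)
  have n: "3 \<le> n" "10 \<le> z" "c_rich \<le> real n" "c_ball \<le> z ^ 4" using L1 by (auto simp: large_def z_def)
  note r = large_rounding[OF L1, folded z_def C2_def]
  have v: "2 \<le> \<eta> * real n / 2" "8 * l - z\<^sup>2 / 128 \<le> - 1" "(12 + 2 * C2) * (l / z ^ 6) \<le> lq / 8"
    "10 * (l / real n) \<le> 1" "10 * (l / real n) \<le> lq / 8" "(2 + C2) * lq * (1 / z ^ 6) \<le> lq / 8" "C2 * (1 / z ^ 6) \<le> \<eta> / 4" "2 * C2 * (l / z ^ 6) \<le> 1"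
    "(2 * ln 2 + 2 + frac / 2 * ln c_rich) / (frac / 2) \<le> l" "(ln 2 + 3 + \<eta> / 4 * ln c_ball) / (\<eta> * \<epsilon> / 128) \<le> l"
    using L by (auto simp: very_large_def l_def z_def C2_def lq_def)
  note pb = poly_exp_bounds[OF n(1), folded l_def]
  have N0: "0 < real n" using n by simp
  have l0: "0 \<le> l" using n by (simp add: l_def)
  have z0: "0 < z" using n by simp
  have C2: "0 \<le> C2" using c_count_pos by (simp add: C2_def)
  have lq: "0 < lq" using lq_pos by (simp add: lq_def)
  have two: "(2::real) ^ n = exp (real n * ln 2)" by (simp add: exp_of_nat_mult)
  have l_le: "10 * l \<le> real n" "10 * l \<le> real n * (lq / 8)" using v(4,5) N0 by (auto simp: field_simps)
  have TN: "(2 * real n ^ 2 + 1) ^ (2 * n) * exp (- ((sqrt (real n) * z - 1)\<^sup>2 / 32)) \<le> exp (- real n)"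
  proof -
    have "1 \<le> sqrt (real n)" using n by simp
    then have "1 * 10 \<le> sqrt (real n) * z" using n by (intro mult_mono) auto
    then have "sqrt (real n) * z / 2 \<le> sqrt (real n) * z - 1" by linarith
    then have "(sqrt (real n) * z / 2)\<^sup>2 \<le> (sqrt (real n) * z - 1)\<^sup>2" using z0 by (intro power_mono) auto
    then have 1: "real n * z\<^sup>2 / 128 \<le> (sqrt (real n) * z - 1)\<^sup>2 / 32" by (simp add: power_mult_distrib power_divide)
    have "(2 * real n ^ 2 + 1) ^ (2 * n) * exp (- ((sqrt (real n) * z - 1)\<^sup>2 / 32))
      \<le> exp (real (2 * n) * (4 * l)) * exp (- (real n * z\<^sup>2 / 128))"
      using 1 by (intro mult_mono power_le_exp pb) auto
    also have "\<dots> = exp (real n * (8 * l - z\<^sup>2 / 128))" by (simp add: exp_add[symmetric] right_diff_distrib mult_ac)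
    also have "\<dots> \<le> exp (real n * (- 1))" using v(2) by (simp only: exp_le_cancel_iff) (intro mult_left_mono, auto)
    finally show ?thesis by simp
  qed
  \<comment> \<open>\<open>support n\<close> and \<open>excess n\<close> are of order at most n/z^6,
    so the entropy is of order n ln n/z^6 and hence o(n). The gain is \<open>lq\<close> times nearly
    n, of which half is kept.\<close>
  have TS: "(real n + 1) ^ support n * (2 * real n ^ 2 + 1) ^ support n * (2 * real n * real n ^ 2 + 1) * (real n + 1) ^ excess n * q0 powr (real n - real (support n) - real (excess n))
    \<le> exp (- (lq / 2) * real n)"
  proof -
    define K where "K = real (support n)"
    define k where "k = real (excess n)"
    define w where "w = real n / z ^ 6"
    have q: "q0 powr (real n - K - k) = exp (- ((real n - K - k) * lq))"
      using q0_bounds by (simp add: powr_def lq_def)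
    have "(real n + 1) ^ support n * (2 * real n ^ 2 + 1) ^ support n * (2 * real n * real n ^ 2 + 1) * (real n + 1) ^ excess n * q0 powr (real n - K - k)
      \<le> exp (K * (2 * l)) * exp (K * (4 * l)) * exp (5 * l) * exp (k * (2 * l)) * exp (- ((real n - K - k) * lq))"
      unfolding K_def k_def q[unfolded K_def k_def] by (intro mult_mono power_le_exp pb mult_nonneg_nonneg) auto
    also have "\<dots> = exp (K * (6 * l + lq) + 5 * l + k * (2 * l + lq) - real n * lq)"
      by (simp add: exp_add[symmetric] algebra_simps)
    also have "\<dots> \<le> exp (- (lq / 2) * real n)" unfolding exp_le_cancel_iff
    proof -
      have "K * (6 * l + lq) \<le> 2 * w * (6 * l + lq)" using r(2) l0 lq by (intro mult_right_mono) (auto simp: K_def w_def)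
      moreover have "k * (2 * l + lq) \<le> C2 * w * (2 * l + lq)" using r(5) l0 lq by (intro mult_right_mono) (auto simp: k_def w_def)
      moreover have "2 * w * (6 * l + lq) + C2 * w * (2 * l + lq) = real n * ((12 + 2 * C2) * (l / z ^ 6) + (2 + C2) * lq * (1 / z ^ 6))"
        by (simp add: w_def algebra_simps add_divide_distrib)
      moreover have "\<dots> \<le> real n * (lq / 8 + lq / 8)" using v(3,6) by (intro mult_left_mono add_mono) auto
      moreover have "5 * l \<le> real n * (lq / 8)" using l_le(2) l0 by linarith
      ultimately show "K * (6 * l + lq) + 5 * l + k * (2 * l + lq) - real n * lq \<le> - (lq / 2) * real n"
        using mult_pos_pos[OF N0 lq] by (simp add: algebra_simps)
    qed
    finally show ?thesis by (simp only: K_def k_def)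
  qed
  \<comment> \<open>The gain \<open>frac / 2 * real n * l\<close> carries a logarithm, which
    eventually beats the two factors 2^n.\<close>
  have TR: "2 ^ n * ((2 * real n * real n ^ 2 + 1) * (2 ^ n * (4 / ((p * (1 - p))\<^sup>2 * (real (rich_dim n) - 1))) powr (real (rich_dim n) / 2))) \<le> exp (- real n)"
  proof -
    have k1: "1 < real (rich_dim n)" using r(6,7) L1 by (auto simp: large_def)
    have "4 / ((p * (1 - p))\<^sup>2 * (real (rich_dim n) - 1)) \<le> 4 / ((p * (1 - p))\<^sup>2 * (frac * real n / 2))"
      using r(7) p_pos p_less_1 frac_pos N0 k1 by (intro divide_left_mono mult_left_mono mult_pos_pos) auto
    also have "\<dots> = c_rich / real n" by (simp add: c_rich_def)
    finally have \<rho>: "4 / ((p * (1 - p))\<^sup>2 * (real (rich_dim n) - 1)) \<le> c_rich / real n" .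
    have "(4 / ((p * (1 - p))\<^sup>2 * (real (rich_dim n) - 1))) powr (real (rich_dim n) / 2) \<le> (c_rich / real n) powr (real (rich_dim n) / 2)"
      using \<rho> k1 p_pos p_less_1 by (intro powr_mono2) auto
    also have "\<dots> \<le> (c_rich / real n) powr (frac * real n / 2)"
      using r(6) n(3) c_rich_pos N0 by (intro powr_mono') auto
    also have "\<dots> = exp (frac * real n / 2 * (ln c_rich - l))"
      using c_rich_pos N0 by (simp add: powr_def ln_div l_def)
    finally have \<rho>2: "(4 / ((p * (1 - p))\<^sup>2 * (real (rich_dim n) - 1))) powr (real (rich_dim n) / 2) \<le> exp (frac * real n / 2 * (ln c_rich - l))" .
    have "2 ^ n * ((2 * real n * real n ^ 2 + 1) * (2 ^ n * (4 / ((p * (1 - p))\<^sup>2 * (real (rich_dim n) - 1))) powr (real (rich_dim n) / 2)))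
      \<le> exp (real n * ln 2) * (exp (5 * l) * (exp (real n * ln 2) * exp (frac * real n / 2 * (ln c_rich - l))))"
      unfolding two using \<rho>2 by (intro mult_mono pb mult_nonneg_nonneg order_refl) auto
    also have "\<dots> = exp (5 * l + real n * (2 * ln 2 + (frac / 2 * ln c_rich - frac / 2 * l)))"
      by (simp add: exp_add[symmetric] field_simps)
    also have "\<dots> \<le> exp (- real n)" unfolding exp_le_cancel_iff
    proof -
      have "2 * ln 2 + 2 + frac / 2 * ln c_rich \<le> l * (frac / 2)" using v(9) frac_pos by (simp only: pos_divide_le_eq half_gt_zero)
      then have "real n * (2 * ln 2 + (frac / 2 * ln c_rich - frac / 2 * l)) \<le> real n * (- 2)" by (intro mult_left_mono) (auto simp: mult.commute)
      then show "5 * l + real n * (2 * ln 2 + (frac / 2 * ln c_rich - frac / 2 * l)) \<le> - real n" using l_le(1) l0 by linarith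
    qed
    finally show ?thesis .
  qed
  have TF: "2 ^ n * ((2 * real n * real n ^ 2 + 1) * ((4 * real n ^ 2 + 1) ^ (4 * rich_dim n) * ((4 * real n * real n ^ 2 + 1) * ((real n + 1) ^ excess n * (c_ball / z ^ 4) powr (real (few_coords n) - real (excess n)))))) \<le> exp (- real n)"
  proof -
    have excess: "real (excess n) \<le> \<eta> / 4 * real n"
    proof -
      have "real (excess n) \<le> real n * (C2 * (1 / z ^ 6))" using r(5) by (simp add: mult_ac)
      also have "\<dots> \<le> real n * (\<eta> / 4)" using v(7) by (intro mult_left_mono) auto
      finally show ?thesis by (simp add: mult.commute)
    qed
    have mk: "\<eta> / 4 * real n \<le> real (few_coords n) - real (excess n)" using r(10) v(1) excess by linarith
    have "(c_ball / z ^ 4) powr (real (few_coords n) - real (excess n)) \<le> (c_ball / z ^ 4) powr (\<eta> / 4 * real n)"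
      using mk n(4) c_ball_pos z0 by (intro powr_mono') auto
    also have "\<dots> = exp (\<eta> / 4 * real n * (ln c_ball - \<epsilon> / 16 * l))"
    proof -
      have "ln (z ^ 4) = \<epsilon> / 16 * l" using N0 by (simp add: z_def scale_def l_def ln_realpow ln_powr)
      then show ?thesis using c_ball_pos z0 by (simp add: powr_def ln_div)
    qed
    finally have p0: "(c_ball / z ^ 4) powr (real (few_coords n) - real (excess n)) \<le> exp (\<eta> / 4 * real n * (ln c_ball - \<epsilon> / 16 * l))" .
    have "2 ^ n * ((2 * real n * real n ^ 2 + 1) * ((4 * real n ^ 2 + 1) ^ (4 * rich_dim n) * ((4 * real n * real n ^ 2 + 1) * ((real n + 1) ^ excess n * (c_ball / z ^ 4) powr (real (few_coords n) - real (excess n))))))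
      \<le> exp (real n * ln 2) * (exp (5 * l) * (exp (real (4 * rich_dim n) * (4 * l)) * (exp (5 * l) * (exp (real (excess n) * (2 * l)) * exp (\<eta> / 4 * real n * (ln c_ball - \<epsilon> / 16 * l))))))"
      unfolding two using p0 by (intro mult_mono pb power_le_exp mult_nonneg_nonneg order_refl) auto
    also have "\<dots> = exp (real n * ln 2 + 10 * l + 16 * (real (rich_dim n) * l) + 2 * (real (excess n) * l) + \<eta> / 4 * real n * (ln c_ball - \<epsilon> / 16 * l))"
      by (simp add: exp_add[symmetric] mult_ac)
    also have "\<dots> \<le> exp (- real n)" unfolding exp_le_cancel_iff
    proof -
      have a: "real (rich_dim n) * l \<le> 2 * frac * real n * l" using r(8) l0 by (intro mult_right_mono) auto
      have b: "2 * (real (excess n) * l) \<le> real n"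
      proof -
        have "real (excess n) * l \<le> C2 * (real n / z ^ 6) * l" using r(5) l0 by (intro mult_right_mono) auto
        moreover have "real n * (2 * C2 * (l / z ^ 6)) = 2 * (C2 * (real n / z ^ 6) * l)" by simp
        ultimately have "2 * (real (excess n) * l) \<le> real n * (2 * C2 * (l / z ^ 6))" by linarith
        also have "\<dots> \<le> real n * 1" using v(8) by (intro mult_left_mono) auto
        finally show ?thesis by simp
      qed
      have pos: "0 < \<eta> * \<epsilon> / 128" using \<eta> \<epsilon> by simp
      have "ln 2 + 3 + \<eta> / 4 * ln c_ball \<le> l * (\<eta> * \<epsilon> / 128)" using v(10) pos by (simp only: pos_divide_le_eq)
      then have c: "real n * (ln 2 + 3 + \<eta> / 4 * ln c_ball) \<le> real n * (l * (\<eta> * \<epsilon> / 128))" by (intro mult_left_mono) auto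
      \<comment> \<open>This is where 4096 comes from: the net costs at most
        \<open>32 * frac * real n * l\<close>, a multiple \<eta>\<epsilon>/128 of
        \<open>real n * l\<close>, exactly half of the small ball gain \<eta>\<epsilon>/64.\<close>
      have d: "16 * (2 * frac * real n * l) = real n * (l * (\<eta> * \<epsilon> / 128))" by (simp add: frac_def)
      have e: "\<eta> / 4 * real n * (ln c_ball - \<epsilon> / 16 * l) = real n * (\<eta> / 4 * ln c_ball) - 2 * (real n * (l * (\<eta> * \<epsilon> / 128)))"
        by (simp add: algebra_simps)
      have f: "real n * (ln 2 + 3 + \<eta> / 4 * ln c_ball) = real n * ln 2 + 3 * real n + real n * (\<eta> / 4 * ln c_ball)"
        by (simp add: algebra_simps)
      show "real n * ln 2 + 10 * l + 16 * (real (rich_dim n) * l) + 2 * (real (excess n) * l) + \<eta> / 4 * real n * (ln c_ball - \<epsilon> / 16 * l) \<le> - real n"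
        using a b c d e f l_le(1) by linarith
    qed
    finally show ?thesis .
  qed
  show ?thesis
    using bad_large[OF V L1, folded z_def] TN TS TR TF
    unfolding z_def[symmetric] distrib_left lq_def by linarith
qed

lemma small_at_very_large:
  "\<exists>n0. \<forall>n\<ge>n0. \<forall>V i j. eigenvector_choice V \<longrightarrow> Suc i < n \<longrightarrow> j < n \<longrightarrow>
     Pr (all_edges n) (small_at n i (real n powr (- 1 / 2 - \<epsilon>)) j) \<le> 2 * \<eta>"
proof -
  define f where "f n = 4 * (3 * exp (- real n) + exp (- (- ln q0 / 2) * real n)) + 4 * (2 / sqrt (p * (1 - p)) * (1 / scale n ^ 4))" for n
  have 1: "(\<lambda>n. exp (- c * real n)) \<longlonglongrightarrow> 0" if "0 < c" for c :: real using that by real_asymp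
  have 2: "(\<lambda>n. 1 / scale n ^ 4) \<longlonglongrightarrow> 0" unfolding scale_def using \<epsilon> by real_asymp
  have "f \<longlonglongrightarrow> 4 * (3 * 0 + 0) + 4 * (2 / sqrt (p * (1 - p)) * 0)"
    unfolding f_def using 1[of 1] 1[of "- ln q0 / 2"] lq_pos by (intro tendsto_intros 2) auto
  then have "eventually (\<lambda>n. f n < \<eta>) sequentially" using \<eta> by (intro order_tendstoD(2)) auto
  then have "eventually (\<lambda>n. very_large n \<and> f n < \<eta>) sequentially"
    using eventually_very_large by (rule eventually_conj[rotated])
  then obtain n0 where n0: "\<And>n. n0 \<le> n \<Longrightarrow> very_large n \<and> f n < \<eta>" by (auto simp: eventually_sequentially)
  show ?thesis
  proof (intro exI[of _ n0] allI impI)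
    fix n V i j assume n: "n0 \<le> n" and V: "eigenvector_choice V" and i: "Suc i < n" and j: "j < n"
    have L: "very_large n" and fn: "f n < \<eta>" using n0[OF n] by auto
    have L1: "large n" using L by (simp add: very_large_def)
    have z: "10 \<le> scale n" and n3: "3 \<le> n" using L1 by (auto simp: large_def)
    have s: "coord_size n = real n powr (- 1 / 2 - \<epsilon>)"
    proof -
      have "scale n ^ 64 = real n powr \<epsilon>" using n3 by (simp add: scale_def powr_powr flip: powr_realpow)
      then show ?thesis using n3 by (simp add: coord_size_def powr_half_sqrt[symmetric] powr_diff powr_minus_divide)
    qed
    have "1 \<le> sqrt (real n)" using n3 by simp
    then have "1 * 10 \<le> sqrt (real n) * scale n" using z by (intro mult_mono) auto
    then have \<Lambda>: "1 \<le> sqrt (real n) * scale n" by simp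
    have m: "2 * few_coords n \<le> n"
    proof -
      have "real (few_coords n) \<le> \<eta> * real n" using large_rounding(9)[OF L1] .
      also have "\<dots> \<le> 1 / 2 * real n" using \<eta> by (intro mult_right_mono) auto
      finally show ?thesis by simp
    qed
    have p0: "2 * (1 / scale n ^ 8) / sqrt (p * (1 - p) * (1 / scale n ^ 8)) = 2 / sqrt (p * (1 - p)) * (1 / scale n ^ 4)"
    proof -
      have "sqrt (scale n ^ 8) = scale n ^ 4" using z by (intro real_sqrt_unique) (auto simp flip: power_mult)
      then have "sqrt (p * (1 - p) * (1 / scale n ^ 8)) = sqrt (p * (1 - p)) / scale n ^ 4" by (simp add: real_sqrt_divide)
      then have "2 * (1 / scale n ^ 8) / sqrt (p * (1 - p) * (1 / scale n ^ 8)) = (2 / sqrt (p * (1 - p))) * (scale n ^ 4 / scale n ^ 8)" by simp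
      also have "scale n ^ 4 / scale n ^ 8 = 1 / scale n ^ 4" using z by (simp add: field_simps flip: power_add)
      finally show ?thesis .
    qed
    have "Pr (all_edges n) (small_at n i (coord_size n) j)
      \<le> few_coords n / n + 4 * Pr (all_edges n) (\<lambda>B. \<not> good n (sqrt (real n) * scale n) (1 / scale n ^ 8) (1 / scale n ^ 8) (coord_size n) (few_coords n) B)
        + 4 * (2 * (1 / scale n ^ 8) / sqrt (p * (1 - p) * (1 / scale n ^ 8)))"
      using z by (intro small_at_le[OF V \<Lambda> _ _ i j m]) (auto simp: coord_size_def)
    also have "\<dots> \<le> \<eta> + f n"
    proof -
      have "few_coords n / n \<le> \<eta>" using large_rounding(9)[OF L1] n3 by (simp add: pos_divide_le_eq)
      then show ?thesis unfolding p0 f_def add.assoc[symmetric]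
        by (intro add_mono order_refl mult_left_mono bad_very_large[OF V L]) simp_all
    qed
    finally show "Pr (all_edges n) (small_at n i (real n powr (- 1 / 2 - \<epsilon>)) j) \<le> 2 * \<eta>" using fn s by simp
  qed
qed

end
end

text \<open>Take for each n the largest index k up to n whose threshold \<open>N k\<close> has been
  passed; every fixed k is eventually admissible, so this index tends to infinity.\<close>

lemma diagonal_sequence:
  fixes P :: "nat \<Rightarrow> nat \<Rightarrow> bool"
  assumes "\<And>k. eventually (P k) sequentially"
  obtains \<kappa> where "filterlim \<kappa> at_top sequentially" "eventually (\<lambda>n. P (\<kappa> n) n) sequentially"
proof -
  obtain N where N: "\<And>k n. N k \<le> n \<Longrightarrow> P k n"
    using assms unfolding eventually_sequentially by metis
  define A where "A n = {k. k \<le> n \<and> N k \<le> n}" for n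
  define \<kappa> where "\<kappa> n = Max (A n)" for n
  have fin: "finite (A n)" for n by (simp add: A_def)
  have "filterlim \<kappa> at_top sequentially"
    unfolding filterlim_at_top
  proof
    fix k
    have "k \<le> \<kappa> n" if "max k (N k) \<le> n" for n
      using that fin by (auto simp: \<kappa>_def A_def intro!: Max_ge)
    then show "eventually (\<lambda>n. k \<le> \<kappa> n) sequentially"
      unfolding eventually_sequentially by blast
  qed
  moreover have "P (\<kappa> n) n" if "N 0 \<le> n" for n
  proof -
    have "0 \<in> A n" using that by (simp add: A_def)
    then have "\<kappa> n \<in> A n" unfolding \<kappa>_def using fin by (intro Max_in) auto
    then show ?thesis using N by (simp add: A_def)
  qed
  then have "eventually (\<lambda>n. P (\<kappa> n) n) sequentially" by (auto simp: eventually_sequentially)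
  ultimately show ?thesis by (rule that)
qed

theorem theorem6p4:
  fixes p \<alpha> :: real
  assumes "0 < p" and "p < 1" and "\<alpha> > 0"
  shows "\<exists>C c\<^sub>1 :: real. \<exists>e\<^sub>1 e\<^sub>2 :: nat \<Rightarrow> real.
           C > 0 \<and> c\<^sub>1 > 0 \<and> e\<^sub>1 \<longlonglongrightarrow> 0 \<and> e\<^sub>2 \<longlonglongrightarrow> 0 \<and>
           (\<forall>V. eigenvector_choice V \<longrightarrow>
             (\<forall>n \<ge> 2. \<forall>\<delta> > real n powr (- \<alpha>).
               (SUP i \<in> {..<n - 1}. SUP j \<in> {..<n}.
                  measure_pmf.prob (random_graph n p)
                    {E. \<bar>vec_index (V (adjacency_mat n E) i) j\<bar> \<le> \<delta> / (sqrt (real n) * ln (real n) powr c\<^sub>1)})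
               \<le> C * real n powr e\<^sub>1 n * \<delta> + e\<^sub>2 n))"
proof -
  interpret bernoulli_sets p using assms by unfold_locales
  \<comment> \<open>One null sequence serves both purposes: the k-th instance uses \<epsilon> =
    \<open>r k\<close> and \<eta> = \<open>r k / 2\<close>, so that the probability bound
    \<open>2 * \<eta>\<close> is \<open>r k\<close> again.\<close>
  define r where "r k = 1 / (real k + 1)" for k
  define P where "P k n \<longleftrightarrow> (\<forall>V i j. eigenvector_choice V \<longrightarrow> Suc i < n \<longrightarrow> j < n \<longrightarrow>
     Pr (all_edges n) (small_at n i (real n powr (- 1 / 2 - r k)) j) \<le> r k)" for k n
  have "eventually (P k) sequentially" for k
  proof -
    have "0 < r k" "r k \<le> 1" by (simp_all add: r_def)
    then show ?thesis
      using small_at_very_large[of "r k" "r k / 2"] by (simp add: P_def eventually_sequentially)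
  qed
  then obtain \<kappa> where \<kappa>: "filterlim \<kappa> at_top sequentially" "eventually (\<lambda>n. P (\<kappa> n) n) sequentially"
    by (rule diagonal_sequence)
  have r0: "r \<longlonglongrightarrow> 0" unfolding r_def by real_asymp
  define e\<^sub>1 where "e\<^sub>1 n = r (\<kappa> n)" for n
  \<comment> \<open>The value 1 makes the claim trivial for the finitely many n where the asymptotic
    bound is not yet available, so that it holds for all n from 2 on.\<close>
  define e\<^sub>2 where "e\<^sub>2 n = (if 3 \<le> n \<and> P (\<kappa> n) n then r (\<kappa> n) else 1)" for n
  have lim: "e\<^sub>1 \<longlonglongrightarrow> 0" unfolding e\<^sub>1_def by (rule filterlim_compose[OF r0 \<kappa>(1)])
  have "eventually (\<lambda>n. e\<^sub>1 n = e\<^sub>2 n) sequentially"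
    using \<kappa>(2) eventually_ge_at_top[of 3] by eventually_elim (simp add: e\<^sub>1_def e\<^sub>2_def)
  then have lim2: "e\<^sub>2 \<longlonglongrightarrow> 0" using lim by (rule Lim_transform_eventually[rotated])
  have bound: "measure_pmf.prob (random_graph n p)
       {E. \<bar>vec_index (V (adjacency_mat n E) i) j\<bar> \<le> \<delta> / (sqrt (real n) * ln (real n) powr 1)}
     \<le> 1 * real n powr e\<^sub>1 n * \<delta> + e\<^sub>2 n"
    if V: "eigenvector_choice V" and n: "2 \<le> n" and \<delta>: "real n powr (- \<alpha>) < \<delta>"
      and i: "Suc i < n" and j: "j < n" for V n \<delta> i j
  proof -
    let ?E = "{E. \<bar>vec_index (V (adjacency_mat n E) i) j\<bar> \<le> \<delta> / (sqrt (real n) * ln (real n) powr 1)}"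
    have \<delta>0: "0 < \<delta>" using \<delta> n by (intro order.strict_trans[OF _ \<delta>]) simp
    then have nn: "0 \<le> real n powr e\<^sub>1 n * \<delta>" by simp
    have e2: "0 \<le> e\<^sub>2 n" by (simp add: e\<^sub>2_def r_def)
    \<comment> \<open>In the second case the right hand side is already at least 1. In the third,
      \<delta> is below n to the power \<open>- e\<^sub>1 n\<close>, so the threshold on the
      coordinate falls below n^(-1/2-\<epsilon>) with \<epsilon> =
      \<open>e\<^sub>1 n\<close>.\<close>
    consider "\<not> (3 \<le> n \<and> P (\<kappa> n) n)" | "1 \<le> real n powr e\<^sub>1 n * \<delta>"
      | "3 \<le> n" "P (\<kappa> n) n" "real n powr e\<^sub>1 n * \<delta> < 1" by linarith
    then show ?thesis
    proof cases
      case 1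
      then have "e\<^sub>2 n = 1" by (simp only: e\<^sub>2_def if_False)
      then show ?thesis using nn measure_pmf.prob_le_1[of "random_graph n p" ?E] by linarith
    next
      case 2
      then show ?thesis using e2 measure_pmf.prob_le_1[of "random_graph n p" ?E] by linarith
    next
      case 3
      \<comment> \<open>With n at least 3 the logarithmic factor is at least 1, so it only shrinks
        the threshold and the exponent 1 will do for \<open>c\<^sub>1\<close>.\<close>
      have ln: "1 \<le> ln (real n)"
        using 3(1) exp_le by (subst ln_ge_iff) auto
      have s: "0 < sqrt (real n)" using n by simp
      have le: "\<delta> / (sqrt (real n) * ln (real n) powr 1) \<le> real n powr (- 1 / 2 - r (\<kappa> n))"
      proof -
        have "\<delta> / (sqrt (real n) * ln (real n) powr 1) \<le> \<delta> / (sqrt (real n) * 1)"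
          using ln s \<delta>0 n by (intro divide_left_mono mult_left_mono mult_pos_pos) auto
        also have "\<dots> \<le> real n powr (- e\<^sub>1 n) / (sqrt (real n) * 1)"
          using 3(3) n s by (intro divide_right_mono) (auto simp: powr_minus_divide field_simps)
        also have "\<dots> = real n powr (- e\<^sub>1 n) * real n powr (- (1 / 2))"
          using n by (simp add: powr_minus_divide powr_half_sqrt)
        also have "\<dots> = real n powr (- 1 / 2 - r (\<kappa> n))"
        proof -
          have "- 1 / 2 - r (\<kappa> n) = - e\<^sub>1 n + - (1 / 2)" by (simp add: e\<^sub>1_def)
          then show ?thesis by (simp only: powr_add)
        qed
        finally show ?thesis .
      qed
      have "measure_pmf.prob (random_graph n p) ?E = Pr (all_edges n) (\<lambda>B. B \<in> ?E)"
        by (rule prob_random_graph)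
      also have "\<dots> \<le> Pr (all_edges n) (small_at n i (real n powr (- 1 / 2 - r (\<kappa> n))) j)"
      proof (rule Pr_mono)
        fix B assume "B \<subseteq> all_edges n" "B \<in> ?E"
        then have "\<bar>eigvec V n B i j\<bar> \<le> real n powr (- 1 / 2 - r (\<kappa> n))"
          using le by (simp add: eigvec_def)
        moreover have "i < n" using i by simp
        ultimately show "small_at n i (real n powr (- 1 / 2 - r (\<kappa> n))) j B"
          unfolding small_at_def using eigvec_eig[OF V] by blast
      qed
      also have "\<dots> \<le> r (\<kappa> n)" using 3(2) V i j unfolding P_def by blast
      also have "\<dots> = e\<^sub>2 n" using 3 by (simp add: e\<^sub>2_def)
      finally show ?thesis using nn by linarith
    qed
  qed
  \<comment> \<open>Both index sets are nonempty for n at least 2, which \<open>cSUP_least\<close>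
    requires on the reals.\<close>
  have sup: "(SUP i \<in> {..<n - 1}. SUP j \<in> {..<n}. f i j) \<le> b"
    if "2 \<le> n" "\<And>i j. Suc i < n \<Longrightarrow> j < n \<Longrightarrow> f i j \<le> b" for n b and f :: "nat \<Rightarrow> nat \<Rightarrow> real"
    using that by (intro cSUP_least) (auto simp: lessThan_empty_iff)
  show ?thesis
  proof (rule exI[of _ 1], rule exI[of _ 1], rule exI[of _ e\<^sub>1], rule exI[of _ e\<^sub>2], intro conjI lim lim2 allI impI)
    fix V n \<delta> assume "eigenvector_choice V" "2 \<le> n" "real n powr (- \<alpha>) < \<delta>"
    then show "(SUP i \<in> {..<n - 1}. SUP j \<in> {..<n}.
                  measure_pmf.prob (random_graph n p)
                    {E. \<bar>vec_index (V (adjacency_mat n E) i) j\<bar> \<le> \<delta> / (sqrt (real n) * ln (real n) powr 1)})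
               \<le> 1 * real n powr e\<^sub>1 n * \<delta> + e\<^sub>2 n"
      by (intro sup bound)
  qed simp_all
qed

end
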